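(* Let $R$ be an associative ring with identity and let $(\mathcal{A},\mathcal{B})$ be a complete and hereditary cotorsion pair in the category of left $R$-modules. Let $C$ be a complex of left $R$-modules. Then $C\in\mathcal{G}(\widetilde{\mathcal{A}})$ if and only if $C_i\in\mathcal{G}(\mathcal{A})$ for every $i\in\mathbb{Z}$.
   Context: Modules are unitary left $R$-modules; $C(R)$ is the category of complexes $\cdots\to C_{n+1}\to C_n\to C_{n-1}\to\cdots$ of $R$-modules; superscripts distinguish different complexes and subscripts denote degrees. ${\rm Hom}_{C(R)}(C,D)$ is the group of chain maps; ${\rm Hom}_R(C,D)$ denotes the usual Hom-complex, with degree-$n$ term $\prod_{i}{\rm Hom}_R(C_i,D_{n+i})$ and differential $(f_i)_i\mapsto(\delta^D_{n+i}f_i-(-1)^nf_{i-1}\delta^C_i)_i$. ${\rm Z}_n(X)$ is the $n$th cycle module of $X$. Cotorsion pairs: in an abelian category $\mathcal{D}$, a pair $(\mathcal{A},\mathcal{B})$ of classes of objects is a cotorsion pair if $\mathcal{B}=\{D\mid {\rm Ext}^1_{\mathcal{D}}(A,D)=0\ \forall A\in\mathcal{A}\}$ and $\mathcal{A}=\{D\mid {\rm Ext}^1_{\mathcal{D}}(D,B)=0\ \forall B\in\mathcal{B}\}$. It is complete if for every object $D$ there are short exact sequences $0\to B\to A\to D\to 0$ and $0\to D\to B'\to A'\to 0$ with $A,A'\in\mathcal{A}$ and $B,B'\in\mathcal{B}$. It is hereditary if ${\rm Ext}^i_{\mathcal{D}}(A,B)=0$ for all $A\in\mathcal{A}$, $B\in\mathcal{B}$,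 $i\geq 1$. Classes of complexes: $\widetilde{\mathcal{A}}$ (resp. $\widetilde{\mathcal{B}}$) is the class of exact complexes $X$ with ${\rm Z}_n(X)\in\mathcal{A}$ (resp. ${\rm Z}_n(X)\in\mathcal{B}$) for all $n\in\mathbb{Z}$. ${\rm dg}\widetilde{\mathcal{B}}$ is the class of complexes $X$ with each $X_n\in\mathcal{B}$ and ${\rm Hom}_R(A,X)$ exact for every $A\in\widetilde{\mathcal{A}}$. For a class $\mathcal{H}$ of objects of an abelian category $\mathcal{D}$, a sequence $\mathbf{S}$ in $\mathcal{D}$ is ${\rm Hom}_{\mathcal{D}}(-,\mathcal{H})$-exact if ${\rm Hom}_{\mathcal{D}}(\mathbf{S},H)$ is exact for every $H\in\mathcal{H}$. $\mathcal{G}(\mathcal{A})$ is the class of $R$-modules $M$ for which there is an exact and ${\rm Hom}_R(-,\mathcal{A}\cap\mathcal{B})$-exact sequence $\cdots\to A_1\to A_0\to A_{-1}\to\cdots$ of modules with each $A_i\in\mathcal{A}$ and $M\cong{\rm Im}(A_0\to A_{-1})$. $\mathcal{G}(\widetilde{\mathcal{A}})$ is the class of $R$-complexes $C$ for which there is an exact and ${\rm Hom}_{C(R)}(-,\widetilde{\mathcal{A}}\cap{\rm dg}\widetilde{\mathcal{B}})$-exact sequence $\cdots\to A^1\to A^0\to A^{-1}\to\cdots$ in $C(R)$ with each $A^i\in\widetilde{\mathcal{A}}$ and $C\cong{\rm Im}(A^0\to A^{-1})$. *)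

theory Defs
  imports "HOL-Algebra.Module" "HOL-Algebra.AbelCoset" "HOL-Algebra.Elementary_Groups"
    "HOL-Library.Equipollence"
begin

section \<open>Left modules over an associative ring\<close>

text \<open>
  The library locale \<^locale>\<open>module\<close> presupposes a commutative ring. The record of the same name
  is reused here; its fields \<^term>\<open>mult\<close> and \<^term>\<open>one\<close> carry no meaning for a module.
\<close>

locale left_module = R?: ring R + M?: abelian_group M
  for R :: "('r, 's) ring_scheme" (structure) and M :: "('r, 'm) module" (structure) +
  assumes smult_closed [simp, intro]:
      "\<lbrakk>a \<in> carrier R; x \<in> carrier M\<rbrakk> \<Longrightarrow> a \<odot>\<^bsub>M\<^esub> x \<in> carrier M"
    and smult_l_distr:
      "\<lbrakk>a \<in> carrier R; b \<in> carrier R; x \<in> carrier M\<rbrakk> \<Longrightarrow>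
        (a \<oplus>\<^bsub>R\<^esub> b) \<odot>\<^bsub>M\<^esub> x = a \<odot>\<^bsub>M\<^esub> x \<oplus>\<^bsub>M\<^esub> b \<odot>\<^bsub>M\<^esub> x"
    and smult_r_distr:
      "\<lbrakk>a \<in> carrier R; x \<in> carrier M; y \<in> carrier M\<rbrakk> \<Longrightarrow>
        a \<odot>\<^bsub>M\<^esub> (x \<oplus>\<^bsub>M\<^esub> y) = a \<odot>\<^bsub>M\<^esub> x \<oplus>\<^bsub>M\<^esub> a \<odot>\<^bsub>M\<^esub> y"
    and smult_assoc:
      "\<lbrakk>a \<in> carrier R; b \<in> carrier R; x \<in> carrier M\<rbrakk> \<Longrightarrow>
        (a \<otimes>\<^bsub>R\<^esub> b) \<odot>\<^bsub>M\<^esub> x = a \<odot>\<^bsub>M\<^esub> (b \<odot>\<^bsub>M\<^esub> x)"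
    and smult_one [simp]: "x \<in> carrier M \<Longrightarrow> \<one>\<^bsub>R\<^esub> \<odot>\<^bsub>M\<^esub> x = x"

text \<open>
  HOL cannot quantify over all carrier types inside a formula, so the category of left
  \<open>R\<close>-modules is taken relative to a family \<open>U\<close> of small subsets of a type \<open>'m\<close>: its objects are
  the modules whose carrier belongs to \<open>U\<close>. Smallness depends on cardinality only, is inherited by
  smaller sets, and some small set is infinite and at least as large as \<open>R\<close>. These conditions make
  the category abelian with enough projectives. If \<open>'m\<close> is a type of all sets (or a Grothendieck
  universe) and \<open>U\<close> consists of the subsets that are sets (or members of the universe), this is the
  usual category of left \<open>R\<close>-modules up to equivalence.
\<close>

definition module_universe :: "('r, 's) ring_scheme \<Rightarrow> 'm set set \<Rightarrow> bool" where
  "module_universe R U \<longleftrightarrow>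
     (\<forall>X\<in>U. \<forall>Y :: 'm set. lepoll Y X \<longrightarrow> Y \<in> U) \<and>
     (\<exists>X\<in>U. infinite X \<and> lepoll (carrier R) X)"

definition left_modules :: "('r, 's) ring_scheme \<Rightarrow> 'm set set \<Rightarrow> ('r, 'm) module set" where
  "left_modules R U = {M. left_module R M \<and> carrier M \<in> U}"

text \<open>Only the values of a homomorphism on the carrier matter.\<close>

definition mod_hom ::
    "('r, 's) ring_scheme \<Rightarrow> ('r, 'm) module \<Rightarrow> ('r, 'm) module \<Rightarrow> ('m \<Rightarrow> 'm) set" where
  "mod_hom R M N = {f \<in> carrier M \<rightarrow> carrier N.
     (\<forall>x\<in>carrier M. \<forall>y\<in>carrier M. f (x \<oplus>\<^bsub>M\<^esub> y) = f x \<oplus>\<^bsub>N\<^esub> f y) \<and>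
     (\<forall>a\<in>carrier R. \<forall>x\<in>carrier M. f (a \<odot>\<^bsub>M\<^esub> x) = a \<odot>\<^bsub>N\<^esub> f x)}"

definition mod_iso :: "('r, 's) ring_scheme \<Rightarrow> ('r, 'm) module \<Rightarrow> ('r, 'm) module \<Rightarrow> bool" where
  "mod_iso R M N \<longleftrightarrow> (\<exists>h \<in> mod_hom R M N. bij_betw h (carrier M) (carrier N))"

definition im_module ::
    "('m \<Rightarrow> 'm) \<Rightarrow> ('r, 'm) module \<Rightarrow> ('r, 'm) module \<Rightarrow> ('r, 'm) module" where
  "im_module f M N = N\<lparr>carrier := f ` carrier M\<rparr>"

text \<open>Exactness of \<open>X \<rightarrow> Y \<rightarrow> Z\<close> at \<open>Y\<close>, for (records extending) additive groups.\<close>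

definition exact_at ::
    "('a, 'p) ring_scheme \<Rightarrow> ('a \<Rightarrow> 'b) \<Rightarrow> ('b, 'q) ring_scheme \<Rightarrow> ('b \<Rightarrow> 'c) \<Rightarrow> ('c, 't) ring_scheme \<Rightarrow> bool"
  where
  "exact_at X f Y g Z \<longleftrightarrow> f ` carrier X = a_kernel Y Z g"

definition short_exact ::
    "('r, 's) ring_scheme \<Rightarrow> ('r, 'm) module \<Rightarrow> ('m \<Rightarrow> 'm) \<Rightarrow> ('r, 'm) module \<Rightarrow> ('m \<Rightarrow> 'm) \<Rightarrow>
      ('r, 'm) module \<Rightarrow> bool" where
  "short_exact R X f Y g Z \<longleftrightarrow>
     f \<in> mod_hom R X Y \<and> g \<in> mod_hom R Y Z \<and>
     inj_on f (carrier X) \<and> exact_at X f Y g Z \<and> g ` carrier Y = carrier Z"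

text \<open>
  The abelian group of homomorphisms. Its elements are extensional so that homomorphisms agreeing
  on the carrier are equal. The multiplicative fields of the record are irrelevant.
\<close>

definition hom_group ::
    "('r, 's) ring_scheme \<Rightarrow> ('r, 'm) module \<Rightarrow> ('r, 'm) module \<Rightarrow> ('m \<Rightarrow> 'm) ring" where
  "hom_group R M N =
     \<lparr>carrier = mod_hom R M N \<inter> extensional (carrier M),
      mult = undefined, one = undefined,
      zero = (\<lambda>x\<in>carrier M. \<zero>\<^bsub>N\<^esub>),
      add = (\<lambda>f g. \<lambda>x\<in>carrier M. f x \<oplus>\<^bsub>N\<^esub> g x)\<rparr>"


section \<open>Complexes\<close>

text \<open>\<open>diff C n\<close> is the differential from degree \<open>n\<close> to degree \<open>n - 1\<close>.\<close>

record ('r, 'm) chain_cpx =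
  obj :: "int \<Rightarrow> ('r, 'm) module"
  diff :: "int \<Rightarrow> 'm \<Rightarrow> 'm"

definition complexes :: "('r, 's) ring_scheme \<Rightarrow> 'm set set \<Rightarrow> ('r, 'm) chain_cpx set" where
  "complexes R U = {C. \<forall>n.
     obj C n \<in> left_modules R U \<and>
     diff C n \<in> mod_hom R (obj C n) (obj C (n - 1)) \<and>
     (\<forall>x\<in>carrier (obj C n). diff C (n - 1) (diff C n x) = \<zero>\<^bsub>obj C (n - 2)\<^esub>)}"

definition exact_cpx :: "('r, 'm) chain_cpx \<Rightarrow> bool" where
  "exact_cpx C \<longleftrightarrow>
     (\<forall>n. exact_at (obj C (n + 1)) (diff C (n + 1)) (obj C n) (diff C n) (obj C (n - 1)))"

definition cycle_module :: "('r, 'm) chain_cpx \<Rightarrow> int \<Rightarrow> ('r, 'm) module" where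
  "cycle_module C n = (obj C n)\<lparr>carrier := a_kernel (obj C n) (obj C (n - 1)) (diff C n)\<rparr>"

definition chain_maps ::
    "('r, 's) ring_scheme \<Rightarrow> ('r, 'm) chain_cpx \<Rightarrow> ('r, 'm) chain_cpx \<Rightarrow> (int \<Rightarrow> 'm \<Rightarrow> 'm) set" where
  "chain_maps R C D = {f. \<forall>n.
     f n \<in> mod_hom R (obj C n) (obj D n) \<and>
     (\<forall>x\<in>carrier (obj C n). f (n - 1) (diff C n x) = diff D n (f n x))}"

definition cpx_iso :: "('r, 's) ring_scheme \<Rightarrow> ('r, 'm) chain_cpx \<Rightarrow> ('r, 'm) chain_cpx \<Rightarrow> bool" where
  "cpx_iso R C D \<longleftrightarrow>
     (\<exists>h \<in> chain_maps R C D. \<forall>n. bij_betw (h n) (carrier (obj C n)) (carrier (obj D n)))"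

definition im_cpx ::
    "(int \<Rightarrow> 'm \<Rightarrow> 'm) \<Rightarrow> ('r, 'm) chain_cpx \<Rightarrow> ('r, 'm) chain_cpx \<Rightarrow> ('r, 'm) chain_cpx" where
  "im_cpx f C D = \<lparr>obj = (\<lambda>n. im_module (f n) (obj C n) (obj D n)), diff = diff D\<rparr>"

definition chain_map_group ::
    "('r, 's) ring_scheme \<Rightarrow> ('r, 'm) chain_cpx \<Rightarrow> ('r, 'm) chain_cpx \<Rightarrow> (int \<Rightarrow> 'm \<Rightarrow> 'm) ring" where
  "chain_map_group R C D =
     \<lparr>carrier = {f \<in> chain_maps R C D. \<forall>n. f n \<in> extensional (carrier (obj C n))},
      mult = undefined, one = undefined,
      zero = (\<lambda>n. \<lambda>x\<in>carrier (obj C n). \<zero>\<^bsub>obj D n\<^esub>),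
      add = (\<lambda>f g. \<lambda>n. \<lambda>x\<in>carrier (obj C n). f n x \<oplus>\<^bsub>obj D n\<^esub> g n x)\<rparr>"

text \<open>The Hom-complex: its terms, its differential, and its exactness.\<close>

definition hom_cpx_obj ::
    "('r, 's) ring_scheme \<Rightarrow> ('r, 'm) chain_cpx \<Rightarrow> ('r, 'm) chain_cpx \<Rightarrow> int \<Rightarrow> (int \<Rightarrow> 'm \<Rightarrow> 'm) ring" where
  "hom_cpx_obj R C D n =
     \<lparr>carrier = {f. \<forall>i. f i \<in> carrier (hom_group R (obj C i) (obj D (n + i)))},
      mult = undefined, one = undefined,
      zero = (\<lambda>i. \<zero>\<^bsub>hom_group R (obj C i) (obj D (n + i))\<^esub>),
      add = (\<lambda>f g. \<lambda>i. f i \<oplus>\<^bsub>hom_group R (obj C i) (obj D (n + i))\<^esub> g i)\<rparr>"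

definition hom_cpx_diff ::
    "('r, 'm) chain_cpx \<Rightarrow> ('r, 'm) chain_cpx \<Rightarrow> int \<Rightarrow> (int \<Rightarrow> 'm \<Rightarrow> 'm) \<Rightarrow> (int \<Rightarrow> 'm \<Rightarrow> 'm)" where
  "hom_cpx_diff C D n f = (\<lambda>i. \<lambda>x\<in>carrier (obj C i).
     if even n
     then diff D (n + i) (f i x) \<ominus>\<^bsub>obj D (n + i - 1)\<^esub> f (i - 1) (diff C i x)
     else diff D (n + i) (f i x) \<oplus>\<^bsub>obj D (n + i - 1)\<^esub> f (i - 1) (diff C i x))"

definition hom_cpx_exact ::
    "('r, 's) ring_scheme \<Rightarrow> ('r, 'm) chain_cpx \<Rightarrow> ('r, 'm) chain_cpx \<Rightarrow> bool" where
  "hom_cpx_exact R C D \<longleftrightarrow>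
     (\<forall>n. exact_at (hom_cpx_obj R C D (n + 1)) (hom_cpx_diff C D (n + 1))
            (hom_cpx_obj R C D n) (hom_cpx_diff C D n) (hom_cpx_obj R C D (n - 1)))"


section \<open>Ext and cotorsion pairs\<close>

definition projective :: "('r, 's) ring_scheme \<Rightarrow> 'm set set \<Rightarrow> ('r, 'm) module \<Rightarrow> bool" where
  "projective R U P \<longleftrightarrow> P \<in> left_modules R U \<and>
     (\<forall>X\<in>left_modules R U. \<forall>Y\<in>left_modules R U.
        \<forall>g\<in>mod_hom R X Y. \<forall>f\<in>mod_hom R P Y.
          g ` carrier X = carrier Y \<longrightarrow>
          (\<exists>h\<in>mod_hom R P X. \<forall>p\<in>carrier P. g (h p) = f p))"

definition projective_resolution ::
    "('r, 's) ring_scheme \<Rightarrow> 'm set set \<Rightarrow> ('r, 'm) module \<Rightarrow> ('r, 'm) chain_cpx \<Rightarrow> ('m \<Rightarrow> 'm) \<Rightarrow> bool" where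
  "projective_resolution R U M P \<epsilon> \<longleftrightarrow>
     P \<in> complexes R U \<and>
     (\<forall>n\<ge>0. projective R U (obj P n)) \<and>
     (\<forall>n<0. carrier (obj P n) = {\<zero>\<^bsub>obj P n\<^esub>}) \<and>
     (\<forall>n\<ge>1. exact_at (obj P (n + 1)) (diff P (n + 1)) (obj P n) (diff P n) (obj P (n - 1))) \<and>
     \<epsilon> \<in> mod_hom R (obj P 0) M \<and>
     \<epsilon> ` carrier (obj P 0) = carrier M \<and>
     exact_at (obj P 1) (diff P 1) (obj P 0) \<epsilon> M"

text \<open>
  \<open>Ext\<^sup>n\<close> is the \<open>n\<close>-th cohomology group of \<open>Hom(P, N)\<close>, where \<open>P\<close> is a chosen projective resolution
  of the first argument. Precomposition with \<open>diff P k\<close> maps \<open>Hom(P\<^sub>k\<^sub>-\<^sub>1, N)\<close> to \<open>Hom(P\<^sub>k, N)\<close>.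
\<close>

definition proj_res :: "('r, 's) ring_scheme \<Rightarrow> 'm set set \<Rightarrow> ('r, 'm) module \<Rightarrow> ('r, 'm) chain_cpx" where
  "proj_res R U M = (SOME P. \<exists>\<epsilon>. projective_resolution R U M P \<epsilon>)"

definition precomp :: "('r, 'm) chain_cpx \<Rightarrow> int \<Rightarrow> ('m \<Rightarrow> 'm) \<Rightarrow> ('m \<Rightarrow> 'm)" where
  "precomp C k f = compose (carrier (obj C k)) f (diff C k)"

definition hom_cohomology ::
    "('r, 's) ring_scheme \<Rightarrow> ('r, 'm) chain_cpx \<Rightarrow> ('r, 'm) module \<Rightarrow> int \<Rightarrow> ('m \<Rightarrow> 'm) set monoid" where
  "hom_cohomology R C N n =
     (hom_group R (obj C n) N)
       \<lparr>carrier := a_kernel (hom_group R (obj C n) N) (hom_group R (obj C (n + 1)) N) (precomp C (n + 1))\<rparr>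
     A_Mod (precomp C n ` carrier (hom_group R (obj C (n - 1)) N))"

definition Ext ::
    "('r, 's) ring_scheme \<Rightarrow> 'm set set \<Rightarrow> nat \<Rightarrow> ('r, 'm) module \<Rightarrow> ('r, 'm) module \<Rightarrow>
      ('m \<Rightarrow> 'm) set monoid" where
  "Ext R U n M N = hom_cohomology R (proj_res R U M) N (int n)"

definition cotorsion_pair ::
    "('r, 's) ring_scheme \<Rightarrow> 'm set set \<Rightarrow> ('r, 'm) module set \<Rightarrow> ('r, 'm) module set \<Rightarrow> bool" where
  "cotorsion_pair R U \<A> \<B> \<longleftrightarrow>
     \<B> = {D \<in> left_modules R U. \<forall>A\<in>\<A>. trivial_group (Ext R U 1 A D)} \<and>
     \<A> = {D \<in> left_modules R U. \<forall>B\<in>\<B>. trivial_group (Ext R U 1 D B)}"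

definition complete_pair ::
    "('r, 's) ring_scheme \<Rightarrow> 'm set set \<Rightarrow> ('r, 'm) module set \<Rightarrow> ('r, 'm) module set \<Rightarrow> bool" where
  "complete_pair R U \<A> \<B> \<longleftrightarrow> (\<forall>D\<in>left_modules R U.
     (\<exists>B\<in>\<B>. \<exists>A\<in>\<A>. \<exists>f g. short_exact R B f A g D) \<and>
     (\<exists>B'\<in>\<B>. \<exists>A'\<in>\<A>. \<exists>f g. short_exact R D f B' g A'))"

definition hereditary_pair ::
    "('r, 's) ring_scheme \<Rightarrow> 'm set set \<Rightarrow> ('r, 'm) module set \<Rightarrow> ('r, 'm) module set \<Rightarrow> bool" where
  "hereditary_pair R U \<A> \<B> \<longleftrightarrow> (\<forall>A\<in>\<A>. \<forall>B\<in>\<B>. \<forall>i\<ge>1. trivial_group (Ext R U i A B))"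


section \<open>Classes of complexes\<close>

definition tilde_class ::
    "('r, 's) ring_scheme \<Rightarrow> 'm set set \<Rightarrow> ('r, 'm) module set \<Rightarrow> ('r, 'm) chain_cpx set" where
  "tilde_class R U \<X> = {X \<in> complexes R U. exact_cpx X \<and> (\<forall>n. cycle_module X n \<in> \<X>)}"

definition dg_tilde_class ::
    "('r, 's) ring_scheme \<Rightarrow> 'm set set \<Rightarrow> ('r, 'm) module set \<Rightarrow> ('r, 'm) module set \<Rightarrow>
      ('r, 'm) chain_cpx set" where
  "dg_tilde_class R U \<A> \<B> = {X \<in> complexes R U.
     (\<forall>n. obj X n \<in> \<B>) \<and> (\<forall>A\<in>tilde_class R U \<A>. hom_cpx_exact R A X)}"


section \<open>Gorenstein modules and complexes\<close>

definition hom_into_exact :: "('r, 's) ring_scheme \<Rightarrow> ('r, 'm) chain_cpx \<Rightarrow> ('r, 'm) module \<Rightarrow> bool" where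
  "hom_into_exact R T H \<longleftrightarrow>
     (\<forall>i. exact_at (hom_group R (obj T (i - 1)) H) (precomp T i)
            (hom_group R (obj T i) H) (precomp T (i + 1))
            (hom_group R (obj T (i + 1)) H))"

definition gorenstein_modules ::
    "('r, 's) ring_scheme \<Rightarrow> 'm set set \<Rightarrow> ('r, 'm) module set \<Rightarrow> ('r, 'm) module set \<Rightarrow>
      ('r, 'm) module set" where
  "gorenstein_modules R U \<A> \<B> = {M \<in> left_modules R U. \<exists>T\<in>complexes R U.
     (\<forall>i. obj T i \<in> \<A>) \<and> exact_cpx T \<and> (\<forall>H\<in>\<A> \<inter> \<B>. hom_into_exact R T H) \<and>
     mod_iso R M (im_module (diff T 0) (obj T 0) (obj T (-1)))}"

text \<open>
  A sequence of complexes consists of complexes \<open>S i\<close> and chain maps \<open>d i\<close> from \<open>S i\<close> to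
  \<open>S (i - 1)\<close>; kernels and images in the category of complexes are formed degreewise.
\<close>

definition exact_seq :: "(int \<Rightarrow> ('r, 'm) chain_cpx) \<Rightarrow> (int \<Rightarrow> int \<Rightarrow> 'm \<Rightarrow> 'm) \<Rightarrow> bool" where
  "exact_seq S d \<longleftrightarrow>
     (\<forall>i n. exact_at (obj (S (i + 1)) n) (d (i + 1) n) (obj (S i) n) (d i n) (obj (S (i - 1)) n))"

definition precomp_map ::
    "('r, 'm) chain_cpx \<Rightarrow> (int \<Rightarrow> 'm \<Rightarrow> 'm) \<Rightarrow> (int \<Rightarrow> 'm \<Rightarrow> 'm) \<Rightarrow> (int \<Rightarrow> 'm \<Rightarrow> 'm)" where
  "precomp_map C d f = (\<lambda>n. compose (carrier (obj C n)) (f n) (d n))"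

definition seq_hom_into_exact ::
    "('r, 's) ring_scheme \<Rightarrow> (int \<Rightarrow> ('r, 'm) chain_cpx) \<Rightarrow> (int \<Rightarrow> int \<Rightarrow> 'm \<Rightarrow> 'm) \<Rightarrow>
      ('r, 'm) chain_cpx \<Rightarrow> bool" where
  "seq_hom_into_exact R S d H \<longleftrightarrow>
     (\<forall>i. exact_at (chain_map_group R (S (i - 1)) H) (precomp_map (S i) (d i))
            (chain_map_group R (S i) H) (precomp_map (S (i + 1)) (d (i + 1)))
            (chain_map_group R (S (i + 1)) H))"

definition gorenstein_complexes ::
    "('r, 's) ring_scheme \<Rightarrow> 'm set set \<Rightarrow> ('r, 'm) module set \<Rightarrow> ('r, 'm) module set \<Rightarrow>
      ('r, 'm) chain_cpx set" where
  "gorenstein_complexes R U \<A> \<B> = {C \<in> complexes R U. \<exists>S d.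
     (\<forall>i. S i \<in> tilde_class R U \<A>) \<and>
     (\<forall>i. d i \<in> chain_maps R (S i) (S (i - 1))) \<and>
     exact_seq S d \<and>
     (\<forall>H\<in>tilde_class R U \<A> \<inter> dg_tilde_class R U \<A> \<B>. seq_hom_into_exact R S d H) \<and>
     cpx_iso R C (im_cpx (d 0) (S 0) (S (-1)))}"

end

theory Submission
  imports Defs
begin

text \<open>
  A complex in \<open>\<A>\<close>-tilde and dg-\<open>\<B>\<close>-tilde has an exact endomorphism Hom-complex, so its identity is a boundary
  and it is contractible. Hence Hom-exactness of a sequence of complexes against this class is the same
  as Hom-exactness of every degree against \<open>\<A> \<inter> \<B>\<close>: discs give one direction, a contracting homotopy
  the other.

  It remains to resolve a complex \<open>C\<close> with Gorenstein terms on both sides by complexes in \<open>\<A>\<close>-tilde.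
  Sums of discs on projective covers, respectively on embeddings into \<open>\<A> \<inter> \<B>\<close>, of the terms of \<open>C\<close> do
  this, and the terms of the new kernels and cokernels are extensions of modules of the same kind. By the
  horseshoe construction such covers and embeddings exist for every iterated extension of modules from \<open>\<A>\<close>
  and Gorenstein modules, so the process can be continued in both directions and spliced.
\<close>

text \<open>\<open>Ext\<close> is the cohomology of one chosen projective resolution, which gives no
  direct access to long exact sequences. Vanishing of Ext^1(M, H) is therefore traded for an
  extension property, \<open>ext_vanish\<close>: maps into H extend along every monomorphism with
  cokernel M. Extensions and syzygies are then handled by diagram chases, and Ext^2 is reached by
  one dimension shift. Heredity enters as the fact that a module in \<A> is a quotient of a
  projective with kernel in \<A>, completeness as an embedding of it into a module of \<A> \<inter>
  \<B> with cokernel in \<A>. Closure of the Gorenstein modules under extensions is not established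
  beforehand. It would follow afterwards: a disc on a module of the extension closure is a
  Gorenstein complex, and by the other direction its terms are Gorenstein. All modules live in one
  type and must have small carriers, so quotients consist of chosen representatives, while sums and
  free modules are carried back by injections.\<close>

section \<open>Differences and scalars in abelian groups and left modules\<close>

context abelian_group
begin

lemma minus_self [simp]: "x \<in> carrier G \<Longrightarrow> x \<ominus> x = \<zero>"
  by (simp add: minus_eq r_neg)

lemma minus_add_cancel [simp]:
  "\<lbrakk>x \<in> carrier G; y \<in> carrier G\<rbrakk> \<Longrightarrow> (x \<ominus> y) \<oplus> y = x"
  by (simp add: minus_eq a_assoc l_neg)

lemma add_minus_cancel [simp]:
  "\<lbrakk>x \<in> carrier G; y \<in> carrier G\<rbrakk> \<Longrightarrow> (x \<oplus> y) \<ominus> y = x"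
  by (simp add: minus_eq a_assoc r_neg)

lemma minus_eq_zero_iff [simp]:
  "\<lbrakk>x \<in> carrier G; y \<in> carrier G\<rbrakk> \<Longrightarrow> x \<ominus> y = \<zero> \<longleftrightarrow> x = y"
  by (metis minus_add_cancel l_zero minus_self)

lemma minus_zero_right [simp]: "x \<in> carrier G \<Longrightarrow> x \<ominus> \<zero> = x"
  by (metis add_minus_cancel r_zero zero_closed)

lemma add_diff_add:
  "\<lbrakk>a \<in> carrier G; b \<in> carrier G; c \<in> carrier G; d \<in> carrier G\<rbrakk> \<Longrightarrow>
    (a \<oplus> b) \<ominus> (c \<oplus> d) = (a \<ominus> c) \<oplus> (b \<ominus> d)"
  by (simp add: minus_eq minus_add a_ac)

lemma minus_trans:
  "\<lbrakk>a \<in> carrier G; b \<in> carrier G; c \<in> carrier G\<rbrakk> \<Longrightarrow> (a \<ominus> b) \<oplus> (b \<ominus> c) = a \<ominus> c"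
  by (simp add: minus_eq a_assoc r_neg1)

end

lemma left_module_abelian_group: "left_module R M \<Longrightarrow> abelian_group M"
  by (simp add: left_module_def)

context left_module
begin

lemma smult_l_null [simp]: "x \<in> carrier M \<Longrightarrow> \<zero>\<^bsub>R\<^esub> \<odot>\<^bsub>M\<^esub> x = \<zero>\<^bsub>M\<^esub>"
  by (metis M.add.l_cancel_one R.l_zero R.zero_closed smult_closed smult_l_distr)

lemma smult_r_null [simp]: "a \<in> carrier R \<Longrightarrow> a \<odot>\<^bsub>M\<^esub> \<zero>\<^bsub>M\<^esub> = \<zero>\<^bsub>M\<^esub>"
  by (metis M.add.l_cancel_one M.l_zero M.zero_closed smult_closed smult_r_distr)

text \<open>Makes negation a scalar action. Additive maps that respect scalars then respect
  negatives, and subsets closed under addition and scalars contain negatives, with no separate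
  conditions.\<close>

lemma smult_neg_one: "x \<in> carrier M \<Longrightarrow> (\<ominus>\<^bsub>R\<^esub> \<one>\<^bsub>R\<^esub>) \<odot>\<^bsub>M\<^esub> x = \<ominus>\<^bsub>M\<^esub> x"
proof -
  assume x: "x \<in> carrier M"
  have "(\<ominus>\<^bsub>R\<^esub> \<one>\<^bsub>R\<^esub>) \<odot>\<^bsub>M\<^esub> x \<oplus>\<^bsub>M\<^esub> x = (\<ominus>\<^bsub>R\<^esub> \<one>\<^bsub>R\<^esub> \<oplus>\<^bsub>R\<^esub> \<one>\<^bsub>R\<^esub>) \<odot>\<^bsub>M\<^esub> x"
    using x by (simp add: smult_l_distr)
  also have "\<dots> = \<zero>\<^bsub>M\<^esub>" using x by (simp add: R.l_neg)
  finally show ?thesis using x M.minus_equality by simp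
qed

lemma smult_neg: "\<lbrakk>a \<in> carrier R; x \<in> carrier M\<rbrakk> \<Longrightarrow> a \<odot>\<^bsub>M\<^esub> (\<ominus>\<^bsub>M\<^esub> x) = \<ominus>\<^bsub>M\<^esub> (a \<odot>\<^bsub>M\<^esub> x)"
  by (metis M.a_inv_closed M.l_neg M.minus_equality smult_closed smult_r_distr smult_r_null)

lemma smult_minus:
  "\<lbrakk>a \<in> carrier R; x \<in> carrier M; y \<in> carrier M\<rbrakk> \<Longrightarrow>
    a \<odot>\<^bsub>M\<^esub> (x \<ominus>\<^bsub>M\<^esub> y) = a \<odot>\<^bsub>M\<^esub> x \<ominus>\<^bsub>M\<^esub> a \<odot>\<^bsub>M\<^esub> y"
  by (simp add: M.minus_eq smult_r_distr smult_neg)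

end

section \<open>Linear maps\<close>

text \<open>Unlike \<^const>\<open>mod_hom\<close>, this allows different carrier types.\<close>

definition lin ::
    "('r, 's) ring_scheme \<Rightarrow> ('r, 'a) module \<Rightarrow> ('r, 'b) module \<Rightarrow> ('a \<Rightarrow> 'b) \<Rightarrow> bool" where
  "lin R M N f \<longleftrightarrow> f \<in> carrier M \<rightarrow> carrier N \<and>
     (\<forall>x\<in>carrier M. \<forall>y\<in>carrier M. f (x \<oplus>\<^bsub>M\<^esub> y) = f x \<oplus>\<^bsub>N\<^esub> f y) \<and>
     (\<forall>a\<in>carrier R. \<forall>x\<in>carrier M. f (a \<odot>\<^bsub>M\<^esub> x) = a \<odot>\<^bsub>N\<^esub> f x)"

lemma mod_hom_iff: "f \<in> mod_hom R M N \<longleftrightarrow> lin R M N f"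
  by (simp add: mod_hom_def lin_def)

lemma linI:
  assumes "\<And>x. x \<in> carrier M \<Longrightarrow> f x \<in> carrier N"
    and "\<And>x y. \<lbrakk>x \<in> carrier M; y \<in> carrier M\<rbrakk> \<Longrightarrow> f (x \<oplus>\<^bsub>M\<^esub> y) = f x \<oplus>\<^bsub>N\<^esub> f y"
    and "\<And>a x. \<lbrakk>a \<in> carrier R; x \<in> carrier M\<rbrakk> \<Longrightarrow> f (a \<odot>\<^bsub>M\<^esub> x) = a \<odot>\<^bsub>N\<^esub> f x"
  shows "lin R M N f"
  using assms by (simp add: lin_def)

lemma lin_closed: "\<lbrakk>lin R M N f; x \<in> carrier M\<rbrakk> \<Longrightarrow> f x \<in> carrier N"
  by (auto simp: lin_def)

lemma lin_add:
  "\<lbrakk>lin R M N f; x \<in> carrier M; y \<in> carrier M\<rbrakk> \<Longrightarrow> f (x \<oplus>\<^bsub>M\<^esub> y) = f x \<oplus>\<^bsub>N\<^esub> f y"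
  by (simp add: lin_def)

lemma lin_smult:
  "\<lbrakk>lin R M N f; a \<in> carrier R; x \<in> carrier M\<rbrakk> \<Longrightarrow> f (a \<odot>\<^bsub>M\<^esub> x) = a \<odot>\<^bsub>N\<^esub> f x"
  by (simp add: lin_def)

lemma lin_zero:
  assumes "lin R M N f" "left_module R M" "left_module R N"
  shows "f \<zero>\<^bsub>M\<^esub> = \<zero>\<^bsub>N\<^esub>"
proof -
  interpret M: left_module R M by fact
  interpret N: left_module R N by fact
  have "f (\<zero>\<^bsub>R\<^esub> \<odot>\<^bsub>M\<^esub> \<zero>\<^bsub>M\<^esub>) = \<zero>\<^bsub>R\<^esub> \<odot>\<^bsub>N\<^esub> f \<zero>\<^bsub>M\<^esub>"
    by (rule lin_smult[OF assms(1)]) simp_all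
  then show ?thesis using lin_closed[OF assms(1)] by simp
qed

lemma lin_neg:
  assumes "lin R M N f" "left_module R M" "left_module R N" "x \<in> carrier M"
  shows "f (\<ominus>\<^bsub>M\<^esub> x) = \<ominus>\<^bsub>N\<^esub> f x"
proof -
  interpret M: left_module R M by fact
  interpret N: left_module R N by fact
  have "f ((\<ominus>\<^bsub>R\<^esub> \<one>\<^bsub>R\<^esub>) \<odot>\<^bsub>M\<^esub> x) = (\<ominus>\<^bsub>R\<^esub> \<one>\<^bsub>R\<^esub>) \<odot>\<^bsub>N\<^esub> f x"
    using assms by (simp add: lin_smult)
  then show ?thesis using assms by (simp add: M.smult_neg_one N.smult_neg_one lin_closed)
qed

lemma lin_minus:
  assumes "lin R M N f" "left_module R M" "left_module R N" "x \<in> carrier M" "y \<in> carrier M"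
  shows "f (x \<ominus>\<^bsub>M\<^esub> y) = f x \<ominus>\<^bsub>N\<^esub> f y"
proof -
  interpret M: left_module R M by fact
  interpret N: left_module R N by fact
  show ?thesis using assms by (simp add: M.minus_eq N.minus_eq lin_add lin_neg)
qed

text \<open>Passes between a linear map and its restriction to the carrier; the Hom groups contain
  extensional functions only.\<close>

lemma lin_cong: "\<lbrakk>lin R M N f; left_module R M; \<And>x. x \<in> carrier M \<Longrightarrow> f x = g x\<rbrakk> \<Longrightarrow> lin R M N g"
proof -
  assume f: "lin R M N f" and M: "left_module R M" and eq: "\<And>x. x \<in> carrier M \<Longrightarrow> f x = g x"
  interpret M: left_module R M by fact
  show ?thesis
    by (rule linI) (simp_all add: eq[symmetric] lin_closed[OF f] lin_add[OF f] lin_smult[OF f])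
qed

lemma lin_id: "lin R M M (\<lambda>x. x)"
  by (simp add: lin_def)

lemma lin_comp: "\<lbrakk>lin R M N f; lin R N P g\<rbrakk> \<Longrightarrow> lin R M P (\<lambda>x. g (f x))"
  by (rule linI) (simp_all add: lin_closed lin_add lin_smult)

lemma lin_const_zero: "left_module R N \<Longrightarrow> lin R M N (\<lambda>x. \<zero>\<^bsub>N\<^esub>)"
proof -
  assume "left_module R N"
  then interpret left_module R N .
  show ?thesis by (auto simp: lin_def)
qed

lemma lin_plus:
  assumes "lin R M N f" "lin R M N g" "left_module R N"
  shows "lin R M N (\<lambda>x. f x \<oplus>\<^bsub>N\<^esub> g x)"
proof -
  interpret N: left_module R N by fact
  show ?thesis using assms(1,2)
    by (intro linI) (auto simp: lin_closed lin_add lin_smult N.smult_r_distr N.a_ac)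
qed

lemma lin_diff:
  assumes "lin R M N f" "lin R M N g" "left_module R N"
  shows "lin R M N (\<lambda>x. f x \<ominus>\<^bsub>N\<^esub> g x)"
proof -
  interpret N: left_module R N by fact
  show ?thesis using assms(1,2)
    by (intro linI) (auto simp: lin_closed lin_add lin_smult N.smult_minus N.add_diff_add)
qed

lemma lin_restrict: "lin R M N f \<Longrightarrow> T \<subseteq> carrier M \<Longrightarrow> lin R (M\<lparr>carrier := T\<rparr>) N f"
  by (rule linI) (simp_all add: lin_closed lin_add lin_smult subset_iff)

lemma lin_into: "lin R M N f \<Longrightarrow> f ` carrier M \<subseteq> T \<Longrightarrow> lin R M (N\<lparr>carrier := T\<rparr>) f"
  by (auto simp: lin_def)

lemma lin_out: "lin R M (N\<lparr>carrier := T\<rparr>) f \<Longrightarrow> T \<subseteq> carrier N \<Longrightarrow> lin R M N f"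
  by (auto simp: lin_def)

lemma lin_surjI:
  assumes "lin R M N f" and "\<And>y. y \<in> carrier N \<Longrightarrow> y \<in> f ` carrier M"
  shows "f ` carrier M = carrier N"
  using assms(2) lin_closed[OF assms(1)] by (intro equalityI image_subsetI subsetI)

lemma lin_injI:
  assumes f: "lin R M N f" and M: "left_module R M" and N: "left_module R N"
    and ker: "\<And>x. \<lbrakk>x \<in> carrier M; f x = \<zero>\<^bsub>N\<^esub>\<rbrakk> \<Longrightarrow> x = \<zero>\<^bsub>M\<^esub>"
  shows "inj_on f (carrier M)"
proof (rule inj_onI)
  interpret M: left_module R M by fact
  interpret N: left_module R N by fact
  fix x y assume xy: "x \<in> carrier M" "y \<in> carrier M" "f x = f y"
  then have "f (x \<ominus>\<^bsub>M\<^esub> y) = \<zero>\<^bsub>N\<^esub>" by (simp add: lin_minus[OF f M N] lin_closed[OF f])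
  then show "x = y" using ker[of "x \<ominus>\<^bsub>M\<^esub> y"] xy by simp
qed

text \<open>Universal property of an epimorphism. The value at z is computed from an arbitrary
  preimage; two preimages differ by an element of the kernel of \<open>q\<close>, which
  \<open>h\<close> kills.\<close>

lemma lin_factor:
  assumes q: "lin R N Q q" and surj: "q ` carrier N = carrier Q" and h: "lin R N H h"
    and N: "left_module R N" and Q: "left_module R Q" and H: "left_module R H"
    and ker: "\<forall>x\<in>carrier N. q x = \<zero>\<^bsub>Q\<^esub> \<longrightarrow> h x = \<zero>\<^bsub>H\<^esub>"
  shows "\<exists>k. lin R Q H k \<and> (\<forall>x\<in>carrier N. k (q x) = h x)"
proof -
  interpret N: left_module R N by fact
  interpret Q: left_module R Q by fact
  interpret H: left_module R H by fact
  have eq: "h x = h y" if "x \<in> carrier N" "y \<in> carrier N" "q x = q y" for x y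
  proof -
    have "q (x \<ominus>\<^bsub>N\<^esub> y) = \<zero>\<^bsub>Q\<^esub>" using that q by (simp add: lin_minus[OF q N Q] lin_closed)
    then have "h (x \<ominus>\<^bsub>N\<^esub> y) = \<zero>\<^bsub>H\<^esub>" using that ker by simp
    then show ?thesis using that by (simp add: lin_minus[OF h N H] lin_closed[OF h])
  qed
  define k where "k = (\<lambda>z. h (inv_into (carrier N) q z))"
  have kq: "k (q x) = h x" if "x \<in> carrier N" for x
    unfolding k_def using that by (intro eq) (auto intro: inv_into_into f_inv_into_f)
  have "lin R Q H k"
  proof (rule linI)
    fix z assume "z \<in> carrier Q"
    then obtain x where "x \<in> carrier N" "z = q x" using surj by auto
    then show "k z \<in> carrier H" using kq lin_closed[OF h] by simp
  next
    fix z z' assume "z \<in> carrier Q" "z' \<in> carrier Q"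
    then obtain x x' where "x \<in> carrier N" "z = q x" "x' \<in> carrier N" "z' = q x'"
      using surj by (metis imageE)
    then show "k (z \<oplus>\<^bsub>Q\<^esub> z') = k z \<oplus>\<^bsub>H\<^esub> k z'"
      using kq lin_add[OF q, symmetric] lin_add[OF h] by simp
  next
    fix a z assume "z \<in> carrier Q" and a: "a \<in> carrier R"
    then obtain x where "x \<in> carrier N" "z = q x" using surj by auto
    then show "k (a \<odot>\<^bsub>Q\<^esub> z) = a \<odot>\<^bsub>H\<^esub> k z"
      using a kq lin_smult[OF q, symmetric] lin_smult[OF h] by simp
  qed
  then show ?thesis using kq by auto
qed

text \<open>Dual of the previous factorization: \<open>k x\<close> is the unique preimage of
  \<open>h x\<close>, and its linearity is checked after applying the injective
  \<open>f\<close>.\<close>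

lemma lin_lift_mono:
  assumes f: "lin R X Y f" and inj: "inj_on f (carrier X)" and h: "lin R N Y h"
    and X: "left_module R X" and N: "left_module R N"
    and sub: "h ` carrier N \<subseteq> f ` carrier X"
  shows "\<exists>k. lin R N X k \<and> (\<forall>x\<in>carrier N. f (k x) = h x)"
proof -
  interpret N: left_module R N by fact
  interpret X: left_module R X by fact
  define k where "k = (\<lambda>x. inv_into (carrier X) f (h x))"
  have k: "k x \<in> carrier X" "f (k x) = h x" if "x \<in> carrier N" for x
  proof -
    have "h x \<in> f ` carrier X" using sub that by blast
    then show "k x \<in> carrier X" "f (k x) = h x"
      unfolding k_def by (simp_all add: inv_into_into f_inv_into_f)
  qed
  have "lin R N X k"
  proof (rule linI)
    fix x y assume "x \<in> carrier N" "y \<in> carrier N"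
    then show "k (x \<oplus>\<^bsub>N\<^esub> y) = k x \<oplus>\<^bsub>X\<^esub> k y"
      by (intro inj_onD[OF inj]) (simp_all add: k lin_add[OF f] lin_add[OF h])
  next
    fix a x assume "a \<in> carrier R" "x \<in> carrier N"
    then show "k (a \<odot>\<^bsub>N\<^esub> x) = a \<odot>\<^bsub>X\<^esub> k x"
      by (intro inj_onD[OF inj]) (simp_all add: k lin_smult[OF f] lin_smult[OF h])
  qed (simp add: k)
  then show ?thesis using k(2) by auto
qed

section \<open>Submodules, quotients and direct sums\<close>

lemma left_module_submodule:
  assumes M: "left_module R M" and S: "S \<subseteq> carrier M" "\<zero>\<^bsub>M\<^esub> \<in> S"
    "\<And>x y. \<lbrakk>x \<in> S; y \<in> S\<rbrakk> \<Longrightarrow> x \<oplus>\<^bsub>M\<^esub> y \<in> S"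
    "\<And>a x. \<lbrakk>a \<in> carrier R; x \<in> S\<rbrakk> \<Longrightarrow> a \<odot>\<^bsub>M\<^esub> x \<in> S"
  shows "left_module R (M\<lparr>carrier := S\<rparr>)"
proof -
  interpret M: left_module R M by fact
  have S1: "x \<in> carrier M" if "x \<in> S" for x using that S(1) by blast
  have "abelian_group (M\<lparr>carrier := S\<rparr>)"
  proof (rule abelian_groupI)
    fix x assume "x \<in> carrier (M\<lparr>carrier := S\<rparr>)"
    then have x: "x \<in> S" by simp
    then have "(\<ominus>\<^bsub>R\<^esub> \<one>\<^bsub>R\<^esub>) \<odot>\<^bsub>M\<^esub> x \<in> S" "(\<ominus>\<^bsub>R\<^esub> \<one>\<^bsub>R\<^esub>) \<odot>\<^bsub>M\<^esub> x \<oplus>\<^bsub>M\<^esub> x = \<zero>\<^bsub>M\<^esub>"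
      using S1 S(4)[of "\<ominus>\<^bsub>R\<^esub> \<one>\<^bsub>R\<^esub>" x] by (simp_all add: M.smult_neg_one M.l_neg)
    then show "\<exists>y\<in>carrier (M\<lparr>carrier := S\<rparr>). y \<oplus>\<^bsub>M\<lparr>carrier := S\<rparr>\<^esub> x = \<zero>\<^bsub>M\<lparr>carrier := S\<rparr>\<^esub>"
      by auto
  qed (use S in \<open>simp_all add: S1 M.a_ac\<close>)
  then show ?thesis
    by (intro left_module.intro M.R.ring_axioms left_module_axioms.intro)
      (use S in \<open>simp_all add: S1 M.smult_l_distr M.smult_r_distr M.smult_assoc\<close>)
qed

lemma left_module_kernel:
  assumes "left_module R M" "left_module R N" "lin R M N f"
  shows "left_module R (M\<lparr>carrier := a_kernel M N f\<rparr>)"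
proof -
  interpret M: left_module R M by fact
  interpret N: left_module R N by fact
  show ?thesis
    by (rule left_module_submodule)
      (use assms in \<open>auto simp: a_kernel_def' lin_zero lin_add lin_smult\<close>)
qed

lemma left_module_image:
  assumes "left_module R M" "left_module R N" "lin R M N f"
  shows "left_module R (N\<lparr>carrier := f ` carrier M\<rparr>)"
proof -
  interpret M: left_module R M by fact
  interpret N: left_module R N by fact
  show ?thesis
  proof (rule left_module_submodule[OF assms(2)])
    show "\<zero>\<^bsub>N\<^esub> \<in> f ` carrier M" using lin_zero[OF assms(3,1,2)] by (metis M.zero_closed imageI)
    show "x \<oplus>\<^bsub>N\<^esub> y \<in> f ` carrier M" if "x \<in> f ` carrier M" "y \<in> f ` carrier M" for x y
      using that lin_add[OF assms(3), symmetric] by auto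
    show "a \<odot>\<^bsub>N\<^esub> x \<in> f ` carrier M" if "a \<in> carrier R" "x \<in> f ` carrier M" for a x
      using that lin_smult[OF assms(3), symmetric] by auto
  qed (use lin_closed[OF assms(3)] in auto)
qed

text \<open>
  The module structure on the set of values of a map \<open>r\<close> on a module. For \<open>r\<close> injective this transports
  the structure; for \<open>r\<close> choosing representatives modulo a submodule it is the quotient.
\<close>

definition induced_module :: "('r, 'a) module \<Rightarrow> ('a \<Rightarrow> 'b) \<Rightarrow> ('r, 'b) module" where
  "induced_module N r =
     \<lparr>carrier = r ` carrier N, mult = undefined, one = undefined, zero = r \<zero>\<^bsub>N\<^esub>,
      add = (\<lambda>x y. r (inv_into (carrier N) r x \<oplus>\<^bsub>N\<^esub> inv_into (carrier N) r y)),
      smult = (\<lambda>a x. r (a \<odot>\<^bsub>N\<^esub> inv_into (carrier N) r x))\<rparr>"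

lemma zero_induced_module: "\<zero>\<^bsub>induced_module N r\<^esub> = r \<zero>\<^bsub>N\<^esub>"
  by (simp add: induced_module_def)

text \<open>The two hypotheses say that the fibres of \<open>r\<close> form a congruence, so the
  representative picked by \<open>inv_into\<close> in the definition may be replaced by any
  other.\<close>

lemma induced_module:
  fixes r :: "'a \<Rightarrow> 'b"
  assumes N: "left_module R N"
    and add: "\<And>x y x' y'. \<lbrakk>x \<in> carrier N; y \<in> carrier N; x' \<in> carrier N; y' \<in> carrier N;
      r x = r x'; r y = r y'\<rbrakk> \<Longrightarrow> r (x \<oplus>\<^bsub>N\<^esub> y) = r (x' \<oplus>\<^bsub>N\<^esub> y')"
    and smult: "\<And>a x x'. \<lbrakk>a \<in> carrier R; x \<in> carrier N; x' \<in> carrier N; r x = r x'\<rbrakk> \<Longrightarrow>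
      r (a \<odot>\<^bsub>N\<^esub> x) = r (a \<odot>\<^bsub>N\<^esub> x')"
  shows "left_module R (induced_module N r)" and "lin R N (induced_module N r) r"
    and "carrier (induced_module N r) = r ` carrier N"
proof -
  interpret N: left_module R N by fact
  let ?Q = "induced_module N r"
  show carr: "carrier ?Q = r ` carrier N" by (simp add: induced_module_def)
  have radd: "r x \<oplus>\<^bsub>?Q\<^esub> r y = r (x \<oplus>\<^bsub>N\<^esub> y)" if "x \<in> carrier N" "y \<in> carrier N" for x y
    unfolding induced_module_def using that
    by (simp, intro add) (simp_all add: inv_into_into f_inv_into_f)
  have rsmult: "a \<odot>\<^bsub>?Q\<^esub> r x = r (a \<odot>\<^bsub>N\<^esub> x)" if "a \<in> carrier R" "x \<in> carrier N" for a x
    unfolding induced_module_def using that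
    by (simp, intro smult) (simp_all add: inv_into_into f_inv_into_f)
  have rzero: "\<zero>\<^bsub>?Q\<^esub> = r \<zero>\<^bsub>N\<^esub>" by (simp add: induced_module_def)
  show "lin R N ?Q r" by (simp add: lin_def carr radd rsmult)
  have "abelian_group ?Q"
  proof (rule abelian_groupI)
    fix x assume "x \<in> carrier ?Q"
    then obtain u where u: "u \<in> carrier N" "x = r u" using carr by auto
    then have "r (\<ominus>\<^bsub>N\<^esub> u) \<oplus>\<^bsub>?Q\<^esub> x = \<zero>\<^bsub>?Q\<^esub>" by (simp add: radd rzero N.l_neg)
    then show "\<exists>y\<in>carrier ?Q. y \<oplus>\<^bsub>?Q\<^esub> x = \<zero>\<^bsub>?Q\<^esub>" using u carr by auto
  qed (auto simp: carr radd rzero N.a_ac)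
  then show "left_module R ?Q"
    by (intro left_module.intro N.R.ring_axioms left_module_axioms.intro)
      (auto simp: carr radd rsmult N.smult_l_distr N.smult_r_distr N.smult_assoc)
qed

text \<open>Cosets would change the carrier type. One representative per coset keeps the quotient
  inside the carrier of \<open>N\<close>, which later makes it small for free.\<close>

lemma quotient_exists:
  fixes N :: "('r, 'a) module"
  assumes N: "left_module R N" and S: "S \<subseteq> carrier N" "\<zero>\<^bsub>N\<^esub> \<in> S"
    "\<And>x y. \<lbrakk>x \<in> S; y \<in> S\<rbrakk> \<Longrightarrow> x \<oplus>\<^bsub>N\<^esub> y \<in> S"
    "\<And>a x. \<lbrakk>a \<in> carrier R; x \<in> S\<rbrakk> \<Longrightarrow> a \<odot>\<^bsub>N\<^esub> x \<in> S"
  obtains Q :: "('r, 'a) module" and q where "left_module R Q" "carrier Q \<subseteq> carrier N"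
    "lin R N Q q" "q ` carrier N = carrier Q" "\<And>x. x \<in> carrier N \<Longrightarrow> q x = \<zero>\<^bsub>Q\<^esub> \<longleftrightarrow> x \<in> S"
proof -
  interpret N: left_module R N by fact
  \<comment> \<open>\<open>r x\<close> is one fixed element of the coset of x. Equal cosets give the
    same predicate, so the choice operator returns the same element.\<close>
  define r where "r x = (SOME y. y \<in> carrier N \<and> y \<ominus>\<^bsub>N\<^esub> x \<in> S)" for x
  have Sneg: "\<ominus>\<^bsub>N\<^esub> x \<in> S" if "x \<in> S" for x
    using S(4)[of "\<ominus>\<^bsub>R\<^esub> \<one>\<^bsub>R\<^esub>" x] that S(1) by (simp add: N.smult_neg_one subset_iff)
  have sym: "x \<ominus>\<^bsub>N\<^esub> y \<in> S" if "y \<ominus>\<^bsub>N\<^esub> x \<in> S" "x \<in> carrier N" "y \<in> carrier N" for x y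
    using Sneg[OF that(1)] that by (simp add: N.minus_eq N.minus_add N.a_comm)
  have trans: "x \<ominus>\<^bsub>N\<^esub> z \<in> S" if "x \<ominus>\<^bsub>N\<^esub> y \<in> S" "y \<ominus>\<^bsub>N\<^esub> z \<in> S" "x \<in> carrier N" "y \<in> carrier N" "z \<in> carrier N" for x y z
    using S(3)[OF that(1,2)] that by (simp add: N.minus_trans)
  have r: "r x \<in> carrier N" "r x \<ominus>\<^bsub>N\<^esub> x \<in> S" if "x \<in> carrier N" for x
  proof -
    have "x \<in> carrier N \<and> x \<ominus>\<^bsub>N\<^esub> x \<in> S" using that S(2) by simp
    then have "r x \<in> carrier N \<and> r x \<ominus>\<^bsub>N\<^esub> x \<in> S" unfolding r_def by (rule someI)
    then show "r x \<in> carrier N" "r x \<ominus>\<^bsub>N\<^esub> x \<in> S" by auto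
  qed
  have r_eq: "r x = r y \<longleftrightarrow> x \<ominus>\<^bsub>N\<^esub> y \<in> S" if "x \<in> carrier N" "y \<in> carrier N" for x y
  proof
    assume "r x = r y"
    then have "x \<ominus>\<^bsub>N\<^esub> r x \<in> S" "r x \<ominus>\<^bsub>N\<^esub> y \<in> S"
      using sym[OF r(2)[OF that(1)] that(1) r(1)[OF that(1)]] r(2)[OF that(2)] by simp_all
    then show "x \<ominus>\<^bsub>N\<^esub> y \<in> S" using trans[of x "r x" y] r(1) that by simp
  next
    assume "x \<ominus>\<^bsub>N\<^esub> y \<in> S"
    then have "(z \<in> carrier N \<and> z \<ominus>\<^bsub>N\<^esub> x \<in> S) = (z \<in> carrier N \<and> z \<ominus>\<^bsub>N\<^esub> y \<in> S)" for z
      using trans[of z x y] trans[of z y x] sym[of x y] sym[of y x] that by blast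
    then show "r x = r y" unfolding r_def by simp
  qed
  have r_add: "r (x \<oplus>\<^bsub>N\<^esub> y) = r (x' \<oplus>\<^bsub>N\<^esub> y')"
    if c: "x \<in> carrier N" "y \<in> carrier N" "x' \<in> carrier N" "y' \<in> carrier N" and "r x = r x'" "r y = r y'"
    for x y x' y'
  proof -
    have "x \<ominus>\<^bsub>N\<^esub> x' \<in> S" "y \<ominus>\<^bsub>N\<^esub> y' \<in> S" using that by (simp_all add: r_eq)
    from S(3)[OF this] show ?thesis using c by (simp add: r_eq N.add_diff_add)
  qed
  have r_smult: "r (a \<odot>\<^bsub>N\<^esub> x) = r (a \<odot>\<^bsub>N\<^esub> x')"
    if a: "a \<in> carrier R" and c: "x \<in> carrier N" "x' \<in> carrier N" and "r x = r x'" for a x x'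
  proof -
    have "x \<ominus>\<^bsub>N\<^esub> x' \<in> S" using that by (simp add: r_eq)
    from S(4)[OF a this] show ?thesis using a c by (simp add: r_eq N.smult_minus)
  qed
  have *: "left_module R (induced_module N r)" "lin R N (induced_module N r) r"
    "carrier (induced_module N r) = r ` carrier N"
    by ((rule induced_module[OF N]; (rule r_add r_smult; assumption))+)
  note z = zero_induced_module[of N r]
  have ker: "r x = \<zero>\<^bsub>induced_module N r\<^esub> \<longleftrightarrow> x \<in> S" if "x \<in> carrier N" for x
    unfolding z r_eq[OF that N.zero_closed] using that by simp
  have "r ` carrier N \<subseteq> carrier N" using r(1) by (rule image_subsetI)
  then have sub: "carrier (induced_module N r) \<subseteq> carrier N" unfolding *(3) .
  from *(1) sub *(2) *(3)[symmetric] ker show thesis by (rule that)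
qed

definition pair_module :: "('r, 'a) module \<Rightarrow> ('r, 'b) module \<Rightarrow> ('r, 'a \<times> 'b) module" where
  "pair_module M N = \<lparr>carrier = carrier M \<times> carrier N, mult = undefined, one = undefined,
     zero = (\<zero>\<^bsub>M\<^esub>, \<zero>\<^bsub>N\<^esub>),
     add = (\<lambda>x y. (fst x \<oplus>\<^bsub>M\<^esub> fst y, snd x \<oplus>\<^bsub>N\<^esub> snd y)),
     smult = (\<lambda>a x. (a \<odot>\<^bsub>M\<^esub> fst x, a \<odot>\<^bsub>N\<^esub> snd x))\<rparr>"

lemma left_module_pair:
  assumes "left_module R M" "left_module R N"
  shows "left_module R (pair_module M N)"
proof -
  interpret M: left_module R M by fact
  interpret N: left_module R N by fact
  have "abelian_group (pair_module M N)"
  proof (rule abelian_groupI)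
    fix x assume "x \<in> carrier (pair_module M N)"
    then show "\<exists>y\<in>carrier (pair_module M N). y \<oplus>\<^bsub>pair_module M N\<^esub> x = \<zero>\<^bsub>pair_module M N\<^esub>"
      by (intro bexI[of _ "(\<ominus>\<^bsub>M\<^esub> fst x, \<ominus>\<^bsub>N\<^esub> snd x)"]) (auto simp: pair_module_def M.l_neg N.l_neg)
  qed (auto simp: pair_module_def M.a_ac N.a_ac)
  then show ?thesis
    by (intro left_module.intro M.R.ring_axioms left_module_axioms.intro)
      (simp_all add: pair_module_def mem_Times_iff M.smult_l_distr M.smult_r_distr M.smult_assoc
        N.smult_l_distr N.smult_r_distr N.smult_assoc)
qed

section \<open>The category of small modules\<close>

lemma lepoll_iff_ordLeq: "A \<lesssim> B \<longleftrightarrow> (card_of A, card_of B) \<in> ordLeq"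
  by (simp add: lepoll_def card_of_ordLeq)

lemma lepoll_linear: "A \<lesssim> B \<or> B \<lesssim> A"
  by (simp add: lepoll_iff_ordLeq ordLeq_total card_of_Well_order)

lemma Times_lepoll_infinite: "infinite Z \<Longrightarrow> A \<lesssim> Z \<Longrightarrow> B \<lesssim> Z \<Longrightarrow> A \<times> B \<lesssim> Z"
  using lepoll_trans[OF times_lepoll_mono[of A Z B Z], of Z] card_of_Times_same_infinite[of Z]
  by (simp add: lepoll_iff_ordLeq ordIso_iff_ordLeq)

text \<open>Lists of a fixed length are bounded by products of \<open>Z\<close> with itself, and a
  countable union of sets no larger than the infinite \<open>Z\<close> is no larger than
  \<open>Z\<close>. This bounds the size of free modules.\<close>

lemma lists_lepoll_infinite:
  assumes "infinite Z"
  shows "lists Z \<lesssim> Z"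
proof -
  have len: "{xs \<in> lists Z. length xs = n} \<lesssim> Z" for n
  proof (induction n)
    case 0
    have "{xs \<in> lists Z. length xs = 0} = {[]}" by auto
    then show ?case using assms
      by (metis finite.emptyI finite.insertI finite_lepoll_infinite)
  next
    case (Suc n)
    have "{xs \<in> lists Z. length xs = Suc n} \<subseteq> (\<lambda>(x, xs). x # xs) ` (Z \<times> {xs \<in> lists Z. length xs = n})"
      by (auto simp: length_Suc_conv image_iff)
    then have "{xs \<in> lists Z. length xs = Suc n} \<lesssim> Z \<times> {xs \<in> lists Z. length xs = n}"
      by (rule subset_image_lepoll)
    also have "\<dots> \<lesssim> Z" using assms Suc by (intro Times_lepoll_infinite lepoll_refl)
    finally show ?case .
  qed
  have "lists Z = (\<Union>n. {xs \<in> lists Z. length xs = n})" by auto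
  moreover have "(card_of (\<Union>n. {xs \<in> lists Z. length xs = n}), card_of Z) \<in> ordLeq"
    using assms len
    by (intro card_of_UNION_ordLeq_infinite) (auto simp: lepoll_iff_ordLeq[symmetric] infinite_le_lepoll)
  ultimately show ?thesis by (simp add: lepoll_iff_ordLeq)
qed

section \<open>Free modules\<close>

definition free_module :: "('r, 's) ring_scheme \<Rightarrow> 'a set \<Rightarrow> ('r, 'a \<Rightarrow> 'r) module" where
  "free_module R X = \<lparr>carrier = {f \<in> UNIV \<rightarrow> carrier R. finite {x. f x \<noteq> \<zero>\<^bsub>R\<^esub>} \<and> {x. f x \<noteq> \<zero>\<^bsub>R\<^esub>} \<subseteq> X},
     mult = undefined, one = undefined,
     zero = (\<lambda>x. \<zero>\<^bsub>R\<^esub>), add = (\<lambda>f g x. f x \<oplus>\<^bsub>R\<^esub> g x), smult = (\<lambda>a f x. a \<otimes>\<^bsub>R\<^esub> f x)\<rparr>"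

definition unit_vector :: "('r, 's) ring_scheme \<Rightarrow> 'a \<Rightarrow> 'a \<Rightarrow> 'r" where
  "unit_vector R x = (\<lambda>y. if y = x then \<one>\<^bsub>R\<^esub> else \<zero>\<^bsub>R\<^esub>)"

lemma left_module_free:
  assumes "ring R"
  shows "left_module R (free_module R X)"
proof -
  interpret ring R by fact
  let ?F = "free_module R X"
  have add: "(\<lambda>x. f x \<oplus>\<^bsub>R\<^esub> g x) \<in> carrier ?F" if "f \<in> carrier ?F" "g \<in> carrier ?F" for f g
  proof -
    have "{x. f x \<oplus>\<^bsub>R\<^esub> g x \<noteq> \<zero>\<^bsub>R\<^esub>} \<subseteq> {x. f x \<noteq> \<zero>\<^bsub>R\<^esub>} \<union> {x. g x \<noteq> \<zero>\<^bsub>R\<^esub>}" by auto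
    then show ?thesis using that by (auto simp: free_module_def Pi_iff intro: finite_subset)
  qed
  have smult: "(\<lambda>x. a \<otimes>\<^bsub>R\<^esub> f x) \<in> carrier ?F" if "a \<in> carrier R" "f \<in> carrier ?F" for f a
  proof -
    have "{x. a \<otimes>\<^bsub>R\<^esub> f x \<noteq> \<zero>\<^bsub>R\<^esub>} \<subseteq> {x. f x \<noteq> \<zero>\<^bsub>R\<^esub>}" using that by auto
    then show ?thesis using that by (auto simp: free_module_def Pi_iff intro: finite_subset)
  qed
  have c: "f x \<in> carrier R" if "f \<in> carrier ?F" for f x
    using that by (auto simp: free_module_def)
  have neg: "(\<lambda>x. \<ominus>\<^bsub>R\<^esub> f x) \<in> carrier ?F" if "f \<in> carrier ?F" for f
  proof -
    have "(\<lambda>x. \<ominus>\<^bsub>R\<^esub> f x) = (\<lambda>x. (\<ominus>\<^bsub>R\<^esub> \<one>\<^bsub>R\<^esub>) \<otimes>\<^bsub>R\<^esub> f x)" using c[OF that] by (simp add: l_minus)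
    then show ?thesis using smult[of "\<ominus>\<^bsub>R\<^esub> \<one>\<^bsub>R\<^esub>" f] that by simp
  qed
  have zero: "(\<lambda>x. \<zero>\<^bsub>R\<^esub>) \<in> carrier ?F" by (simp add: free_module_def)
  have ops: "f \<oplus>\<^bsub>?F\<^esub> g = (\<lambda>x. f x \<oplus>\<^bsub>R\<^esub> g x)" "\<zero>\<^bsub>?F\<^esub> = (\<lambda>x. \<zero>\<^bsub>R\<^esub>)" "a \<odot>\<^bsub>?F\<^esub> f = (\<lambda>x. a \<otimes>\<^bsub>R\<^esub> f x)"
    for f g a by (simp_all add: free_module_def)
  have "abelian_group ?F"
  proof (rule abelian_groupI)
    fix f assume "f \<in> carrier ?F"
    then show "\<exists>y\<in>carrier ?F. y \<oplus>\<^bsub>?F\<^esub> f = \<zero>\<^bsub>?F\<^esub>"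
      by (intro bexI[OF _ neg]) (simp_all add: ops l_neg c)
  qed (simp_all add: add ops zero c a_ac)
  then show ?thesis
    by (intro left_module.intro left_module_axioms.intro assms)
      (simp_all add: smult ops c l_distr r_distr m_assoc)
qed

lemma unit_vector_closed: "ring R \<Longrightarrow> x \<in> X \<Longrightarrow> unit_vector R x \<in> carrier (free_module R X)"
proof -
  assume "ring R" and x: "x \<in> X"
  interpret ring R by fact
  have "{y. unit_vector R x y \<noteq> \<zero>\<^bsub>R\<^esub>} \<subseteq> {x}" by (auto simp: unit_vector_def)
  then show ?thesis using x finite_subset by (auto simp: free_module_def unit_vector_def)
qed

text \<open>The lift is the linear combination of the values \<open>v x\<close> with coefficients
  \<open>f x\<close>, summed over the support of \<open>f\<close>.\<close>

lemma free_module_lift: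
  assumes "ring R" and M: "left_module R M" and v: "\<forall>x\<in>X. v x \<in> carrier M"
  shows "\<exists>h. lin R (free_module R X) M h \<and> (\<forall>x\<in>X. h (unit_vector R x) = v x)"
proof -
  interpret M: left_module R M by fact
  let ?F = "free_module R X"
  define h where "h f = (\<Oplus>\<^bsub>M\<^esub>x\<in>{x. f x \<noteq> \<zero>\<^bsub>R\<^esub>}. f x \<odot>\<^bsub>M\<^esub> v x)" for f
  have c: "f x \<in> carrier R" if "f \<in> carrier ?F" for f x
    using that by (auto simp: free_module_def)
  \<comment> \<open>The support varies with \<open>f\<close>. This allows the sum to be taken over
    any larger finite subset of \<open>X\<close>, so that the sums for two vectors and for their sum
    share an index set.\<close>
  have h_eq: "h f = (\<Oplus>\<^bsub>M\<^esub>x\<in>S. f x \<odot>\<^bsub>M\<^esub> v x)"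
    if "f \<in> carrier ?F" "finite S" "S \<subseteq> X" "{x. f x \<noteq> \<zero>\<^bsub>R\<^esub>} \<subseteq> S" for f S
    unfolding h_def
    by (rule M.add.finprod_mono_neutral_cong_left) (use that c v in \<open>auto simp: subset_iff\<close>)
  have supp: "finite {x. f x \<noteq> \<zero>\<^bsub>R\<^esub>}" "{x. f x \<noteq> \<zero>\<^bsub>R\<^esub>} \<subseteq> X" if "f \<in> carrier ?F" for f
    using that by (auto simp: free_module_def)
  have "lin R ?F M h"
  proof (rule linI)
    fix f assume f: "f \<in> carrier ?F"
    then show "h f \<in> carrier M" unfolding h_def
      using supp[OF f] v c by (intro M.finsum_closed) (auto simp: subset_iff)
    fix g assume g: "g \<in> carrier ?F"
    let ?S = "{x. f x \<noteq> \<zero>\<^bsub>R\<^esub>} \<union> {x. g x \<noteq> \<zero>\<^bsub>R\<^esub>}"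
    have fg: "f \<oplus>\<^bsub>?F\<^esub> g = (\<lambda>x. f x \<oplus>\<^bsub>R\<^esub> g x)" by (simp add: free_module_def)
    have fgc: "f \<oplus>\<^bsub>?F\<^esub> g \<in> carrier ?F"
      using f g left_module_free[OF \<open>ring R\<close>, of X, THEN left_module_abelian_group]
      by (simp add: abelian_group.axioms(1) abelian_monoid.a_closed)
    have S: "finite ?S" "?S \<subseteq> X" using supp[OF f] supp[OF g] by auto
    have "h (f \<oplus>\<^bsub>?F\<^esub> g) = (\<Oplus>\<^bsub>M\<^esub>x\<in>?S. (f x \<oplus>\<^bsub>R\<^esub> g x) \<odot>\<^bsub>M\<^esub> v x)"
    proof -
      have "{x. f x \<oplus>\<^bsub>R\<^esub> g x \<noteq> \<zero>\<^bsub>R\<^esub>} \<subseteq> ?S" by auto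
      then show ?thesis using h_eq[OF fgc S] by (simp add: fg)
    qed
    also have "\<dots> = (\<Oplus>\<^bsub>M\<^esub>x\<in>?S. f x \<odot>\<^bsub>M\<^esub> v x \<oplus>\<^bsub>M\<^esub> g x \<odot>\<^bsub>M\<^esub> v x)"
      using S v f g c by (intro M.finsum_cong') (auto simp: M.smult_l_distr subset_iff)
    also have "\<dots> = (\<Oplus>\<^bsub>M\<^esub>x\<in>?S. f x \<odot>\<^bsub>M\<^esub> v x) \<oplus>\<^bsub>M\<^esub> (\<Oplus>\<^bsub>M\<^esub>x\<in>?S. g x \<odot>\<^bsub>M\<^esub> v x)"
      using S v f g c by (intro M.finsum_addf) (auto simp: subset_iff)
    also have "\<dots> = h f \<oplus>\<^bsub>M\<^esub> h g" using S f g by (simp add: h_eq[of f ?S] h_eq[of g ?S])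
    finally show "h (f \<oplus>\<^bsub>?F\<^esub> g) = h f \<oplus>\<^bsub>M\<^esub> h g" .
  next
    fix a f assume a: "a \<in> carrier R" and f: "f \<in> carrier ?F"
    let ?S = "{x. f x \<noteq> \<zero>\<^bsub>R\<^esub>}"
    have af: "a \<odot>\<^bsub>?F\<^esub> f = (\<lambda>x. a \<otimes>\<^bsub>R\<^esub> f x)" by (simp add: free_module_def)
    have afc: "a \<odot>\<^bsub>?F\<^esub> f \<in> carrier ?F"
      using a f left_module.smult_closed[OF left_module_free[OF \<open>ring R\<close>]] by blast
    have scale: "a \<odot>\<^bsub>M\<^esub> (\<Oplus>\<^bsub>M\<^esub>x\<in>T. f x \<odot>\<^bsub>M\<^esub> v x) = (\<Oplus>\<^bsub>M\<^esub>x\<in>T. (a \<otimes>\<^bsub>R\<^esub> f x) \<odot>\<^bsub>M\<^esub> v x)"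
      if "finite T" "T \<subseteq> X" for T
      using that
    proof (induction T rule: finite_induct)
      case (insert t T)
      have "(\<lambda>x. f x \<odot>\<^bsub>M\<^esub> v x) \<in> T \<rightarrow> carrier M" "(\<lambda>x. (a \<otimes>\<^bsub>R\<^esub> f x) \<odot>\<^bsub>M\<^esub> v x) \<in> T \<rightarrow> carrier M"
        "f t \<odot>\<^bsub>M\<^esub> v t \<in> carrier M" "v t \<in> carrier M"
        using insert.prems a c[OF f] v by auto
      then show ?case using insert a c[OF f] by (simp add: M.smult_r_distr M.smult_assoc)
    qed (use a in simp)
    have "h (a \<odot>\<^bsub>?F\<^esub> f) = (\<Oplus>\<^bsub>M\<^esub>x\<in>?S. (a \<otimes>\<^bsub>R\<^esub> f x) \<odot>\<^bsub>M\<^esub> v x)"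
    proof -
      have "{x. a \<otimes>\<^bsub>R\<^esub> f x \<noteq> \<zero>\<^bsub>R\<^esub>} \<subseteq> ?S" using a by auto
      then show ?thesis using h_eq[OF afc supp[OF f]] by (simp add: af)
    qed
    also have "\<dots> = a \<odot>\<^bsub>M\<^esub> h f" unfolding h_def using scale[OF supp[OF f]] by simp
    finally show "h (a \<odot>\<^bsub>?F\<^esub> f) = a \<odot>\<^bsub>M\<^esub> h f" .
  qed
  moreover have "h (unit_vector R x) = v x" if "x \<in> X" for x
  proof -
    have "h (unit_vector R x) = (\<Oplus>\<^bsub>M\<^esub>y\<in>{x}. unit_vector R x y \<odot>\<^bsub>M\<^esub> v y)"
      using that unit_vector_closed[OF \<open>ring R\<close> that]
      by (intro h_eq) (auto simp: unit_vector_def split: if_splits)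
    also have "\<dots> = v x" using v that by (simp add: unit_vector_def)
    finally show ?thesis .
  qed
  ultimately show ?thesis by blast
qed

text \<open>Induction on a finite set containing the support, splitting off one multiple of a unit
  vector at a time.\<close>

lemma free_module_eqI:
  assumes "ring R" and M: "left_module R M"
    and g: "lin R (free_module R X) M g" and h: "lin R (free_module R X) M h"
    and eq: "\<forall>x\<in>X. g (unit_vector R x) = h (unit_vector R x)"
    and f: "f \<in> carrier (free_module R X)"
  shows "g f = h f"
proof -
  interpret M: left_module R M by fact
  let ?F = "free_module R X"
  have F: "left_module R ?F" by (rule left_module_free) fact
  have "finite {x. f x \<noteq> \<zero>\<^bsub>R\<^esub>}" using f by (simp add: free_module_def)
  then obtain S where "finite S" "{x. f x \<noteq> \<zero>\<^bsub>R\<^esub>} \<subseteq> S" by blast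
  then show ?thesis using f
  proof (induction S arbitrary: f rule: finite_induct)
    case empty
    then have "f = \<zero>\<^bsub>?F\<^esub>" by (auto simp: free_module_def)
    then show ?case using lin_zero[OF g F M] lin_zero[OF h F M] by simp
  next
    case (insert s S)
    have c: "f x \<in> carrier R" for x using insert.prems by (auto simp: free_module_def)
    show ?case
    proof (cases "f s = \<zero>\<^bsub>R\<^esub>")
      case True
      then have "{x. f x \<noteq> \<zero>\<^bsub>R\<^esub>} \<subseteq> S" using insert.prems by auto
      then show ?thesis using insert by blast
    next
      case False
      then have s: "s \<in> X" using insert.prems by (auto simp: free_module_def)
      have sub: "{x. (f(s := \<zero>\<^bsub>R\<^esub>)) x \<noteq> \<zero>\<^bsub>R\<^esub>} \<subseteq> {x. f x \<noteq> \<zero>\<^bsub>R\<^esub>}" by auto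
      then have f': "f(s := \<zero>\<^bsub>R\<^esub>) \<in> carrier ?F"
        using insert.prems finite_subset[OF sub] by (auto simp: free_module_def)
      have "g (f(s := \<zero>\<^bsub>R\<^esub>)) = h (f(s := \<zero>\<^bsub>R\<^esub>))"
        using insert.prems by (intro insert.IH f') auto
      moreover have "f = f(s := \<zero>\<^bsub>R\<^esub>) \<oplus>\<^bsub>?F\<^esub> f s \<odot>\<^bsub>?F\<^esub> unit_vector R s"
        using c by (auto simp: free_module_def unit_vector_def fun_eq_iff)
      moreover have u: "unit_vector R s \<in> carrier ?F" by (rule unit_vector_closed) fact+
      then have "f s \<odot>\<^bsub>?F\<^esub> unit_vector R s \<in> carrier ?F" by (rule left_module.smult_closed[OF F c])
      then have "k (f(s := \<zero>\<^bsub>R\<^esub>) \<oplus>\<^bsub>?F\<^esub> f s \<odot>\<^bsub>?F\<^esub> unit_vector R s)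
          = k (f(s := \<zero>\<^bsub>R\<^esub>)) \<oplus>\<^bsub>M\<^esub> f s \<odot>\<^bsub>M\<^esub> k (unit_vector R s)" if "lin R ?F M k" for k
        using that f' c u by (simp add: lin_add lin_smult)
      ultimately show ?thesis using g h bspec[OF eq s] by metis
    qed
  qed
qed

section \<open>Small modules\<close>

locale module_category =
  fixes R :: "('r, 's) ring_scheme" and U :: "'m set set"
  assumes ring: "ring R" and universe: "module_universe R U"
begin

abbreviation "LM \<equiv> left_modules R U"

lemma LM_left_module [dest]: "M \<in> LM \<Longrightarrow> left_module R M"
  by (simp add: left_modules_def)

lemma universe_lepoll: "\<lbrakk>X \<in> U; Y \<lesssim> X\<rbrakk> \<Longrightarrow> Y \<in> U"
  using universe unfolding module_universe_def by blast

text \<open>The source of smallness for kernels, images and quotients by representatives: their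
  carriers are subsets of a small carrier.\<close>

lemma LM_subset:
  "\<lbrakk>left_module R N; carrier N \<subseteq> carrier M; M \<in> LM\<rbrakk> \<Longrightarrow> N \<in> LM"
  using universe_lepoll[OF _ subset_imp_lepoll] by (auto simp: left_modules_def)

text \<open>Brings a set of an arbitrary type into a small set of type \<open>'m\<close> once its
  size is bounded by a small set.\<close>

lemma small_embedding:
  assumes "A \<lesssim> Z" and "Z \<in> U"
  shows "\<exists>e :: 'a \<Rightarrow> 'm. inj_on e A \<and> e ` A \<in> U"
proof -
  obtain e where e: "inj_on e A" "e ` A \<subseteq> Z" using assms(1) by (auto simp: lepoll_def)
  have "e ` A \<in> U" by (rule universe_lepoll[OF assms(2) subset_imp_lepoll[OF e(2)]])
  then show ?thesis using e by blast
qed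

text \<open>Cardinals are comparable, so the largest of the two given sets and the infinite set
  supplied by the universe serves as a bound for all.\<close>

lemma common_bound:
  assumes "X \<in> U" "Y \<in> U"
  obtains Z where "Z \<in> U" "infinite Z" "carrier R \<lesssim> Z" "X \<lesssim> Z" "Y \<lesssim> Z"
proof -
  obtain Z0 where Z0: "Z0 \<in> U" "infinite Z0" "carrier R \<lesssim> Z0"
    using universe by (auto simp: module_universe_def)
  have max: "\<exists>Z\<in>U. A \<lesssim> Z \<and> B \<lesssim> Z" if "A \<in> U" "B \<in> U" for A B :: "'m set"
    using lepoll_linear[of A B] that by blast
  obtain Z1 where Z1: "Z1 \<in> U" "Z0 \<lesssim> Z1" "X \<lesssim> Z1" using max[OF Z0(1) assms(1)] by blast
  obtain Z where Z: "Z \<in> U" "Z1 \<lesssim> Z" "Y \<lesssim> Z" using max[OF Z1(1) assms(2)] by blast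
  have Z0Z: "Z0 \<lesssim> Z" by (rule lepoll_trans[OF Z1(2) Z(2)])
  have "infinite Z"
    using Z0(2) lepoll_trans[OF _ Z0Z] unfolding infinite_le_lepoll by blast
  then show thesis
    by (rule that[OF Z(1) _ lepoll_trans[OF Z0(3) Z0Z] lepoll_trans[OF Z1(3) Z(2)] Z(3)])
qed

section \<open>Biproducts inside the universe\<close>

text \<open>A fixed but arbitrary injection of the product into a small set. After the basic facts
  on \<open>dpair\<close>, \<open>dfst\<close> and \<open>dsnd\<close>, the proofs handle
  \<open>dsum\<close> through these three maps only.\<close>

definition pair_emb :: "('r, 'm) module \<Rightarrow> ('r, 'm) module \<Rightarrow> 'm \<times> 'm \<Rightarrow> 'm" where
  "pair_emb M N = (SOME e. inj_on e (carrier M \<times> carrier N) \<and> e ` (carrier M \<times> carrier N) \<in> U)"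

definition dsum :: "('r, 'm) module \<Rightarrow> ('r, 'm) module \<Rightarrow> ('r, 'm) module" where
  "dsum M N = induced_module (pair_module M N) (pair_emb M N)"

definition dpair :: "('r, 'm) module \<Rightarrow> ('r, 'm) module \<Rightarrow> 'm \<Rightarrow> 'm \<Rightarrow> 'm" where
  "dpair M N x y = pair_emb M N (x, y)"

definition dfst :: "('r, 'm) module \<Rightarrow> ('r, 'm) module \<Rightarrow> 'm \<Rightarrow> 'm" where
  "dfst M N z = fst (inv_into (carrier M \<times> carrier N) (pair_emb M N) z)"

definition dsnd :: "('r, 'm) module \<Rightarrow> ('r, 'm) module \<Rightarrow> 'm \<Rightarrow> 'm" where
  "dsnd M N z = snd (inv_into (carrier M \<times> carrier N) (pair_emb M N) z)"

lemma carrier_pair_module: "carrier (pair_module M N) = carrier M \<times> carrier N"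
  by (simp add: pair_module_def)

lemma pair_emb:
  assumes "M \<in> LM" "N \<in> LM"
  shows "inj_on (pair_emb M N) (carrier M \<times> carrier N)" "pair_emb M N ` (carrier M \<times> carrier N) \<in> U"
proof -
  have "carrier M \<in> U" "carrier N \<in> U" using assms by (auto simp: left_modules_def)
  then obtain Z where "Z \<in> U" "infinite Z" "carrier M \<lesssim> Z" "carrier N \<lesssim> Z"
    using common_bound by metis
  then have "carrier M \<times> carrier N \<lesssim> Z" by (intro Times_lepoll_infinite)
  from small_embedding[OF this \<open>Z \<in> U\<close>]
  have "inj_on (pair_emb M N) (carrier M \<times> carrier N) \<and> pair_emb M N ` (carrier M \<times> carrier N) \<in> U"
    unfolding pair_emb_def by (rule someI_ex)
  then show "inj_on (pair_emb M N) (carrier M \<times> carrier N)" "pair_emb M N ` (carrier M \<times> carrier N) \<in> U"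
    by auto
qed

lemma induced_inj:
  fixes N :: "('r, 'a) module" and e :: "'a \<Rightarrow> 'b"
  assumes "left_module R N" "inj_on e (carrier N)"
  shows "left_module R (induced_module N e)" "lin R N (induced_module N e) e"
    "carrier (induced_module N e) = e ` carrier N"
  by (rule induced_module[OF assms(1)]; use inj_onD[OF assms(2)] in metis)+

context
  fixes M N assumes MN: "M \<in> LM" "N \<in> LM"
begin

lemma
  shows dsum_LM: "dsum M N \<in> LM" and lin_pair_emb: "lin R (pair_module M N) (dsum M N) (pair_emb M N)"
    and carrier_dsum: "carrier (dsum M N) = pair_emb M N ` (carrier M \<times> carrier N)"
proof -
  have "left_module R (pair_module M N)" using MN by (intro left_module_pair) auto
  note * = induced_inj[OF this, of "pair_emb M N", unfolded carrier_pair_module, OF pair_emb(1)[OF MN]]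
  show "lin R (pair_module M N) (dsum M N) (pair_emb M N)"
    "carrier (dsum M N) = pair_emb M N ` (carrier M \<times> carrier N)"
    using * by (simp_all add: dsum_def)
  then show "dsum M N \<in> LM" using *(1) pair_emb(2)[OF MN] by (simp add: left_modules_def dsum_def)
qed

lemma dpair_closed: "\<lbrakk>x \<in> carrier M; y \<in> carrier N\<rbrakk> \<Longrightarrow> dpair M N x y \<in> carrier (dsum M N)"
  by (simp add: carrier_dsum dpair_def)

lemma dfst_dpair [simp]: "\<lbrakk>x \<in> carrier M; y \<in> carrier N\<rbrakk> \<Longrightarrow> dfst M N (dpair M N x y) = x"
  using pair_emb(1)[OF MN] by (simp add: dfst_def dpair_def)

lemma dsnd_dpair [simp]: "\<lbrakk>x \<in> carrier M; y \<in> carrier N\<rbrakk> \<Longrightarrow> dsnd M N (dpair M N x y) = y"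
  using pair_emb(1)[OF MN] by (simp add: dsnd_def dpair_def)

lemma dsum_cases:
  assumes "z \<in> carrier (dsum M N)"
  obtains x y where "x \<in> carrier M" "y \<in> carrier N" "z = dpair M N x y"
  using assms by (auto simp: carrier_dsum dpair_def)

lemma dpair_collapse [simp]: "z \<in> carrier (dsum M N) \<Longrightarrow> dpair M N (dfst M N z) (dsnd M N z) = z"
  by (elim dsum_cases) simp

lemma dpair_add:
  "\<lbrakk>x \<in> carrier M; y \<in> carrier N; x' \<in> carrier M; y' \<in> carrier N\<rbrakk> \<Longrightarrow>
    dpair M N x y \<oplus>\<^bsub>dsum M N\<^esub> dpair M N x' y' = dpair M N (x \<oplus>\<^bsub>M\<^esub> x') (y \<oplus>\<^bsub>N\<^esub> y')"
  using lin_add[OF lin_pair_emb, of "(x, y)" "(x', y')"] by (simp add: pair_module_def dpair_def)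

lemma dpair_smult:
  "\<lbrakk>a \<in> carrier R; x \<in> carrier M; y \<in> carrier N\<rbrakk> \<Longrightarrow>
    a \<odot>\<^bsub>dsum M N\<^esub> dpair M N x y = dpair M N (a \<odot>\<^bsub>M\<^esub> x) (a \<odot>\<^bsub>N\<^esub> y)"
  using lin_smult[OF lin_pair_emb, of a "(x, y)"] by (simp add: pair_module_def dpair_def)

lemma lin_dpair:
  assumes "lin R X M f" "lin R X N g"
  shows "lin R X (dsum M N) (\<lambda>x. dpair M N (f x) (g x))"
  using assms by (intro linI) (simp_all add: dpair_closed dpair_add dpair_smult lin_closed lin_add lin_smult)

lemma lin_dfst: "lin R (dsum M N) M (dfst M N)"
proof -
  interpret M: left_module R M using MN by auto
  interpret N: left_module R N using MN by auto
  show ?thesis by (rule linI) (auto elim!: dsum_cases simp: dpair_add dpair_smult)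
qed

lemma lin_dsnd: "lin R (dsum M N) N (dsnd M N)"
proof -
  interpret M: left_module R M using MN by auto
  interpret N: left_module R N using MN by auto
  show ?thesis by (rule linI) (auto elim!: dsum_cases simp: dpair_add dpair_smult)
qed

lemma dpair_zero: "dpair M N \<zero>\<^bsub>M\<^esub> \<zero>\<^bsub>N\<^esub> = \<zero>\<^bsub>dsum M N\<^esub>"
  by (simp add: dsum_def dpair_def zero_induced_module pair_module_def)

end

section \<open>Enough projectives\<close>

text \<open>The free module on the underlying set of \<open>M\<close> is small because each vector
  is determined by a list over a product of small size. Its transport along an injection into
  \<open>'m\<close> is projective and maps onto \<open>M\<close> by sending basis vectors to the
  elements they stand for.\<close>

lemma free_cover:
  assumes "M \<in> LM"
  obtains P \<pi> where "projective R U P" "lin R P M \<pi>" "\<pi> ` carrier P = carrier M"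
proof -
  let ?X = "carrier M" let ?F = "free_module R ?X"
  have F: "left_module R ?F" by (rule left_module_free[OF ring])
  have "?X \<in> U" using assms by (simp add: left_modules_def)
  then obtain Z where Z: "Z \<in> U" "infinite Z" "carrier R \<lesssim> Z" "?X \<lesssim> Z"
    using common_bound by metis
  have "carrier ?F \<lesssim> lists (?X \<times> carrier R)"
  proof -
    \<comment> \<open>Lists the graph of \<open>f\<close> over its finite support, from which
      \<open>f\<close> can be recovered.\<close>
    define l where "l f = (SOME xs. set xs = (\<lambda>x. (x, f x)) ` {x. f x \<noteq> \<zero>\<^bsub>R\<^esub>})" for f :: "'m \<Rightarrow> 'r"
    have l: "set (l f) = (\<lambda>x. (x, f x)) ` {x. f x \<noteq> \<zero>\<^bsub>R\<^esub>}" if "f \<in> carrier ?F" for f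
    proof -
      have "finite ((\<lambda>x. (x, f x)) ` {x. f x \<noteq> \<zero>\<^bsub>R\<^esub>})" using that by (simp add: free_module_def)
      then have "\<exists>xs. set xs = (\<lambda>x. (x, f x)) ` {x. f x \<noteq> \<zero>\<^bsub>R\<^esub>}" by (rule finite_list)
      then show ?thesis unfolding l_def by (rule someI_ex)
    qed
    have mem: "(x, r) \<in> set (l f) \<longleftrightarrow> f x = r \<and> r \<noteq> \<zero>\<^bsub>R\<^esub>" if "f \<in> carrier ?F" for f x r
      using l[OF that] by auto
    have "inj_on l (carrier ?F)"
    proof (rule inj_onI, rule ext)
      fix f g x assume fg: "f \<in> carrier ?F" "g \<in> carrier ?F" "l f = l g"
      show "f x = g x"
        using mem[OF fg(1), of x "f x"] mem[OF fg(2), of x "f x"] mem[OF fg(1), of x "g x"]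
          mem[OF fg(2), of x "g x"] fg(3) by (cases "f x = \<zero>\<^bsub>R\<^esub>") auto
    qed
    moreover have "l ` carrier ?F \<subseteq> lists (?X \<times> carrier R)"
    proof (rule image_subsetI)
      fix f assume f: "f \<in> carrier ?F"
      have "set (l f) \<subseteq> ?X \<times> carrier R" using l[OF f] f by (auto simp: free_module_def)
      then show "l f \<in> lists (?X \<times> carrier R)" by (simp add: lists_eq_set)
    qed
    ultimately show ?thesis unfolding lepoll_def by blast
  qed
  also have "\<dots> \<lesssim> lists Z" using Z by (intro lists_lepoll_mono Times_lepoll_infinite)
  also have "\<dots> \<lesssim> Z" using Z by (intro lists_lepoll_infinite)
  finally have small: "carrier ?F \<lesssim> Z" .
  from small_embedding[OF this Z(1)]
  obtain e :: "('m \<Rightarrow> 'r) \<Rightarrow> 'm" where e: "inj_on e (carrier ?F)" "e ` carrier ?F \<in> U"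
    by blast
  define P where "P = induced_module ?F e"
  note P = induced_inj[OF F e(1), folded P_def]
  have PLM: "P \<in> LM" using P e(2) by (simp add: left_modules_def)
  have surj: "e ` carrier ?F = carrier P" by (simp add: P(3))
  \<comment> \<open>As \<open>e\<close> is injective, maps out of the free module factor through its
    copy \<open>P\<close>; universal properties can thus be checked on the free module.\<close>
  have through: "\<exists>k. lin R P X k \<and> (\<forall>f\<in>carrier ?F. k (e f) = h f)"
    if X: "X \<in> LM" and h: "lin R ?F X h" for X and h :: "('m \<Rightarrow> 'r) \<Rightarrow> 'm"
  proof -
    have "h f = \<zero>\<^bsub>X\<^esub>" if "f \<in> carrier ?F" "e f = \<zero>\<^bsub>P\<^esub>" for f
    proof -
      have "e f = e \<zero>\<^bsub>?F\<^esub>" using lin_zero[OF P(2) F P(1)] that by simp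
      then have "f = \<zero>\<^bsub>?F\<^esub>"
        using inj_onD[OF e(1)] that(1) F[THEN left_module_abelian_group]
        by (simp add: abelian_group.axioms(1) abelian_monoid.zero_closed)
      then show ?thesis using lin_zero[OF h F] X by auto
    qed
    then show ?thesis
      using lin_factor[OF P(2) surj h F P(1) LM_left_module[OF X]] by blast
  qed
  have "projective R U P"
    unfolding projective_def
  proof (intro conjI PLM ballI impI)
    fix X Y g f
    assume X: "X \<in> LM" and Y: "Y \<in> LM" and "g \<in> mod_hom R X Y" "f \<in> mod_hom R P Y"
      and gs: "g ` carrier X = carrier Y"
    then have g: "lin R X Y g" and f: "lin R P Y f" by (simp_all add: mod_hom_iff)
    \<comment> \<open>Lifting a map out of \<open>P\<close> amounts to choosing preimages under
      \<open>g\<close> of the images of the basis vectors.\<close>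
    have "\<exists>y\<in>carrier X. g y = f (e (unit_vector R x))" if "x \<in> ?X" for x
    proof -
      have "f (e (unit_vector R x)) \<in> carrier Y"
        using lin_closed[OF f lin_closed[OF P(2) unit_vector_closed[OF ring that]]] .
      then show ?thesis using gs by (metis imageE)
    qed
    then obtain v where v: "\<forall>x\<in>?X. v x \<in> carrier X"
      "\<forall>x\<in>?X. g (v x) = f (e (unit_vector R x))" by metis
    obtain h where h: "lin R ?F X h" "\<forall>x\<in>?X. h (unit_vector R x) = v x"
      using free_module_lift[OF ring LM_left_module[OF X] v(1)] by blast
    obtain k where k: "lin R P X k" "\<forall>f\<in>carrier ?F. k (e f) = h f"
      using through[OF X h(1)] by blast
    have eq: "g (h u) = f (e u)" if "u \<in> carrier ?F" for u
    proof (rule free_module_eqI[OF ring LM_left_module[OF Y] lin_comp[OF h(1) g] lin_comp[OF P(2) f] _ that])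
      show "\<forall>x\<in>?X. g (h (unit_vector R x)) = f (e (unit_vector R x))" using h(2) v(2) by simp
    qed
    have "g (k p) = f p" if "p \<in> carrier P" for p
    proof -
      obtain u where u: "u \<in> carrier ?F" "p = e u" using \<open>p \<in> carrier P\<close> unfolding P(3) by blast
      show ?thesis using eq[OF u(1)] k(2) u by simp
    qed
    then show "\<exists>h\<in>mod_hom R P X. \<forall>p\<in>carrier P. g (h p) = f p"
      using k(1) unfolding mod_hom_iff[symmetric] by blast
  qed
  moreover obtain h where h: "lin R ?F M h" "\<forall>x\<in>?X. h (unit_vector R x) = x"
    using free_module_lift[OF ring LM_left_module[OF assms], of ?X "\<lambda>x. x"] by auto
  then obtain k where k: "lin R P M k" "\<forall>f\<in>carrier ?F. k (e f) = h f"
    using through[OF assms] by blast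
  moreover have "k ` carrier P = carrier M"
  proof (rule lin_surjI[OF k(1)])
    fix x assume x: "x \<in> carrier M"
    have u: "unit_vector R x \<in> carrier ?F" by (rule unit_vector_closed[OF ring x])
    then have "e (unit_vector R x) \<in> carrier P" "k (e (unit_vector R x)) = x"
      using k(2) h(2) x by (simp_all add: P(3))
    then show "x \<in> k ` carrier P" by (metis imageI)
  qed
  ultimately show thesis using that[of P k] by simp
qed

end

section \<open>Short exact sequences and \<open>Ext\<close>\<close>

lemma short_exactI:
  assumes "lin R X Y f" "lin R Y Z g" "inj_on f (carrier X)"
    and "\<forall>x\<in>carrier X. g (f x) = \<zero>\<^bsub>Z\<^esub>"
    and "\<forall>y\<in>carrier Y. g y = \<zero>\<^bsub>Z\<^esub> \<longrightarrow> y \<in> f ` carrier X"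
    and "g ` carrier Y = carrier Z"
  shows "short_exact R X f Y g Z"
proof -
  have "f ` carrier X = {y \<in> carrier Y. g y = \<zero>\<^bsub>Z\<^esub>}"
    using assms(4,5) lin_closed[OF assms(1)] by auto
  then show ?thesis
    using assms by (simp add: short_exact_def mod_hom_iff exact_at_def a_kernel_def')
qed

lemma short_exactD:
  assumes "short_exact R X f Y g Z"
  shows "lin R X Y f" "lin R Y Z g" "inj_on f (carrier X)"
    and "f ` carrier X = {y \<in> carrier Y. g y = \<zero>\<^bsub>Z\<^esub>}"
    and "\<forall>x\<in>carrier X. g (f x) = \<zero>\<^bsub>Z\<^esub>"
    and "\<forall>y\<in>carrier Y. g y = \<zero>\<^bsub>Z\<^esub> \<longrightarrow> (\<exists>x\<in>carrier X. y = f x)"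
    and "g ` carrier Y = carrier Z"
proof -
  show 4: "f ` carrier X = {y \<in> carrier Y. g y = \<zero>\<^bsub>Z\<^esub>}"
    and "lin R X Y f" "lin R Y Z g" "inj_on f (carrier X)" "g ` carrier Y = carrier Z"
    using assms by (auto simp: short_exact_def mod_hom_iff exact_at_def a_kernel_def')
  show "\<forall>x\<in>carrier X. g (f x) = \<zero>\<^bsub>Z\<^esub>" 
    "\<forall>y\<in>carrier Y. g y = \<zero>\<^bsub>Z\<^esub> \<longrightarrow> (\<exists>x\<in>carrier X. y = f x)"
    using 4 by auto
qed

abbreviation ker_mod :: "('r, 'm) module \<Rightarrow> ('r, 'n) module \<Rightarrow> ('m \<Rightarrow> 'n) \<Rightarrow> ('r, 'm) module" where
  "ker_mod M N f \<equiv> M\<lparr>carrier := a_kernel M N f\<rparr>"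

abbreviation zero_mod :: "('r, 'm) module \<Rightarrow> ('r, 'm) module" where
  "zero_mod M \<equiv> M\<lparr>carrier := {\<zero>\<^bsub>M\<^esub>}\<rparr>"

lemma lin_subset: "T \<subseteq> carrier M \<Longrightarrow> lin R (M\<lparr>carrier := T\<rparr>) M (\<lambda>x. x)"
  by (auto simp: lin_def)

lemma short_exact_ker:
  assumes "lin R N Q q" "q ` carrier N = carrier Q"
  shows "short_exact R (ker_mod N Q q) (\<lambda>x. x) N q Q"
  using assms by (intro short_exactI) (auto simp: a_kernel_def' intro: lin_subset)

section \<open>Cohomology of Hom sequences in terms of cocycles\<close>

text \<open>Triviality of the cohomology group and exactness of the Hom sequence both mean that
  every cocycle is a coboundary. Stated for plain linear maps, this removes extensional functions
  and factor groups from everything that follows.\<close>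

lemma trivial_hom_cohomology_iff:
  assumes P: "P \<in> complexes R U" and N: "left_module R N"
  shows "trivial_group (hom_cohomology R P N n) \<longleftrightarrow>
    (\<forall>h. lin R (obj P n) N h \<and> (\<forall>x\<in>carrier (obj P (n + 1)). h (diff P (n + 1) x) = \<zero>\<^bsub>N\<^esub>) \<longrightarrow>
      (\<exists>g. lin R (obj P (n - 1)) N g \<and> (\<forall>x\<in>carrier (obj P n). g (diff P n x) = h x)))"
    (is "_ \<longleftrightarrow> ?cob")
    and hom_exact_at_iff: "exact_at (hom_group R (obj P (n - 1)) N) (precomp P n)
      (hom_group R (obj P n) N) (precomp P (n + 1)) (hom_group R (obj P (n + 1)) N) \<longleftrightarrow>
    (\<forall>h. lin R (obj P n) N h \<and> (\<forall>x\<in>carrier (obj P (n + 1)). h (diff P (n + 1) x) = \<zero>\<^bsub>N\<^esub>) \<longrightarrow>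
      (\<exists>g. lin R (obj P (n - 1)) N g \<and> (\<forall>x\<in>carrier (obj P n). g (diff P n x) = h x)))"
proof -
  let ?X = "obj P n" let ?W = "obj P (n - 1)" let ?Y = "obj P (n + 1)"
  interpret N: left_module R N by fact
  have mods: "left_module R ?X" "left_module R ?W" "left_module R ?Y"
    and d: "lin R ?X ?W (diff P n)" and d': "lin R ?Y ?X (diff P (n + 1))"
    and dd: "\<forall>x\<in>carrier ?Y. diff P n (diff P (n + 1) x) = \<zero>\<^bsub>?W\<^esub>"
  proof -
    from P have *: "\<forall>n. obj P n \<in> left_modules R U \<and>
      diff P n \<in> mod_hom R (obj P n) (obj P (n - 1)) \<and>
      (\<forall>x\<in>carrier (obj P n). diff P (n - 1) (diff P n x) = \<zero>\<^bsub>obj P (n - 2)\<^esub>)"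
      by (simp add: complexes_def)
    from * show "left_module R ?X" "left_module R ?W" "left_module R ?Y" by (auto simp: left_modules_def)
    from *[rule_format, of n] show "lin R ?X ?W (diff P n)" by (simp add: mod_hom_iff)
    from *[rule_format, of "n + 1"] show "lin R ?Y ?X (diff P (n + 1))"
      "\<forall>x\<in>carrier ?Y. diff P n (diff P (n + 1) x) = \<zero>\<^bsub>?W\<^esub>" by (simp_all add: mod_hom_iff)
  qed
  interpret X: left_module R ?X by (rule mods)
  \<comment> \<open>\<open>Z\<close> consists of the cocycles and \<open>B\<close> of the
    coboundaries; \<open>G\<close> carries the operations of the Hom group on
    \<open>Z\<close>.\<close>
  define Z where "Z = {h. lin R ?X N h \<and> h \<in> extensional (carrier ?X) \<and>
    (\<forall>x\<in>carrier ?Y. h (diff P (n + 1) x) = \<zero>\<^bsub>N\<^esub>)}"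
  define B where "B = precomp P n ` carrier (hom_group R ?W N)"
  define G where "G = (hom_group R ?X N)\<lparr>carrier := Z\<rparr>"
  have dY: "diff P (n + 1) x \<in> carrier ?X" if "x \<in> carrier ?Y" for x
    using lin_closed[OF d' that] .
  have kerZ: "a_kernel (hom_group R ?X N) (hom_group R ?Y N) (precomp P (n + 1)) = Z"
  proof -
    have "precomp P (n + 1) h = (\<lambda>x\<in>carrier ?Y. \<zero>\<^bsub>N\<^esub>) \<longleftrightarrow> (\<forall>x\<in>carrier ?Y. h (diff P (n + 1) x) = \<zero>\<^bsub>N\<^esub>)" for h
      by (auto simp: precomp_def compose_def fun_eq_iff restrict_def)
    then show ?thesis by (auto simp: a_kernel_def' hom_group_def Z_def mod_hom_iff)
  qed
  have coh: "hom_cohomology R P N n = G A_Mod B"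
    by (simp add: hom_cohomology_def kerZ B_def G_def)
  have B_iff: "h \<in> B \<longleftrightarrow> h \<in> extensional (carrier ?X) \<and>
      (\<exists>g. lin R ?W N g \<and> (\<forall>x\<in>carrier ?X. g (diff P n x) = h x))" for h
  proof
    assume "h \<in> B"
    then obtain g where "lin R ?W N g" "h = precomp P n g"
      by (auto simp: B_def hom_group_def mod_hom_iff)
    then show "h \<in> extensional (carrier ?X) \<and>
      (\<exists>g. lin R ?W N g \<and> (\<forall>x\<in>carrier ?X. g (diff P n x) = h x))"
      by (intro conjI exI[of _ g]) (simp_all add: precomp_def compose_def)
  next
    assume a: "h \<in> extensional (carrier ?X) \<and>
      (\<exists>g. lin R ?W N g \<and> (\<forall>x\<in>carrier ?X. g (diff P n x) = h x))"
    then obtain g where g: "lin R ?W N g" "\<forall>x\<in>carrier ?X. g (diff P n x) = h x" by blast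
    let ?g = "restrict g (carrier ?W)"
    have "lin R ?W N ?g" by (rule lin_cong[OF g(1) mods(2)]) simp
    then have "?g \<in> carrier (hom_group R ?W N)" by (simp add: hom_group_def mod_hom_iff)
    moreover have "h = precomp P n ?g"
      using a g(2) lin_closed[OF d]
      by (auto simp: precomp_def compose_def fun_eq_iff restrict_def extensional_def)
    ultimately show "h \<in> B" unfolding B_def by blast
  qed
  have BZ: "B \<subseteq> Z"
  proof
    fix h assume "h \<in> B"
    then obtain g where h: "h \<in> extensional (carrier ?X)" "lin R ?W N g" "\<forall>x\<in>carrier ?X. g (diff P n x) = h x"
      using B_iff by blast
    have "lin R ?X N h"
      by (rule lin_cong[OF lin_comp[OF d h(2)] mods(1)]) (simp add: h(3))
    moreover have "h (diff P (n + 1) x) = \<zero>\<^bsub>N\<^esub>" if "x \<in> carrier ?Y" for x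
    proof -
      have "h (diff P (n + 1) x) = g (diff P n (diff P (n + 1) x))" using h(3) dY[OF that] by simp
      also have "\<dots> = \<zero>\<^bsub>N\<^esub>" using dd that lin_zero[OF h(2) mods(2) N] by simp
      finally show ?thesis .
    qed
    ultimately show "h \<in> Z" using h(1) by (simp add: Z_def)
  qed
  have addG: "h \<oplus>\<^bsub>G\<^esub> k = (\<lambda>x\<in>carrier ?X. h x \<oplus>\<^bsub>N\<^esub> k x)" for h k
    by (simp add: G_def hom_group_def)
  have zeroG: "\<zero>\<^bsub>G\<^esub> = (\<lambda>x\<in>carrier ?X. \<zero>\<^bsub>N\<^esub>)" and carG: "carrier G = Z"
    by (simp_all add: G_def hom_group_def)
  have ZD: "lin R ?X N h" "h \<in> extensional (carrier ?X)" "h (diff P (n + 1) y) = \<zero>\<^bsub>N\<^esub>"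
    if "h \<in> Z" "y \<in> carrier ?Y" for h y
    using that by (auto simp: Z_def)
  have clos: "h x \<in> carrier N" if "h \<in> Z" "x \<in> carrier ?X" for h x
    using that lin_closed by (auto simp: Z_def)
  have ZI: "restrict k (carrier ?X) \<in> Z"
    if "lin R ?X N k" "\<forall>x\<in>carrier ?Y. k (diff P (n + 1) x) = \<zero>\<^bsub>N\<^esub>" for k
    using that dY lin_cong[OF that(1) mods(1), of "restrict k (carrier ?X)"] by (simp add: Z_def)
  have zeroZ: "\<zero>\<^bsub>G\<^esub> \<in> Z" unfolding zeroG by (rule ZI) (simp_all add: lin_const_zero[OF N])
  have G: "abelian_group G"
  proof (rule abelian_groupI, unfold carG)
    fix h k assume h: "h \<in> Z" and k: "k \<in> Z"
    show "h \<oplus>\<^bsub>G\<^esub> k \<in> Z" unfolding addG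
      using h k by (intro ZI lin_plus N) (simp_all add: Z_def)
    show "h \<oplus>\<^bsub>G\<^esub> k = k \<oplus>\<^bsub>G\<^esub> h"
      unfolding addG using clos h k by (auto simp: fun_eq_iff restrict_def N.a_comm)
    fix l assume l: "l \<in> Z"
    show "h \<oplus>\<^bsub>G\<^esub> k \<oplus>\<^bsub>G\<^esub> l = h \<oplus>\<^bsub>G\<^esub> (k \<oplus>\<^bsub>G\<^esub> l)"
      unfolding addG using clos h k l by (auto simp: fun_eq_iff restrict_def N.a_assoc)
  next
    show "\<zero>\<^bsub>G\<^esub> \<in> Z" by (rule zeroZ)
  next
    fix h assume h: "h \<in> Z"
    then have e: "h \<in> extensional (carrier ?X)" by (simp add: Z_def)
    show "\<zero>\<^bsub>G\<^esub> \<oplus>\<^bsub>G\<^esub> h = h"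
      unfolding addG zeroG using clos[OF h] e by (auto simp: fun_eq_iff restrict_def extensional_def)
    have "(\<lambda>x\<in>carrier ?X. \<zero>\<^bsub>N\<^esub> \<ominus>\<^bsub>N\<^esub> h x) \<in> Z"
      using h by (intro ZI lin_diff lin_const_zero N) (simp_all add: Z_def)
    then show "\<exists>k\<in>Z. k \<oplus>\<^bsub>G\<^esub> h = \<zero>\<^bsub>G\<^esub>"
    proof (rule bexI[rotated])
      show "(\<lambda>x\<in>carrier ?X. \<zero>\<^bsub>N\<^esub> \<ominus>\<^bsub>N\<^esub> h x) \<oplus>\<^bsub>G\<^esub> h = \<zero>\<^bsub>G\<^esub>"
        unfolding addG zeroG using clos[OF h] by (auto simp: fun_eq_iff restrict_def)
    qed
  qed
  \<comment> \<open>If the quotient is trivial, the coset of a cocycle h is \<open>B\<close>, and it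
    contains h because the zero map lies in \<open>B\<close>. Conversely, if \<open>Z\<close> is
    contained in \<open>B\<close>, then \<open>B\<close> is the whole group and has a single
    coset.\<close>
  have triv: "trivial_group (G A_Mod B) \<longleftrightarrow> Z \<subseteq> B"
  proof
    assume triv: "trivial_group (G A_Mod B)"
    show "Z \<subseteq> B"
    proof
      fix h assume h: "h \<in> Z"
      have "(\<lambda>x\<in>carrier ?X. \<zero>\<^bsub>N\<^esub>) \<in> B"
        unfolding B_iff by (intro conjI exI[of _ "\<lambda>x. \<zero>\<^bsub>N\<^esub>"]) (simp_all add: lin_const_zero[OF N])
      then have z: "\<zero>\<^bsub>G\<^esub> \<in> B" by (simp add: zeroG)
      have "carrier (G A_Mod B) = {B}"
        using triv by (simp add: trivial_group_def A_FactGroup_def FactGroup_def)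
      then have "r_coset (add_monoid G) B h = B"
        using h carG by (auto simp: A_FactGroup_def FactGroup_def RCOSETS_def)
      moreover have "\<zero>\<^bsub>G\<^esub> \<oplus>\<^bsub>G\<^esub> h \<in> r_coset (add_monoid G) B h"
        using z by (auto simp: r_coset_def)
      moreover have "\<zero>\<^bsub>G\<^esub> \<oplus>\<^bsub>G\<^esub> h = h"
        using abelian_monoid.l_zero[OF abelian_group.axioms(1)[OF G]] h carG by simp
      ultimately show "h \<in> B" by simp
    qed
  next
    assume "Z \<subseteq> B"
    then have B: "B = carrier (add_monoid G)" using BZ carG by auto
    interpret G: comm_group "add_monoid G" by (rule abelian_group.a_comm_group[OF G])
    have sub: "subgroup B (add_monoid G)" unfolding B by (rule G.subgroup_self)
    then have "group (G A_Mod B)"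
      unfolding A_FactGroup_def using G.normal_iff_subgroup normal.factorgroup_is_group by blast
    moreover have "carrier (G A_Mod B) = {B}"
    proof -
      have "r_coset (add_monoid G) B h = B" if "h \<in> B" for h
        by (rule G.coset_join2[OF _ sub that]) (use that B in auto)
      then have "r_coset (add_monoid G) B ` B = {B}"
        using zeroZ \<open>Z \<subseteq> B\<close> by (auto simp: image_iff)
      moreover have "carrier (G A_Mod B) = r_coset (add_monoid G) B ` carrier (add_monoid G)"
        by (auto simp: A_FactGroup_def FactGroup_def RCOSETS_def)
      ultimately show ?thesis unfolding B[symmetric] by simp
    qed
    ultimately show "trivial_group (G A_Mod B)"
      by (simp add: trivial_group_def A_FactGroup_def FactGroup_def)
  qed
  have cob: "Z \<subseteq> B \<longleftrightarrow> ?cob"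
  proof
    assume ZB: "Z \<subseteq> B"
    show ?cob
    proof (intro allI impI, elim conjE)
      fix h assume "lin R ?X N h" "\<forall>x\<in>carrier ?Y. h (diff P (n + 1) x) = \<zero>\<^bsub>N\<^esub>"
      then have "restrict h (carrier ?X) \<in> B" using ZI ZB by blast
      then show "\<exists>g. lin R ?W N g \<and> (\<forall>x\<in>carrier ?X. g (diff P n x) = h x)"
        unfolding B_iff by (auto simp: restrict_def)
    qed
  next
    assume c: ?cob
    show "Z \<subseteq> B"
    proof
      fix h assume h: "h \<in> Z"
      then have "\<exists>g. lin R ?W N g \<and> (\<forall>x\<in>carrier ?X. g (diff P n x) = h x)"
        using c[rule_format, of h] by (simp add: Z_def)
      then show "h \<in> B" using h by (simp add: B_iff Z_def)
    qed
  qed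
  show "trivial_group (hom_cohomology R P N n) \<longleftrightarrow> ?cob" by (simp only: coh triv cob)
  have "exact_at (hom_group R ?W N) (precomp P n) (hom_group R ?X N) (precomp P (n + 1)) (hom_group R ?Y N) \<longleftrightarrow> B = Z"
    by (simp add: exact_at_def kerZ B_def)
  also have "\<dots> \<longleftrightarrow> Z \<subseteq> B" using BZ by auto
  finally show "exact_at (hom_group R ?W N) (precomp P n) (hom_group R ?X N) (precomp P (n + 1)) (hom_group R ?Y N) \<longleftrightarrow> ?cob"
    by (simp only: cob)
qed

context module_category
begin

lemma ker_LM: "\<lbrakk>M \<in> LM; N \<in> LM; lin R M N f\<rbrakk> \<Longrightarrow> ker_mod M N f \<in> LM"
  by (rule LM_subset[of _ M, OF left_module_kernel]) (auto simp: a_kernel_def')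

lemma zero_LM: "M \<in> LM \<Longrightarrow> zero_mod M \<in> LM"
proof (rule LM_subset[of _ M])
  assume "M \<in> LM"
  then interpret M: left_module R M by auto
  show "left_module R (zero_mod M)" by (rule left_module_submodule) (auto intro: M.left_module_axioms)
  show "carrier (zero_mod M) \<subseteq> carrier M" by simp
qed

lemma coker_exists:
  assumes X: "X \<in> LM" and Y: "Y \<in> LM" and f: "lin R X Y f" and inj: "inj_on f (carrier X)"
  shows "\<exists>Q q. Q \<in> LM \<and> short_exact R X f Y q Q"
proof -
  note mX = LM_left_module[OF X] note mY = LM_left_module[OF Y]
  interpret im: left_module R "Y\<lparr>carrier := f ` carrier X\<rparr>"
    by (rule left_module_image[OF mX mY f])
  show ?thesis
  proof (rule quotient_exists[OF mY, of "f ` carrier X"])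
    show "f ` carrier X \<subseteq> carrier Y" using lin_closed[OF f] by blast
    show "\<zero>\<^bsub>Y\<^esub> \<in> f ` carrier X" using im.zero_closed by simp
    show "\<And>x y. \<lbrakk>x \<in> f ` carrier X; y \<in> f ` carrier X\<rbrakk> \<Longrightarrow> x \<oplus>\<^bsub>Y\<^esub> y \<in> f ` carrier X"
      using im.a_closed by simp
    show "\<And>a x. \<lbrakk>a \<in> carrier R; x \<in> f ` carrier X\<rbrakk> \<Longrightarrow> a \<odot>\<^bsub>Y\<^esub> x \<in> f ` carrier X"
      using im.smult_closed by simp
    fix Q :: "('r, 'm) module" and q
    assume Q: "left_module R Q" "carrier Q \<subseteq> carrier Y" "lin R Y Q q" "q ` carrier Y = carrier Q"
      "\<And>x. x \<in> carrier Y \<Longrightarrow> q x = \<zero>\<^bsub>Q\<^esub> \<longleftrightarrow> x \<in> f ` carrier X"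
    have "Q \<in> LM" by (rule LM_subset[OF Q(1,2) Y])
    moreover have "short_exact R X f Y q Q"
      using Q f inj by (intro short_exactI) (auto simp: lin_closed)
    ultimately show ?thesis by blast
  qed
qed

section \<open>Vanishing of Ext^1 as an extension property\<close>

text \<open>Working form of Ext^1(M, H) = 0. With X = H and u the identity it says that extensions
  of M by H split. Allowing an arbitrary kernel X builds the pushout along u into the
  definition.\<close>

definition ext_vanish :: "('r, 'm) module \<Rightarrow> ('r, 'm) module \<Rightarrow> bool" where
  "ext_vanish M H \<longleftrightarrow> (\<forall>X\<in>LM. \<forall>Y\<in>LM. \<forall>f g u. short_exact R X f Y g M \<longrightarrow> lin R X H u \<longrightarrow>
     (\<exists>w. lin R Y H w \<and> (\<forall>x\<in>carrier X. w (f x) = u x)))"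

lemma ext_vanishI:
  assumes "\<And>X Y f g u. \<lbrakk>X \<in> LM; Y \<in> LM; short_exact R X f Y g M; lin R X H u\<rbrakk> \<Longrightarrow>
     \<exists>w. lin R Y H w \<and> (\<forall>x\<in>carrier X. w (f x) = u x)"
  shows "ext_vanish M H"
  using assms unfolding ext_vanish_def by auto

lemma ext_vanishD:
  assumes "ext_vanish M H" "X \<in> LM" "Y \<in> LM" "short_exact R X f Y g M" "lin R X H u"
  shows "\<exists>w. lin R Y H w \<and> (\<forall>x\<in>carrier X. w (f x) = u x)"
  by (rule assms(1)[unfolded ext_vanish_def, rule_format, OF assms(2-5)])

text \<open>Insert between X and Y the preimage Y' of M'. Then Y'/X is M' and Y/Y' is M'', so u
  extends first to Y' and from there to Y.\<close>

lemma ext_vanish_extension: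
  assumes LM: "M' \<in> LM" "M \<in> LM" "M'' \<in> LM" and se: "short_exact R M' i M p M''"
    and van: "ext_vanish M' H" "ext_vanish M'' H"
  shows "ext_vanish M H"
proof (rule ext_vanishI)
  fix X Y f g u
  assume X: "X \<in> LM" and Y: "Y \<in> LM" and fg: "short_exact R X f Y g M" and u: "lin R X H u"
  note i = short_exactD[OF se] and f = short_exactD[OF fg]
  note mM = LM_left_module[OF LM(2)] and mY = LM_left_module[OF Y]
  let ?pg = "\<lambda>y. p (g y)"
  let ?Y = "ker_mod Y M'' ?pg"
  have pg: "lin R Y M'' ?pg" by (rule lin_comp[OF f(2) i(2)])
  have Y': "?Y \<in> LM" by (rule ker_LM[OF Y LM(3) pg])
  have carY: "carrier ?Y = {y \<in> carrier Y. p (g y) = \<zero>\<^bsub>M''\<^esub>}" by (simp add: a_kernel_def')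
  have gY: "lin R ?Y M g" by (rule lin_restrict[OF f(2)]) (auto simp: a_kernel_def')
  have "g ` carrier ?Y \<subseteq> i ` carrier M'"
    unfolding i(4) carY using lin_closed[OF f(2)] by auto
  then obtain h where h: "lin R ?Y M' h" "\<forall>y\<in>carrier ?Y. i (h y) = g y"
    using lin_lift_mono[OF i(1,3) gY LM_left_module[OF LM(1)] LM_left_module[OF Y']] by blast
  have i0: "i \<zero>\<^bsub>M'\<^esub> = \<zero>\<^bsub>M\<^esub>" by (rule lin_zero[OF i(1)]) (use LM in auto)
  have "short_exact R X f ?Y h M'"
  proof (rule short_exactI)
    have sub: "f ` carrier X \<subseteq> carrier ?Y"
    proof (rule image_subsetI)
      fix x assume x: "x \<in> carrier X"
      have "p (g (f x)) = \<zero>\<^bsub>M''\<^esub>" using f(5) x lin_zero[OF i(2) mM LM_left_module[OF LM(3)]] by simp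
      then show "f x \<in> carrier ?Y" unfolding carY using lin_closed[OF f(1) x] by simp
    qed
    show "lin R X ?Y f" by (rule lin_into[OF f(1)]) (use sub in simp)
    show "\<forall>x\<in>carrier X. h (f x) = \<zero>\<^bsub>M'\<^esub>"
    proof
      fix x assume x: "x \<in> carrier X"
      then have fx: "f x \<in> carrier ?Y" using sub by blast
      have "i (h (f x)) = i \<zero>\<^bsub>M'\<^esub>" using h(2) fx f(5) x i0 by simp
      then show "h (f x) = \<zero>\<^bsub>M'\<^esub>"
        by (rule inj_onD[OF i(3)]) (use lin_closed[OF h(1) fx] LM(1) in \<open>auto dest!: LM_left_module left_module_abelian_group abelian_group.axioms(1) intro: abelian_monoid.zero_closed\<close>)
    qed
    show "\<forall>y\<in>carrier ?Y. h y = \<zero>\<^bsub>M'\<^esub> \<longrightarrow> y \<in> f ` carrier X"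
    proof (intro ballI impI)
      fix y assume y: "y \<in> carrier ?Y" "h y = \<zero>\<^bsub>M'\<^esub>"
      then have "g y = \<zero>\<^bsub>M\<^esub>" using h(2) i0 by metis
      then show "y \<in> f ` carrier X" unfolding f(4) using y(1) carY by simp
    qed
    show "h ` carrier ?Y = carrier M'"
    proof (rule lin_surjI[OF h(1)])
      fix m assume m: "m \<in> carrier M'"
      have "i m \<in> g ` carrier Y" unfolding f(7) by (rule lin_closed[OF i(1) m])
      then obtain y where y: "y \<in> carrier Y" "g y = i m" by auto
      then have yY: "y \<in> carrier ?Y" unfolding carY using i(5) m by simp
      have "h y = m" by (rule inj_onD[OF i(3)]) (use h yY y m lin_closed[OF h(1) yY] in auto)
      then show "m \<in> h ` carrier ?Y" using yY by blast
    qed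
  qed (fact h(1), fact f(3))
  from ext_vanishD[OF van(1) X Y' this u]
  obtain w' where w': "lin R ?Y H w'" "\<forall>x\<in>carrier X. w' (f x) = u x" by blast
  have pgs: "?pg ` carrier Y = carrier M''"
    using f(7) i(7) by (simp add: image_image[symmetric])
  from ext_vanishD[OF van(2) Y' Y short_exact_ker[OF pg pgs] w'(1)]
  obtain w where w: "lin R Y H w" "\<forall>y\<in>carrier ?Y. w y = w' y" by blast
  have "w (f x) = u x" if "x \<in> carrier X" for x
  proof -
    have "p (g (f x)) = \<zero>\<^bsub>M''\<^esub>" using f(5) that lin_zero[OF i(2) mM LM_left_module[OF LM(3)]] by simp
    then have "f x \<in> carrier ?Y" unfolding carY using lin_closed[OF f(1) that] by simp
    then show ?thesis using w(2) w'(2) that by simp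
  qed
  then show "\<exists>w. lin R Y H w \<and> (\<forall>x\<in>carrier X. w (f x) = u x)" using w(1) by blast
qed

text \<open>Pulling an extension of \<open>M\<close> back along \<open>p\<close> reduces it to an extension of \<open>Y\<close>.\<close>

lemma ext_vanish_syzygy:
  assumes LM: "K \<in> LM" "Y \<in> LM" "M \<in> LM" "H \<in> LM" and se: "short_exact R K i Y p M"
    and van: "ext_vanish Y H"
    and ex: "\<And>v. lin R K H v \<Longrightarrow> \<exists>w. lin R Y H w \<and> (\<forall>x\<in>carrier K. w (i x) = v x)"
  shows "ext_vanish M H"
proof (rule ext_vanishI)
  fix X Z f g u
  assume X: "X \<in> LM" and Z: "Z \<in> LM" and fg: "short_exact R X f Z g M" and u: "lin R X H u"
  note i = short_exactD[OF se] and f = short_exactD[OF fg]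
  interpret M: left_module R M using LM by auto
  interpret Y: left_module R Y using LM by auto
  interpret Z: left_module R Z using Z by auto
  interpret H: left_module R H using LM by auto
  note YZ = LM(2) Z
  note mK = LM_left_module[OF LM(1)] and mX = LM_left_module[OF X]
  note mM = M.left_module_axioms and mY = Y.left_module_axioms and mZ = Z.left_module_axioms
    and mH = H.left_module_axioms
  let ?D = "dsum Y Z" let ?\<delta> = "\<lambda>z. p (dfst Y Z z) \<ominus>\<^bsub>M\<^esub> g (dsnd Y Z z)"
  have D: "?D \<in> LM" by (rule dsum_LM[OF YZ])
  have \<delta>: "lin R ?D M ?\<delta>"
    by (intro lin_diff lin_comp[OF lin_dfst[OF YZ] i(2)] lin_comp[OF lin_dsnd[OF YZ] f(2)] mM)
  \<comment> \<open>The pullback of \<open>p\<close> and \<open>g\<close>. It is an extension of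
    \<open>Y\<close> by \<open>X\<close> through the first projection, and of \<open>Z\<close> by
    \<open>K\<close> through the second.\<close>
  define Q where "Q = ker_mod ?D M ?\<delta>"
  have Q: "Q \<in> LM" unfolding Q_def by (rule ker_LM[OF D LM(3) \<delta>])
  note mQ = LM_left_module[OF Q]
  have memQ: "dpair Y Z y z \<in> carrier Q" if "y \<in> carrier Y" "z \<in> carrier Z" "p y = g z" for y z
    using that lin_closed[OF i(2)] lin_closed[OF f(2)]
    by (simp add: Q_def a_kernel_def' dpair_closed[OF YZ] dfst_dpair[OF YZ] dsnd_dpair[OF YZ])
  have Qcases: "\<exists>y z. y \<in> carrier Y \<and> z \<in> carrier Z \<and> p y = g z \<and> q = dpair Y Z y z" if "q \<in> carrier Q" for q
  proof -
    from that have q: "q \<in> carrier ?D" "?\<delta> q = \<zero>\<^bsub>M\<^esub>" by (simp_all add: Q_def a_kernel_def')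
    obtain y z where yz: "y \<in> carrier Y" "z \<in> carrier Z" "q = dpair Y Z y z"
      using dsum_cases[OF YZ q(1)] by metis
    with q(2) have "p y = g z"
      using lin_closed[OF i(2)] lin_closed[OF f(2)] by (simp add: dfst_dpair[OF YZ] dsnd_dpair[OF YZ])
    with yz show ?thesis by blast
  qed
  have Qsub: "carrier Q \<subseteq> carrier ?D" by (auto simp: Q_def a_kernel_def')
  have linQ: "lin R Q N h" if "lin R ?D N h" for N :: "('r, 'm) module" and h
    unfolding Q_def by (rule lin_restrict[OF that]) (auto simp: a_kernel_def')
  have intoQ: "lin R N Q h" if "lin R N ?D h" "h ` carrier N \<subseteq> carrier Q" for N :: "('r, 'm) module" and h
    unfolding Q_def by (rule lin_into[OF that(1)]) (use that(2) in \<open>simp add: Q_def\<close>)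
  have p0: "p \<zero>\<^bsub>Y\<^esub> = \<zero>\<^bsub>M\<^esub>" by (rule lin_zero[OF i(2) mY mM])
  have g0: "g \<zero>\<^bsub>Z\<^esub> = \<zero>\<^bsub>M\<^esub>" by (rule lin_zero[OF f(2) mZ mM])
  let ?a = "\<lambda>x. dpair Y Z \<zero>\<^bsub>Y\<^esub> (f x)"
  have aQ: "?a x \<in> carrier Q" if "x \<in> carrier X" for x
    using memQ[OF Y.zero_closed lin_closed[OF f(1) that]] f(5) that p0 by simp
  have a: "lin R X Q ?a"
    by (intro intoQ lin_dpair[OF YZ] lin_const_zero mY f(1)) (use aQ in auto)
  let ?b = "\<lambda>k. dpair Y Z (i k) \<zero>\<^bsub>Z\<^esub>"
  have bQ: "?b k \<in> carrier Q" if "k \<in> carrier K" for k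
    using memQ[OF lin_closed[OF i(1) that] Z.zero_closed] i(5) that g0 by simp
  have b: "lin R K Q ?b"
    by (intro intoQ lin_dpair[OF YZ] lin_const_zero mZ i(1)) (use bQ in auto)
  have "short_exact R X ?a Q (dfst Y Z) Y"
  proof (rule short_exactI)
    show "lin R X Q ?a" by (rule a)
    show "lin R Q Y (dfst Y Z)" by (rule linQ[OF lin_dfst[OF YZ]])
    show "inj_on ?a (carrier X)"
    proof (rule inj_onI)
      fix x y assume xy: "x \<in> carrier X" "y \<in> carrier X" "?a x = ?a y"
      then have "dsnd Y Z (?a x) = dsnd Y Z (?a y)" by simp
      then have "f x = f y" using xy(1,2) lin_closed[OF f(1)] by (simp add: dsnd_dpair[OF YZ])
      then show "x = y" using inj_onD[OF f(3)] xy by simp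
    qed
    show "\<forall>x\<in>carrier X. dfst Y Z (?a x) = \<zero>\<^bsub>Y\<^esub>"
      using lin_closed[OF f(1)] by (simp add: dfst_dpair[OF YZ])
    show "\<forall>q\<in>carrier Q. dfst Y Z q = \<zero>\<^bsub>Y\<^esub> \<longrightarrow> q \<in> ?a ` carrier X"
    proof (intro ballI impI)
      fix q assume "q \<in> carrier Q" and q0: "dfst Y Z q = \<zero>\<^bsub>Y\<^esub>"
      then obtain y z where yz: "y \<in> carrier Y" "z \<in> carrier Z" "p y = g z" "q = dpair Y Z y z"
        using Qcases by blast
      then have "y = \<zero>\<^bsub>Y\<^esub>" using q0 by (simp add: dfst_dpair[OF YZ])
      moreover have "\<exists>x\<in>carrier X. z = f x" using f(6) yz p0 calculation by simp
      ultimately show "q \<in> ?a ` carrier X" using yz by auto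
    qed
    show "dfst Y Z ` carrier Q = carrier Y"
    proof (rule lin_surjI[OF linQ[OF lin_dfst[OF YZ]]])
      fix y assume y: "y \<in> carrier Y"
      have "p y \<in> g ` carrier Z" unfolding f(7) by (rule lin_closed[OF i(2) y])
      then obtain z where z: "z \<in> carrier Z" "p y = g z" by auto
      have "dfst Y Z (dpair Y Z y z) = y" by (rule dfst_dpair[OF YZ y z(1)])
      then show "y \<in> dfst Y Z ` carrier Q" using memQ[OF y z] by (metis imageI)
    qed
  qed
  from ext_vanishD[OF van X Q this u]
  obtain w where w: "lin R Q H w" "\<forall>x\<in>carrier X. w (?a x) = u x" by blast
  obtain v where v: "lin R Y H v" "\<forall>k\<in>carrier K. v (i k) = w (?b k)"
    using ex[OF lin_comp[OF b w(1)]] by blast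
  \<comment> \<open>\<open>w\<close> extends \<open>u\<close> to the pullback but need not vanish on
    the copy of \<open>K\<close>. Its restriction to \<open>K\<close> extends to \<open>v\<close> on
    \<open>Y\<close>; after subtracting \<open>v\<close> the map kills \<open>K\<close> and descends
    to \<open>Z\<close>. On the copy of \<open>X\<close> nothing changes, as the first component is
    zero there.\<close>
  let ?t = "\<lambda>q. w q \<ominus>\<^bsub>H\<^esub> v (dfst Y Z q)"
  have t: "lin R Q H ?t"
    by (intro lin_diff w(1) lin_comp[OF linQ[OF lin_dfst[OF YZ]] v(1)] mH)
  have dsnd_surj: "dsnd Y Z ` carrier Q = carrier Z"
  proof (rule lin_surjI[OF linQ[OF lin_dsnd[OF YZ]]])
    fix z assume z: "z \<in> carrier Z"
    have "g z \<in> p ` carrier Y" unfolding i(7) by (rule lin_closed[OF f(2) z])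
    then obtain y where y: "y \<in> carrier Y" "p y = g z" by auto
    have "dsnd Y Z (dpair Y Z y z) = z" by (rule dsnd_dpair[OF YZ y(1) z])
    then show "z \<in> dsnd Y Z ` carrier Q" using memQ[OF y(1) z y(2)] by (metis imageI)
  qed
  have "\<forall>q\<in>carrier Q. dsnd Y Z q = \<zero>\<^bsub>Z\<^esub> \<longrightarrow> ?t q = \<zero>\<^bsub>H\<^esub>"
  proof (intro ballI impI)
    fix q assume q: "q \<in> carrier Q" and q0: "dsnd Y Z q = \<zero>\<^bsub>Z\<^esub>"
    then obtain y z where yz: "y \<in> carrier Y" "z \<in> carrier Z" "p y = g z" "q = dpair Y Z y z"
      using Qcases by blast
    then have z: "z = \<zero>\<^bsub>Z\<^esub>" using q0 by (simp add: dsnd_dpair[OF YZ])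
    then obtain k where k: "k \<in> carrier K" "y = i k" using i(6) yz g0 by auto
    have "v (dfst Y Z q) = w q" using v(2) k yz z by (simp add: dfst_dpair[OF YZ])
    then show "?t q = \<zero>\<^bsub>H\<^esub>" using lin_closed[OF w(1) q] by simp
  qed
  from lin_factor[OF linQ[OF lin_dsnd[OF YZ]] dsnd_surj t mQ mZ mH this]
  obtain s where s: "lin R Z H s" "\<forall>q\<in>carrier Q. s (dsnd Y Z q) = ?t q" by blast
  have "s (f x) = u x" if x: "x \<in> carrier X" for x
  proof -
    have fx: "f x \<in> carrier Z" by (rule lin_closed[OF f(1) x])
    have "s (f x) = s (dsnd Y Z (?a x))" using fx by (simp add: dsnd_dpair[OF YZ])
    also have "\<dots> = w (?a x) \<ominus>\<^bsub>H\<^esub> v (dfst Y Z (?a x))" using s(2) aQ[OF x] by simp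
    also have "\<dots> = u x \<ominus>\<^bsub>H\<^esub> \<zero>\<^bsub>H\<^esub>"
      using w(2) x fx lin_zero[OF v(1) mY mH] by (simp add: dfst_dpair[OF YZ])
    also have "\<dots> = u x" using lin_closed[OF u x] by simp
    finally show ?thesis .
  qed
  then show "\<exists>w. lin R Z H w \<and> (\<forall>x\<in>carrier X. w (f x) = u x)" using s(1) by blast
qed

lemma ext_vanish_iso:
  assumes LM: "M \<in> LM" "M' \<in> LM" and h: "lin R M M' h" "bij_betw h (carrier M) (carrier M')"
    and van: "ext_vanish M H"
  shows "ext_vanish M' H"
proof (rule ext_vanishI)
  fix X Y f g u
  assume X: "X \<in> LM" and Y: "Y \<in> LM" and fg: "short_exact R X f Y g M'" and u: "lin R X H u"
  note f = short_exactD[OF fg]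
  note mM = LM_left_module[OF LM(1)] and mM' = LM_left_module[OF LM(2)]
  have inj: "inj_on h (carrier M)" and surj: "h ` carrier M = carrier M'"
    using h(2) by (auto simp: bij_betw_def)
  have "g ` carrier Y \<subseteq> h ` carrier M" using f(7) surj by simp
  then obtain k where k: "lin R Y M k" "\<forall>y\<in>carrier Y. h (k y) = g y"
    using lin_lift_mono[OF h(1) inj f(2) mM LM_left_module[OF Y]] by blast
  interpret M: left_module R M by (rule mM)
  have h0: "h \<zero>\<^bsub>M\<^esub> = \<zero>\<^bsub>M'\<^esub>" by (rule lin_zero[OF h(1) mM mM'])
  have k0: "k y = \<zero>\<^bsub>M\<^esub> \<longleftrightarrow> g y = \<zero>\<^bsub>M'\<^esub>" if y: "y \<in> carrier Y" for y
    using inj_onD[OF inj, of "k y" "\<zero>\<^bsub>M\<^esub>"] k(2) y h0 lin_closed[OF k(1) y] by auto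
  have "short_exact R X f Y k M"
  proof (rule short_exactI)
    show "\<forall>x\<in>carrier X. k (f x) = \<zero>\<^bsub>M\<^esub>" using k0 lin_closed[OF f(1)] f(5) by simp
    show "\<forall>y\<in>carrier Y. k y = \<zero>\<^bsub>M\<^esub> \<longrightarrow> y \<in> f ` carrier X" using k0 f(4) by simp
    show "k ` carrier Y = carrier M"
    proof (rule lin_surjI[OF k(1)])
      fix m assume m: "m \<in> carrier M"
      have "h m \<in> g ` carrier Y" unfolding f(7) by (rule lin_closed[OF h(1) m])
      then obtain y where y: "y \<in> carrier Y" "g y = h m" by auto
      have "k y = m" by (rule inj_onD[OF inj]) (use k y m lin_closed[OF k(1) y(1)] in auto)
      then show "m \<in> k ` carrier Y" using y by blast
    qed
  qed (fact f(1), fact k(1), fact f(3))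
  from ext_vanishD[OF van X Y this u] show "\<exists>w. lin R Y H w \<and> (\<forall>x\<in>carrier X. w (f x) = u x)" .
qed

lemma projectiveD:
  assumes "projective R U P" "X \<in> LM" "Y \<in> LM" "lin R X Y g" "lin R P Y f" "g ` carrier X = carrier Y"
  shows "\<exists>h. lin R P X h \<and> (\<forall>p\<in>carrier P. g (h p) = f p)"
proof -
  have "\<exists>h\<in>mod_hom R P X. \<forall>p\<in>carrier P. g (h p) = f p"
    using assms unfolding projective_def by (simp add: mod_hom_iff)
  then show ?thesis by (auto simp: mod_hom_iff)
qed

lemma projective_LM: "projective R U P \<Longrightarrow> P \<in> LM"
  by (simp add: projective_def)

text \<open>The identity of \<open>P\<close> lifts to a section s of g, and y - s(g y) retracts Y
  onto the copy of X. Composing u with this retraction extends u.\<close>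

lemma ext_vanish_projective:
  assumes P: "projective R U P" and H: "H \<in> LM"
  shows "ext_vanish P H"
proof (rule ext_vanishI)
  fix X Y f g u
  assume X: "X \<in> LM" and Y: "Y \<in> LM" and fg: "short_exact R X f Y g P" and u: "lin R X H u"
  note f = short_exactD[OF fg]
  have PL: "P \<in> LM" by (rule projective_LM[OF P])
  note mP = LM_left_module[OF PL] and mY = LM_left_module[OF Y]
  interpret Y: left_module R Y by (rule mY)
  interpret P: left_module R P by (rule mP)
  obtain s where s: "lin R P Y s" "\<forall>p\<in>carrier P. g (s p) = p"
    using projectiveD[OF P Y PL f(2) lin_id f(7)] by blast
  let ?r = "\<lambda>y. y \<ominus>\<^bsub>Y\<^esub> s (g y)"
  have r: "lin R Y Y ?r" by (intro lin_diff lin_id lin_comp[OF f(2) s(1)] mY)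
  have "?r ` carrier Y \<subseteq> f ` carrier X"
  proof (rule image_subsetI)
    fix y assume y: "y \<in> carrier Y"
    have gy: "g y \<in> carrier P" by (rule lin_closed[OF f(2) y])
    have "g (?r y) = g y \<ominus>\<^bsub>P\<^esub> g (s (g y))"
      by (rule lin_minus[OF f(2) mY mP y lin_closed[OF s(1) gy]])
    then show "?r y \<in> f ` carrier X" using s(2) gy lin_closed[OF r y] unfolding f(4) by simp
  qed
  then obtain k where k: "lin R Y X k" "\<forall>y\<in>carrier Y. f (k y) = ?r y"
    using lin_lift_mono[OF f(1,3) r LM_left_module[OF X] mY] by blast
  have "k (f x) = x" if x: "x \<in> carrier X" for x
  proof (rule inj_onD[OF f(3)])
    have fx: "f x \<in> carrier Y" by (rule lin_closed[OF f(1) x])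
    show "f (k (f x)) = f x" using k(2) fx f(5) x lin_zero[OF s(1) mP mY] by simp
    show "k (f x) \<in> carrier X" by (rule lin_closed[OF k(1) fx])
  qed (rule x)
  then show "\<exists>w. lin R Y H w \<and> (\<forall>x\<in>carrier X. w (f x) = u x)"
    by (intro exI[of _ "\<lambda>y. u (k y)"]) (simp add: lin_comp[OF k(1) u])
qed

section \<open>Projective resolutions and comparison with \<open>Ext\<close>\<close>

lemma complexesD:
  assumes "C \<in> complexes R U"
  shows "obj C n \<in> LM" "lin R (obj C n) (obj C (n - 1)) (diff C n)"
    "x \<in> carrier (obj C n) \<Longrightarrow> diff C (n - 1) (diff C n x) = \<zero>\<^bsub>obj C (n - 2)\<^esub>"
  using assms by (auto simp: complexes_def mod_hom_iff)

lemma complexesI: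
  assumes "\<And>n. obj C n \<in> LM" "\<And>n. lin R (obj C n) (obj C (n - 1)) (diff C n)"
    "\<And>n x. x \<in> carrier (obj C n) \<Longrightarrow> diff C (n - 1) (diff C n x) = \<zero>\<^bsub>obj C (n - 2)\<^esub>"
  shows "C \<in> complexes R U"
  using assms by (simp add: complexes_def mod_hom_iff)

text \<open>Gives meaning to the choice in \<open>proj_res\<close>. Free covers of successive
  kernels are iterated over the natural numbers and then spread over integer degrees.\<close>

lemma projective_resolution_exists:
  assumes M: "M \<in> LM"
  shows "\<exists>P \<epsilon>. projective_resolution R U M P \<epsilon>"
proof -
  have "\<forall>N\<in>LM. \<exists>P \<pi>. projective R U P \<and> lin R P N \<pi> \<and> \<pi> ` carrier P = carrier N"
  proof
    fix N assume N: "N \<in> LM"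
    show "\<exists>P \<pi>. projective R U P \<and> lin R P N \<pi> \<and> \<pi> ` carrier P = carrier N"
      by (rule free_cover[OF N]) blast
  qed
  then obtain F p where Fp: "\<forall>N\<in>LM. projective R U (F N) \<and> lin R (F N) N (p N) \<and> p N ` carrier (F N) = carrier N"
    by metis
  define K where "K = rec_nat M (\<lambda>_ N. ker_mod (F N) N (p N))"
  have K0: "K 0 = M" and KS: "K (Suc n) = ker_mod (F (K n)) (K n) (p (K n))" for n
    by (simp_all add: K_def)
  have K: "K n \<in> LM" for n
  proof (induction n)
    case (Suc n)
    then show ?case unfolding KS using Fp projective_LM by (intro ker_LM) auto
  qed (simp add: K0 M)
  have proj: "projective R U (F (K n))" and pl: "lin R (F (K n)) (K n) (p (K n))"
    and ps: "p (K n) ` carrier (F (K n)) = carrier (K n)" for n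
    using Fp K[of n] by auto
  have KSc: "carrier (K (Suc n)) = {x \<in> carrier (F (K n)). p (K n) x = \<zero>\<^bsub>K n\<^esub>}" for n
    by (simp add: KS a_kernel_def')
  have KSz: "\<zero>\<^bsub>K (Suc n)\<^esub> = \<zero>\<^bsub>F (K n)\<^esub>" for n by (simp add: KS)
  have plS: "lin R (F (K (Suc n))) (F (K n)) (p (K (Suc n)))" for n
    by (rule lin_out[of _ _ "a_kernel (F (K n)) (K n) (p (K n))" "F (K n)"])
      (use pl[of "Suc n"] KS in \<open>simp, auto simp: a_kernel_def'\<close>)
  have pp: "p (K n) (p (K (Suc n)) x) = \<zero>\<^bsub>K n\<^esub>" if "x \<in> carrier (F (K (Suc n)))" for n x
    using lin_closed[OF pl that] unfolding KSc by simp
  \<comment> \<open>Negative degrees need some zero module with carrier in \<open>'m\<close>; the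
    zero submodule of \<open>M\<close> is at hand.\<close>
  define Zm where "Zm = zero_mod M"
  have Zm: "Zm \<in> LM" "carrier Zm = {\<zero>\<^bsub>Zm\<^esub>}" using zero_LM[OF M] by (simp_all add: Zm_def)
  define P :: "('r, 'm) chain_cpx" where
    "P = \<lparr>obj = (\<lambda>n. if n \<ge> 0 then F (K (nat n)) else Zm),
          diff = (\<lambda>n. if n \<ge> 1 then p (K (nat n)) else (\<lambda>x. \<zero>\<^bsub>Zm\<^esub>))\<rparr>"
  have obj_nat: "obj P (int n) = F (K n)" and diff_nat: "diff P (int (Suc n)) = p (K (Suc n))" for n
    by (simp_all add: P_def nat_add_distrib)
  have obj_neg: "obj P n = Zm" if "n < 0" for n using that by (simp add: P_def)
  have diff_neg: "diff P n = (\<lambda>x. \<zero>\<^bsub>Zm\<^esub>)" if "n \<le> 0" for n using that by (simp add: P_def)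
  have pos: "n = int (Suc (nat (n - 1)))" "n - 1 = int (nat (n - 1))" "n + 1 = int (Suc (Suc (nat (n - 1))))"
    if "n \<ge> 1" for n using that by simp_all
  have "P \<in> complexes R U"
  proof (rule complexesI)
    fix n
    show "obj P n \<in> LM"
      using proj projective_LM Zm(1) by (simp add: P_def)
    show "lin R (obj P n) (obj P (n - 1)) (diff P n)"
    proof (cases "n \<ge> 1")
      case True
      have "lin R (obj P (int (Suc (nat (n - 1))))) (obj P (int (nat (n - 1)))) (diff P (int (Suc (nat (n - 1)))))"
        unfolding obj_nat diff_nat by (rule plS)
      then show ?thesis unfolding pos[OF True, symmetric] .
    next
      case False
      then show ?thesis using lin_const_zero[OF LM_left_module[OF Zm(1)]] by (simp add: obj_neg diff_neg)
    qed
    fix x assume x: "x \<in> carrier (obj P n)"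
    show "diff P (n - 1) (diff P n x) = \<zero>\<^bsub>obj P (n - 2)\<^esub>"
    proof (cases "n \<ge> 2")
      case True
      define k where "k = nat (n - 2)"
      have n: "n = int (Suc (Suc k))" "n - 1 = int (Suc k)" "n - 2 = int k"
        using True by (simp_all add: k_def)
      have "x \<in> carrier (F (K (Suc (Suc k))))" using x unfolding n(1) obj_nat .
      from pp[OF this]
      have "diff P (int (Suc k)) (diff P (int (Suc (Suc k))) x) = \<zero>\<^bsub>obj P (int k)\<^esub>"
        unfolding obj_nat diff_nat KSz .
      then show ?thesis unfolding n(2,3) unfolding n(1) .
    next
      case False
      then show ?thesis by (simp add: obj_neg diff_neg)
    qed
  qed
  moreover have ker: "p (K (Suc n)) ` carrier (F (K (Suc n))) = {x \<in> carrier (F (K n)). p (K n) x = \<zero>\<^bsub>K n\<^esub>}" for n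
    using ps[of "Suc n"] KSc by simp
  have "exact_at (obj P (n + 1)) (diff P (n + 1)) (obj P n) (diff P n) (obj P (n - 1))" if "n \<ge> 1" for n
  proof -
    define k where "k = nat (n - 1)"
    have n: "n = int (Suc k)" "n - 1 = int k" "n + 1 = int (Suc (Suc k))"
      using that by (simp_all add: k_def)
    show ?thesis using ker[of "Suc k"] unfolding n(2,3) unfolding n(1) obj_nat diff_nat exact_at_def a_kernel_def' KSz .
  qed
  moreover have "exact_at (obj P 1) (diff P 1) (obj P 0) (p M) M"
    using ker[of 0] obj_nat[of 0] obj_nat[of 1] diff_nat[of 0] by (simp add: exact_at_def a_kernel_def' K0)
  moreover have "\<forall>n\<ge>0. projective R U (obj P n)" using proj by (simp add: P_def)
  moreover have "p M \<in> mod_hom R (obj P 0) M" "p M ` carrier (obj P 0) = carrier M"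
    using pl[of 0] ps[of 0] obj_nat[of 0] by (simp_all add: mod_hom_iff K0)
  ultimately have "projective_resolution R U M P (p M)"
    unfolding projective_resolution_def using Zm(2) by (simp add: obj_neg)
  then show ?thesis by blast
qed

lemma proj_res:
  assumes "M \<in> LM"
  shows "\<exists>\<epsilon>. projective_resolution R U M (proj_res R U M) \<epsilon>"
  unfolding proj_res_def by (rule someI_ex[OF projective_resolution_exists[OF assms]])

lemma projective_resolutionD:
  assumes "projective_resolution R U M P \<epsilon>"
  shows "P \<in> complexes R U" "n \<ge> 0 \<Longrightarrow> projective R U (obj P n)"
    "lin R (obj P 0) M \<epsilon>" "\<epsilon> ` carrier (obj P 0) = carrier M"
    "diff P 1 ` carrier (obj P 1) = a_kernel (obj P 0) M \<epsilon>"
    "n \<ge> 1 \<Longrightarrow> diff P (n + 1) ` carrier (obj P (n + 1)) = a_kernel (obj P n) (obj P (n - 1)) (diff P n)"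
  using assms unfolding projective_resolution_def exact_at_def mod_hom_iff by auto

text \<open>Degree-one cocycles are maps out of the kernel of the augmentation, and coboundaries are
  those that extend to the degree-zero projective. So Ext^1 vanishes iff the extension property
  holds for this one presentation of \<open>M\<close>, and \<open>ext_vanish_syzygy\<close> spreads
  it to all extensions of \<open>M\<close>.\<close>

lemma Ext_1_iff:
  assumes M: "M \<in> LM" and H: "H \<in> LM"
  shows "trivial_group (Ext R U 1 M H) \<longleftrightarrow> ext_vanish M H"
proof -
  define P where "P = proj_res R U M"
  obtain \<epsilon> where "projective_resolution R U M P \<epsilon>" using proj_res[OF M] P_def by blast
  note res = projective_resolutionD[OF this]
  note mH = LM_left_module[OF H]
  let ?K = "ker_mod (obj P 0) M \<epsilon>"
  have LMs: "obj P n \<in> LM" for n by (rule complexesD(1)[OF res(1)])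
  note mods = LM_left_module[OF LMs]
  have K: "?K \<in> LM" by (rule ker_LM[OF LMs M res(3)])
  have se: "short_exact R ?K (\<lambda>x. x) (obj P 0) \<epsilon> M" by (rule short_exact_ker[OF res(3,4)])
  have d1: "lin R (obj P 1) (obj P 0) (diff P 1)" and d2: "lin R (obj P 2) (obj P 1) (diff P 2)"
    using complexesD(2)[OF res(1), of 1] complexesD(2)[OF res(1), of 2] by simp_all
  have d1K: "lin R (obj P 1) ?K (diff P 1)" by (rule lin_into[OF d1]) (simp add: res(5))
  have d1s: "diff P 1 ` carrier (obj P 1) = carrier ?K" by (simp add: res(5))
  have d2s: "diff P 2 ` carrier (obj P 2) = a_kernel (obj P 1) (obj P 0) (diff P 1)"
    using res(6)[of 1] by simp
  have "trivial_group (Ext R U 1 M H) \<longleftrightarrow>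
    (\<forall>h. lin R (obj P 1) H h \<and> (\<forall>x\<in>carrier (obj P 2). h (diff P 2 x) = \<zero>\<^bsub>H\<^esub>) \<longrightarrow>
      (\<exists>g. lin R (obj P 0) H g \<and> (\<forall>x\<in>carrier (obj P 1). g (diff P 1 x) = h x)))"
    (is "_ \<longleftrightarrow> ?cob")
    using trivial_hom_cohomology_iff[OF res(1) mH, of 1] by (simp add: Ext_def P_def)
  also have "\<dots> \<longleftrightarrow> ext_vanish M H"
  proof
    assume cob: ?cob
    show "ext_vanish M H"
    proof (rule ext_vanish_syzygy[OF K LMs M H se])
      show "ext_vanish (obj P 0) H" by (rule ext_vanish_projective[OF res(2) H]) simp
      fix v assume v: "lin R ?K H v"
      have "v (diff P 1 (diff P 2 x)) = \<zero>\<^bsub>H\<^esub>" if "x \<in> carrier (obj P 2)" for x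
      proof -
        have "diff P 1 (diff P 2 x) = \<zero>\<^bsub>?K\<^esub>" using complexesD(3)[OF res(1) that] by simp
        then show ?thesis using lin_zero[OF v LM_left_module[OF K] mH] by simp
      qed
      then obtain g where g: "lin R (obj P 0) H g" "\<forall>x\<in>carrier (obj P 1). g (diff P 1 x) = v (diff P 1 x)"
        using cob[rule_format, of "\<lambda>x. v (diff P 1 x)"] lin_comp[OF d1K v] by blast
      have "\<forall>x\<in>carrier ?K. g x = v x" unfolding d1s[symmetric] using g(2) by blast
      then show "\<exists>w. lin R (obj P 0) H w \<and> (\<forall>x\<in>carrier ?K. w x = v x)" using g(1) by blast
    qed
  next
    assume van: "ext_vanish M H"
    show ?cob
    proof (intro allI impI, elim conjE)
      fix h assume h: "lin R (obj P 1) H h" and hd: "\<forall>x\<in>carrier (obj P 2). h (diff P 2 x) = \<zero>\<^bsub>H\<^esub>"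
      have "\<forall>x\<in>carrier (obj P 1). diff P 1 x = \<zero>\<^bsub>?K\<^esub> \<longrightarrow> h x = \<zero>\<^bsub>H\<^esub>"
      proof (intro ballI impI)
        fix x assume x: "x \<in> carrier (obj P 1)" "diff P 1 x = \<zero>\<^bsub>?K\<^esub>"
        then have "x \<in> diff P 2 ` carrier (obj P 2)" unfolding d2s by (simp add: a_kernel_def')
        then show "h x = \<zero>\<^bsub>H\<^esub>" using hd by auto
      qed
      from lin_factor[OF d1K d1s h mods LM_left_module[OF K] mH this]
      obtain u where u: "lin R ?K H u" "\<forall>x\<in>carrier (obj P 1). u (diff P 1 x) = h x" by blast
      from ext_vanishD[OF van K LMs se u(1)]
      obtain w where w: "lin R (obj P 0) H w" "\<forall>x\<in>carrier ?K. w x = u x" by blast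
      have "w (diff P 1 x) = h x" if "x \<in> carrier (obj P 1)" for x
        using w(2) u(2) lin_closed[OF d1K that] that by metis
      then show "\<exists>g. lin R (obj P 0) H g \<and> (\<forall>x\<in>carrier (obj P 1). g (diff P 1 x) = h x)"
        using w(1) by blast
    qed
  qed
  finally show ?thesis .
qed

text \<open>The dimension shift from Ext^2(M, H) to Ext^1 of the first syzygy. The presentation is
  fixed before \<open>H\<close> because one syzygy must serve all \<open>H\<close> in \<B> at
  once.\<close>

lemma Ext_2_syzygy:
  assumes M: "M \<in> LM"
  shows "\<exists>P \<epsilon>. projective R U P \<and> lin R P M \<epsilon> \<and> \<epsilon> ` carrier P = carrier M \<and>
    (\<forall>H\<in>LM. trivial_group (Ext R U 2 M H) \<longrightarrow> ext_vanish (ker_mod P M \<epsilon>) H)"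
proof -
  define P where "P = proj_res R U M"
  obtain \<epsilon> where "projective_resolution R U M P \<epsilon>" using proj_res[OF M] P_def by blast
  note res = projective_resolutionD[OF this]
  let ?K = "ker_mod (obj P 0) M \<epsilon>"
  let ?L = "ker_mod (obj P 1) ?K (diff P 1)"
  have LMs: "obj P n \<in> LM" for n by (rule complexesD(1)[OF res(1)])
  note mods = LM_left_module[OF LMs]
  have K: "?K \<in> LM" by (rule ker_LM[OF LMs M res(3)])
  have d1: "lin R (obj P 1) (obj P 0) (diff P 1)" and d2: "lin R (obj P 2) (obj P 1) (diff P 2)"
    using complexesD(2)[OF res(1), of 1] complexesD(2)[OF res(1), of 2] by simp_all
  have d1K: "lin R (obj P 1) ?K (diff P 1)" by (rule lin_into[OF d1]) (simp add: res(5))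
  have d1s: "diff P 1 ` carrier (obj P 1) = carrier ?K" by (simp add: res(5))
  have L: "?L \<in> LM" by (rule ker_LM[OF LMs K d1K])
  have d2s: "diff P 2 ` carrier (obj P 2) = carrier ?L"
    using res(6)[of 1] by (simp add: a_kernel_def')
  have d2L: "lin R (obj P 2) ?L (diff P 2)" by (rule lin_into[OF d2]) (use d2s in simp)
  have "ext_vanish ?K H" if H: "H \<in> LM" and triv: "trivial_group (Ext R U 2 M H)" for H
  proof (rule ext_vanish_syzygy[OF L LMs K H short_exact_ker[OF d1K d1s]])
    note mH = LM_left_module[OF H]
    have cob: "\<forall>h. lin R (obj P 2) H h \<and> (\<forall>x\<in>carrier (obj P 3). h (diff P 3 x) = \<zero>\<^bsub>H\<^esub>) \<longrightarrow>
      (\<exists>g. lin R (obj P 1) H g \<and> (\<forall>x\<in>carrier (obj P 2). g (diff P 2 x) = h x))"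
      using trivial_hom_cohomology_iff[OF res(1) mH, of 2] triv by (simp add: Ext_def P_def)
    show "ext_vanish (obj P 1) H" by (rule ext_vanish_projective[OF res(2) H]) simp
    fix v assume v: "lin R ?L H v"
    have "v (diff P 2 (diff P 3 x)) = \<zero>\<^bsub>H\<^esub>" if "x \<in> carrier (obj P 3)" for x
    proof -
      have "diff P 2 (diff P 3 x) = \<zero>\<^bsub>?L\<^esub>" using complexesD(3)[OF res(1) that] by simp
      then show ?thesis using lin_zero[OF v LM_left_module[OF L] mH] by simp
    qed
    then obtain g where g: "lin R (obj P 1) H g" "\<forall>x\<in>carrier (obj P 2). g (diff P 2 x) = v (diff P 2 x)"
      using cob[rule_format, of "\<lambda>x. v (diff P 2 x)"] lin_comp[OF d2L v] by blast
    have "\<forall>x\<in>carrier ?L. g x = v x" unfolding d2s[symmetric] using g(2) by blast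
    then show "\<exists>w. lin R (obj P 1) H w \<and> (\<forall>x\<in>carrier ?L. w x = v x)" using g(1) by blast
  qed
  then show ?thesis using res(2)[of 0] res(3,4) by blast
qed

end

section \<open>Extensions of Gorenstein modules\<close>

lemma lin_zero_mem: "left_module R M \<Longrightarrow> \<zero>\<^bsub>M\<^esub> \<in> carrier M"
  by (simp add: left_module_abelian_group abelian_group.axioms(1) abelian_monoid.zero_closed)

context module_category
begin

lemma projective_zero:
  assumes M: "M \<in> LM" and zero: "carrier M = {\<zero>\<^bsub>M\<^esub>}"
  shows "projective R U M"
  unfolding projective_def
proof (intro conjI M ballI impI)
  fix X Y g f
  assume X: "X \<in> LM" and Y: "Y \<in> LM" and "g \<in> mod_hom R X Y" "f \<in> mod_hom R M Y"
  then have g: "lin R X Y g" and f: "lin R M Y f" by (simp_all add: mod_hom_iff)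
  note m = LM_left_module[OF M] LM_left_module[OF X] LM_left_module[OF Y]
  show "\<exists>h\<in>mod_hom R M X. \<forall>p\<in>carrier M. g (h p) = f p"
  proof (rule bexI[of _ "\<lambda>x. \<zero>\<^bsub>X\<^esub>"])
    show "\<forall>p\<in>carrier M. g \<zero>\<^bsub>X\<^esub> = f p"
      using lin_zero[OF g m(2,3)] lin_zero[OF f m(1,3)] zero by simp
    show "(\<lambda>x. \<zero>\<^bsub>X\<^esub>) \<in> mod_hom R M X" unfolding mod_hom_iff by (rule lin_const_zero[OF m(2)])
  qed
qed

lemma ext_vanish_zero:
  assumes H: "H \<in> LM" and zero: "carrier H = {\<zero>\<^bsub>H\<^esub>}"
  shows "ext_vanish M H"
proof (rule ext_vanishI)
  fix X Y f g u
  assume u: "lin R X H u"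
  have "\<forall>x\<in>carrier X. \<zero>\<^bsub>H\<^esub> = u x" using lin_closed[OF u] zero by simp
  then show "\<exists>w. lin R Y H w \<and> (\<forall>x\<in>carrier X. w (f x) = u x)"
    using lin_const_zero[OF LM_left_module[OF H], of Y] by (intro exI[of _ "\<lambda>x. \<zero>\<^bsub>H\<^esub>"]) simp
qed

lemma short_exact_dsum:
  assumes MN: "M \<in> LM" "N \<in> LM"
  shows "short_exact R M (\<lambda>x. dpair M N x \<zero>\<^bsub>N\<^esub>) (dsum M N) (dsnd M N) N"
proof -
  note z = lin_zero_mem[OF LM_left_module[OF MN(1)]] lin_zero_mem[OF LM_left_module[OF MN(2)]]
  note simps = dfst_dpair[OF MN] dsnd_dpair[OF MN] dpair_closed[OF MN]
  show ?thesis
  proof (rule short_exactI)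
    show "lin R M (dsum M N) (\<lambda>x. dpair M N x \<zero>\<^bsub>N\<^esub>)"
      by (intro lin_dpair[OF MN] lin_id lin_const_zero LM_left_module MN)
    show "lin R (dsum M N) N (dsnd M N)" by (rule lin_dsnd[OF MN])
    show "inj_on (\<lambda>x. dpair M N x \<zero>\<^bsub>N\<^esub>) (carrier M)"
      by (rule inj_on_inverseI[of _ "dfst M N"]) (simp add: simps z)
    show "\<forall>x\<in>carrier M. dsnd M N (dpair M N x \<zero>\<^bsub>N\<^esub>) = \<zero>\<^bsub>N\<^esub>" by (simp add: simps z)
    show "\<forall>y\<in>carrier (dsum M N). dsnd M N y = \<zero>\<^bsub>N\<^esub> \<longrightarrow> y \<in> (\<lambda>x. dpair M N x \<zero>\<^bsub>N\<^esub>) ` carrier M"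
    proof (intro ballI impI)
      fix y assume y: "y \<in> carrier (dsum M N)" "dsnd M N y = \<zero>\<^bsub>N\<^esub>"
      have "y = dpair M N (dfst M N y) \<zero>\<^bsub>N\<^esub>" using dpair_collapse[OF MN y(1)] y(2) by simp
      then show "y \<in> (\<lambda>x. dpair M N x \<zero>\<^bsub>N\<^esub>) ` carrier M" using lin_closed[OF lin_dfst[OF MN] y(1)] by blast
    qed
    show "dsnd M N ` carrier (dsum M N) = carrier N"
    proof (rule lin_surjI[OF lin_dsnd[OF MN]])
      fix y assume y: "y \<in> carrier N"
      have "dsnd M N (dpair M N \<zero>\<^bsub>M\<^esub> y) = y" "dpair M N \<zero>\<^bsub>M\<^esub> y \<in> carrier (dsum M N)"
        using y by (simp_all add: simps z)
      then show "y \<in> dsnd M N ` carrier (dsum M N)" by (metis imageI)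
    qed
  qed
qed

section \<open>Horseshoe constructions and sequences of cokernels\<close>

text \<open>A lift \<open>b\<close> of the epimorphism onto M'' to a map into M is given in place of
  projectivity of X''. This covers two uses: joining projective covers along an extension, and, with
  M'' = 0, adding to an epimorphism onto M an arbitrary map from X'', when the kernel becomes an
  extension of X'' by the kernel of \<open>a\<close>.\<close>

lemma horseshoe_kernel:
  assumes LM: "M' \<in> LM" "M \<in> LM" "M'' \<in> LM" "X' \<in> LM" "X'' \<in> LM"
    and se: "short_exact R M' i M p M''"
    and a: "lin R X' M' a" "a ` carrier X' = carrier M'"
    and b: "lin R X'' M b" "(\<lambda>x. p (b x)) ` carrier X'' = carrier M''"
  defines "c \<equiv> \<lambda>z. i (a (dfst X' X'' z)) \<oplus>\<^bsub>M\<^esub> b (dsnd X' X'' z)"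
  shows "lin R (dsum X' X'') M c" and "c ` carrier (dsum X' X'') = carrier M"
    and "short_exact R (ker_mod X' M' a) (\<lambda>x. dpair X' X'' x \<zero>\<^bsub>X''\<^esub>) (ker_mod (dsum X' X'') M c)
      (dsnd X' X'') (ker_mod X'' M'' (\<lambda>x. p (b x)))"
proof -
  note XX = LM(4,5)
  note s = short_exactD[OF se]
  interpret M': left_module R M' using LM by auto
  interpret M: left_module R M using LM by auto
  interpret M'': left_module R M'' using LM by auto
  interpret X': left_module R X' using LM by auto
  interpret X'': left_module R X'' using LM by auto
  note mods = M'.left_module_axioms M.left_module_axioms M''.left_module_axioms
    X'.left_module_axioms X''.left_module_axioms
  note simps = dfst_dpair[OF XX] dsnd_dpair[OF XX] dpair_closed[OF XX]
  let ?D = "dsum X' X''"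
  show c: "lin R ?D M c"
    unfolding c_def by (intro lin_plus lin_comp[OF lin_dfst[OF XX] lin_comp[OF a(1) s(1)]]
      lin_comp[OF lin_dsnd[OF XX] b(1)] mods)
  have c_pair: "c (dpair X' X'' x y) = i (a x) \<oplus>\<^bsub>M\<^esub> b y" if "x \<in> carrier X'" "y \<in> carrier X''" for x y
    using that by (simp add: c_def simps)
  have ia: "i (a x) \<in> carrier M" if "x \<in> carrier X'" for x
    using lin_closed[OF s(1) lin_closed[OF a(1) that]] .
  have bM: "b x \<in> carrier M" if "x \<in> carrier X''" for x using lin_closed[OF b(1) that] .
  have pia: "p (i (a x)) = \<zero>\<^bsub>M''\<^esub>" if "x \<in> carrier X'" for x
    using s(5) lin_closed[OF a(1) that] by simp
  have pc: "p (c (dpair X' X'' x y)) = p (b y)" if "x \<in> carrier X'" "y \<in> carrier X''" for x y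
    using that by (simp add: c_pair lin_add[OF s(2)] ia bM pia lin_closed[OF s(2)])
  have i0: "i \<zero>\<^bsub>M'\<^esub> = \<zero>\<^bsub>M\<^esub>" by (rule lin_zero[OF s(1) mods(1,2)])
  have b0: "b \<zero>\<^bsub>X''\<^esub> = \<zero>\<^bsub>M\<^esub>" by (rule lin_zero[OF b(1) mods(5,2)])
  \<comment> \<open>Exactness at \<open>M\<close> combined with surjectivity of \<open>a\<close>. It
    is used twice to correct \<open>b y\<close> by an element coming from X'.\<close>
  have hit: "\<exists>x\<in>carrier X'. i (a x) = m" if m: "m \<in> carrier M" "p m = \<zero>\<^bsub>M''\<^esub>" for m
  proof -
    obtain m' where m': "m' \<in> carrier M'" "m = i m'" using s(6)[rule_format, OF m] by blast
    have "m' \<in> a ` carrier X'" unfolding a(2) by (rule m'(1))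
    then obtain x where "x \<in> carrier X'" "m' = a x" by blast
    then show ?thesis using m'(2) by blast
  qed
  show "c ` carrier ?D = carrier M"
  proof (rule lin_surjI[OF c])
    fix m assume m: "m \<in> carrier M"
    have "p m \<in> (\<lambda>x. p (b x)) ` carrier X''" unfolding b(2) by (rule lin_closed[OF s(2) m])
    then obtain y where y: "y \<in> carrier X''" "p m = p (b y)" by blast
    have "p (m \<ominus>\<^bsub>M\<^esub> b y) = \<zero>\<^bsub>M''\<^esub>"
      using y m lin_minus[OF s(2) mods(2,3) m bM[OF y(1)]] lin_closed[OF s(2) m] by simp
    then obtain x where x: "x \<in> carrier X'" "i (a x) = m \<ominus>\<^bsub>M\<^esub> b y" using hit m bM[OF y(1)] by blast
    have "c (dpair X' X'' x y) = m" using c_pair[OF x(1) y(1)] x(2) m bM[OF y(1)] by simp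
    then show "m \<in> c ` carrier ?D" using simps(3)[OF x(1) y(1)] by blast
  qed
  let ?K' = "ker_mod X' M' a" let ?K = "ker_mod ?D M c" let ?K'' = "ker_mod X'' M'' (\<lambda>x. p (b x))"
  have K: "carrier ?K' = {x \<in> carrier X'. a x = \<zero>\<^bsub>M'\<^esub>}" "carrier ?K = {z \<in> carrier ?D. c z = \<zero>\<^bsub>M\<^esub>}"
    "carrier ?K'' = {x \<in> carrier X''. p (b x) = \<zero>\<^bsub>M''\<^esub>}"
    by (simp_all add: a_kernel_def')
  note sd = short_exactD[OF short_exact_dsum[OF XX]]
  show "short_exact R ?K' (\<lambda>x. dpair X' X'' x \<zero>\<^bsub>X''\<^esub>) ?K (dsnd X' X'') ?K''"
  proof (rule short_exactI)
    have "(\<lambda>x. dpair X' X'' x \<zero>\<^bsub>X''\<^esub>) ` carrier ?K' \<subseteq> carrier ?K"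
      unfolding K by (auto simp: simps c_pair i0 b0)
    then show "lin R ?K' ?K (\<lambda>x. dpair X' X'' x \<zero>\<^bsub>X''\<^esub>)"
      by (intro lin_into lin_restrict[OF sd(1)]) (auto simp: a_kernel_def')
    have "dsnd X' X'' ` carrier ?K \<subseteq> carrier ?K''"
    proof (rule image_subsetI)
      fix z assume z: "z \<in> carrier ?K"
      obtain x y where xy: "x \<in> carrier X'" "y \<in> carrier X''" "z = dpair X' X'' x y"
        using dsum_cases[OF XX, of z] z unfolding K by blast
      have "p (b y) = p (c z)" using xy pc by simp
      also have "\<dots> = \<zero>\<^bsub>M''\<^esub>" using z lin_zero[OF s(2) mods(2,3)] by (simp add: a_kernel_def')
      finally show "dsnd X' X'' z \<in> carrier ?K''" unfolding K using xy by (simp add: simps)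
    qed
    then show "lin R ?K ?K'' (dsnd X' X'')"
      by (intro lin_into lin_restrict[OF sd(2)]) (auto simp: a_kernel_def')
    show "inj_on (\<lambda>x. dpair X' X'' x \<zero>\<^bsub>X''\<^esub>) (carrier ?K')"
      by (rule inj_on_subset[OF sd(3)]) (auto simp: a_kernel_def')
    show "\<forall>x\<in>carrier ?K'. dsnd X' X'' (dpair X' X'' x \<zero>\<^bsub>X''\<^esub>) = \<zero>\<^bsub>?K''\<^esub>"
      unfolding K by (simp add: simps)
    show "\<forall>z\<in>carrier ?K. dsnd X' X'' z = \<zero>\<^bsub>?K''\<^esub> \<longrightarrow> z \<in> (\<lambda>x. dpair X' X'' x \<zero>\<^bsub>X''\<^esub>) ` carrier ?K'"
    proof (intro ballI impI)
      fix z assume z: "z \<in> carrier ?K" "dsnd X' X'' z = \<zero>\<^bsub>?K''\<^esub>"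
      then obtain x where x: "x \<in> carrier X'" "z = dpair X' X'' x \<zero>\<^bsub>X''\<^esub>"
        using sd(6) by (auto simp: a_kernel_def')
      then have "i (a x) = i \<zero>\<^bsub>M'\<^esub>"
        using z(1) c_pair[OF x(1) X''.zero_closed] ia[OF x(1)] by (simp add: a_kernel_def' b0 i0)
      then have "a x = \<zero>\<^bsub>M'\<^esub>" by (rule inj_onD[OF s(3)]) (use lin_closed[OF a(1) x(1)] in auto)
      then show "z \<in> (\<lambda>x. dpair X' X'' x \<zero>\<^bsub>X''\<^esub>) ` carrier ?K'" unfolding K using x by blast
    qed
    show "dsnd X' X'' ` carrier ?K = carrier ?K''"
    proof
      show "dsnd X' X'' ` carrier ?K \<subseteq> carrier ?K''" by fact
      show "carrier ?K'' \<subseteq> dsnd X' X'' ` carrier ?K"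
      proof
        fix y assume "y \<in> carrier ?K''"
        then have y: "y \<in> carrier X''" "p (b y) = \<zero>\<^bsub>M''\<^esub>" unfolding K by auto
        have "p (\<ominus>\<^bsub>M\<^esub> b y) = \<zero>\<^bsub>M''\<^esub>"
          using lin_neg[OF s(2) mods(2,3) bM[OF y(1)]] y(2) by simp
        then obtain x where x: "x \<in> carrier X'" "i (a x) = \<ominus>\<^bsub>M\<^esub> b y" using hit bM[OF y(1)] by blast
        have "c (dpair X' X'' x y) = \<zero>\<^bsub>M\<^esub>"
          using c_pair[OF x(1) y(1)] x(2) bM[OF y(1)] by (simp add: M.l_neg)
        then have "dpair X' X'' x y \<in> carrier ?K" unfolding K using simps(3)[OF x(1) y(1)] by simp
        moreover have "dsnd X' X'' (dpair X' X'' x y) = y" using x y by (simp add: simps)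
        ultimately show "y \<in> dsnd X' X'' ` carrier ?K" by (metis imageI)
      qed
    qed
  qed
qed

text \<open>Elementwise form of the third isomorphism theorem. N, Q and Q' are the quotients of E, I
  and I by the kernels of q, s and r. The conditions say that ker q is the preimage of ker s under
  j, and that ker r is generated by ker s and the image of j. Hence N embeds into Q with quotient
  Q'.\<close>

lemma coker_sequence:
  assumes LM: "E \<in> LM" "N \<in> LM" "I \<in> LM" "Q \<in> LM" "Q' \<in> LM"
    and q: "lin R E N q" "q ` carrier E = carrier N" and s: "lin R I Q s" "s ` carrier I = carrier Q"
    and j: "lin R E I j" and r: "lin R I Q' r" "r ` carrier I = carrier Q'"
    and sj: "\<forall>x\<in>carrier E. s (j x) = \<zero>\<^bsub>Q\<^esub> \<longleftrightarrow> q x = \<zero>\<^bsub>N\<^esub>"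
    and rj: "\<forall>x\<in>carrier E. r (j x) = \<zero>\<^bsub>Q'\<^esub>"
    and sr: "\<forall>z\<in>carrier I. s z = \<zero>\<^bsub>Q\<^esub> \<longrightarrow> r z = \<zero>\<^bsub>Q'\<^esub>"
    and rs: "\<forall>z\<in>carrier I. r z = \<zero>\<^bsub>Q'\<^esub> \<longrightarrow> (\<exists>x\<in>carrier E. s z = s (j x))"
  shows "\<exists>a b. short_exact R N a Q b Q'"
proof -
  note m = LM[THEN LM_left_module]
  obtain a where a: "lin R N Q a" "\<forall>x\<in>carrier E. a (q x) = s (j x)"
    using lin_factor[OF q lin_comp[OF j s(1)] m(1,2,4)] sj by blast
  obtain b where b: "lin R Q Q' b" "\<forall>z\<in>carrier I. b (s z) = r z"
    using lin_factor[OF s r(1) m(3,4,5) sr] by blast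
  have "short_exact R N a Q b Q'"
  proof (rule short_exactI[OF a(1) b(1)])
    show "inj_on a (carrier N)"
    proof (rule lin_injI[OF a(1) m(2,4)])
      fix u assume u: "u \<in> carrier N" "a u = \<zero>\<^bsub>Q\<^esub>"
      then obtain x where "x \<in> carrier E" "u = q x" using q(2) by (metis imageE)
      then show "u = \<zero>\<^bsub>N\<^esub>" using a(2) sj u by simp
    qed
    show "\<forall>u\<in>carrier N. b (a u) = \<zero>\<^bsub>Q'\<^esub>"
      unfolding q(2)[symmetric] using a(2) b(2) rj lin_closed[OF j] by simp
    show "\<forall>u\<in>carrier Q. b u = \<zero>\<^bsub>Q'\<^esub> \<longrightarrow> u \<in> a ` carrier N"
    proof (intro ballI impI)
      fix u assume u: "u \<in> carrier Q" "b u = \<zero>\<^bsub>Q'\<^esub>"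
      then obtain z where z: "z \<in> carrier I" "u = s z" using s(2) by (metis imageE)
      then obtain x where x: "x \<in> carrier E" "u = s (j x)" using rs u b(2) by auto
      then have "u = a (q x)" using a(2) by simp
      then show "u \<in> a ` carrier N" using lin_closed[OF q(1) x(1)] by blast
    qed
    have "b ` s ` carrier I = r ` carrier I" unfolding image_image by (rule image_cong) (simp_all add: b(2))
    then show "b ` carrier Q = carrier Q'" using s(2) r(2) by simp
  qed
  then show ?thesis by blast
qed

text \<open>Dual horseshoe. The embedding of M' is extended to M by \<open>t\<close> in advance, so
  X' may be any module. For M' = 0 and M = M'' the map \<open>t\<close> is arbitrary, and the
  cokernel is an extension of Q'' by X'.\<close>

lemma horseshoe_cokernel:
  assumes LM: "M' \<in> LM" "M \<in> LM" "M'' \<in> LM" "X' \<in> LM" "X'' \<in> LM" "Q' \<in> LM" "Q'' \<in> LM"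
    and se: "short_exact R M' i M p M''"
    and t: "lin R M X' t" and se': "short_exact R M' (\<lambda>x. t (i x)) X' q' Q'"
    and se'': "short_exact R M'' e X'' q'' Q''"
  defines "F \<equiv> \<lambda>m. dpair X' X'' (t m) (e (p m))"
  shows "\<exists>Q s a b. Q \<in> LM \<and> short_exact R M F (dsum X' X'') s Q \<and> short_exact R Q' a Q b Q''"
proof -
  note XX = LM(4,5)
  note s0 = short_exactD[OF se] and s1 = short_exactD[OF se'] and s2 = short_exactD[OF se'']
  interpret M': left_module R M' using LM by auto
  interpret M: left_module R M using LM by auto
  interpret M'': left_module R M'' using LM by auto
  interpret X': left_module R X' using LM by auto
  interpret X'': left_module R X'' using LM by auto
  interpret Q': left_module R Q' using LM by auto
  interpret Q'': left_module R Q'' using LM by auto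
  note simps = dfst_dpair[OF XX] dsnd_dpair[OF XX] dpair_closed[OF XX]
  let ?D = "dsum X' X''"
  have D: "?D \<in> LM" by (rule dsum_LM[OF XX])
  interpret D: left_module R ?D using D by auto
  have ep: "lin R M X'' (\<lambda>m. e (p m))" by (rule lin_comp[OF s0(2) s2(1)])
  have F: "lin R M ?D F" unfolding F_def by (intro lin_dpair[OF XX] t ep)
  have fstF: "dfst X' X'' (F m) = t m" and sndF: "dsnd X' X'' (F m) = e (p m)" if "m \<in> carrier M" for m
    using that lin_closed[OF t] lin_closed[OF ep] by (simp_all add: F_def simps)
  have p0: "p \<zero>\<^bsub>M\<^esub> = \<zero>\<^bsub>M''\<^esub>" by (rule lin_zero[OF s0(2)]) (use LM in auto)
  have e0: "e \<zero>\<^bsub>M''\<^esub> = \<zero>\<^bsub>X''\<^esub>" by (rule lin_zero[OF s2(1)]) (use LM in auto)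
  have q''0: "q'' \<zero>\<^bsub>X''\<^esub> = \<zero>\<^bsub>Q''\<^esub>" by (rule lin_zero[OF s2(2)]) (use LM in auto)
  have eker: "\<exists>m'\<in>carrier M'. m = i m'" if "m \<in> carrier M" "e (p m) = \<zero>\<^bsub>X''\<^esub>" for m
  proof -
    have "p m = \<zero>\<^bsub>M''\<^esub>"
      by (rule inj_onD[OF s2(3)]) (use that e0 lin_closed[OF s0(2) that(1)] in auto)
    then show ?thesis using s0(6) that(1) by simp
  qed
  have inj: "inj_on F (carrier M)"
  proof (rule lin_injI[OF F M.left_module_axioms D.left_module_axioms])
    fix m assume m: "m \<in> carrier M" "F m = \<zero>\<^bsub>?D\<^esub>"
    then have "F m = dpair X' X'' \<zero>\<^bsub>X'\<^esub> \<zero>\<^bsub>X''\<^esub>" using dpair_zero[OF XX] by simp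
    then have t0: "t m = \<zero>\<^bsub>X'\<^esub>" and "e (p m) = \<zero>\<^bsub>X''\<^esub>"
      using fstF[OF m(1)] sndF[OF m(1)] dfst_dpair[OF XX X'.zero_closed X''.zero_closed]
        dsnd_dpair[OF XX X'.zero_closed X''.zero_closed] by metis+
    then obtain m' where m': "m' \<in> carrier M'" "m = i m'" using eker m(1) by blast
    have "t (i m') = t (i \<zero>\<^bsub>M'\<^esub>)"
      using m' t0 lin_zero[OF s1(1) M'.left_module_axioms X'.left_module_axioms] by simp
    then have "m' = \<zero>\<^bsub>M'\<^esub>" using inj_onD[OF s1(3)] m'(1) by blast
    then show "m = \<zero>\<^bsub>M\<^esub>"
      using m'(2) lin_zero[OF s0(1) M'.left_module_axioms M.left_module_axioms] by simp
  qed
  obtain Q s where Q: "Q \<in> LM" and sQ: "short_exact R M F ?D s Q"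
    using coker_exists[OF LM(2) D F inj] by blast
  note s3 = short_exactD[OF sQ]
  interpret Q: left_module R Q using Q by auto
  let ?j = "\<lambda>x. dpair X' X'' x \<zero>\<^bsub>X''\<^esub>"
  note sd = short_exactD[OF short_exact_dsum[OF XX]]
  have sj: "lin R X' Q (\<lambda>x. s (?j x))" by (rule lin_comp[OF sd(1) s3(2)])
  have sj0: "s (?j x) = \<zero>\<^bsub>Q\<^esub> \<longleftrightarrow> q' x = \<zero>\<^bsub>Q'\<^esub>" if x: "x \<in> carrier X'" for x
  proof
    assume "s (?j x) = \<zero>\<^bsub>Q\<^esub>"
    then obtain m where m: "m \<in> carrier M" "?j x = F m" using s3(6) x by (auto simp: simps)
    have "t m = x" "e (p m) = \<zero>\<^bsub>X''\<^esub>"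
      using fstF[OF m(1)] sndF[OF m(1)] m(2)[symmetric] x by (simp_all add: simps)
    moreover obtain m' where "m' \<in> carrier M'" "m = i m'" using eker[OF m(1)] calculation by blast
    ultimately show "q' x = \<zero>\<^bsub>Q'\<^esub>" using s1(5) by auto
  next
    assume "q' x = \<zero>\<^bsub>Q'\<^esub>"
    then obtain m' where m': "m' \<in> carrier M'" "x = t (i m')" using s1(6) x by blast
    have "?j x = F (i m')" using m' s0(5) by (simp add: F_def e0)
    then show "s (?j x) = \<zero>\<^bsub>Q\<^esub>" using s3(5) lin_closed[OF s0(1) m'(1)] by simp
  qed
  have "\<exists>a b. short_exact R Q' a Q b Q''"
  proof (rule coker_sequence[OF LM(4,6) D Q LM(7) s1(2,7) s3(2,7) sd(1) lin_comp[OF lin_dsnd[OF XX] s2(2)]])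
    show "(\<lambda>z. q'' (dsnd X' X'' z)) ` carrier ?D = carrier Q''"
      using s2(7) sd(7) by (simp add: image_image[symmetric])
    show "\<forall>x\<in>carrier X'. s (?j x) = \<zero>\<^bsub>Q\<^esub> \<longleftrightarrow> q' x = \<zero>\<^bsub>Q'\<^esub>" using sj0 by blast
    show "\<forall>x\<in>carrier X'. q'' (dsnd X' X'' (?j x)) = \<zero>\<^bsub>Q''\<^esub>" using q''0 by (simp add: simps)
    show "\<forall>z\<in>carrier ?D. s z = \<zero>\<^bsub>Q\<^esub> \<longrightarrow> q'' (dsnd X' X'' z) = \<zero>\<^bsub>Q''\<^esub>"
    proof (intro ballI impI)
      fix z assume "z \<in> carrier ?D" "s z = \<zero>\<^bsub>Q\<^esub>"
      then obtain m where m: "m \<in> carrier M" "z = F m" using s3(6) by blast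
      then show "q'' (dsnd X' X'' z) = \<zero>\<^bsub>Q''\<^esub>" using sndF s2(5) lin_closed[OF s0(2)] by simp
    qed
    show "\<forall>z\<in>carrier ?D. q'' (dsnd X' X'' z) = \<zero>\<^bsub>Q''\<^esub> \<longrightarrow> (\<exists>x\<in>carrier X'. s z = s (?j x))"
    proof (intro ballI impI)
      fix z assume z: "z \<in> carrier ?D" "q'' (dsnd X' X'' z) = \<zero>\<^bsub>Q''\<^esub>"
      obtain x y where xy: "x \<in> carrier X'" "y \<in> carrier X''" "z = dpair X' X'' x y"
        using dsum_cases[OF XX z(1)] by blast
      then have "q'' y = \<zero>\<^bsub>Q''\<^esub>" using z by (simp add: simps)
      then obtain m'' where m'': "m'' \<in> carrier M''" "y = e m''" using s2(6) xy by blast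
      obtain m where m: "m \<in> carrier M" "m'' = p m" using m''(1) s0(7) by (metis imageE)
      have tm: "t m \<in> carrier X'" by (rule lin_closed[OF t m(1)])
      \<comment> \<open>Modulo the image of \<open>F\<close> an element with second component e(p m)
        can be moved into the first summand.\<close>
      have "z = ?j (x \<ominus>\<^bsub>X'\<^esub> t m) \<oplus>\<^bsub>?D\<^esub> F m"
        using xy m m'' tm by (simp add: F_def dpair_add[OF XX])
      then have "s z = s (?j (x \<ominus>\<^bsub>X'\<^esub> t m)) \<oplus>\<^bsub>Q\<^esub> s (F m)"
        using lin_add[OF s3(2)] lin_closed[OF F m(1)] xy tm by (simp add: simps)
      then have "s z = s (?j (x \<ominus>\<^bsub>X'\<^esub> t m))"
        using s3(5) m(1) xy(1) tm lin_closed[OF sj] by simp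
      then show "\<exists>x\<in>carrier X'. s z = s (?j x)" using xy(1) tm by blast
    qed
  qed
  then show ?thesis using Q sQ by blast
qed

lemma short_exact_ker_comp:
  assumes LM: "P \<in> LM" "E \<in> LM" "M \<in> LM"
    and \<pi>: "lin R P E \<pi>" "\<pi> ` carrier P = carrier E" and p: "lin R E M p"
  shows "short_exact R (ker_mod P E \<pi>) (\<lambda>x. x) (ker_mod P M (\<lambda>x. p (\<pi> x))) \<pi> (ker_mod E M p)"
proof (rule short_exactI)
  have p0: "p \<zero>\<^bsub>E\<^esub> = \<zero>\<^bsub>M\<^esub>" by (rule lin_zero[OF p]) (use LM in auto)
  let ?K = "ker_mod P M (\<lambda>x. p (\<pi> x))"
  show "lin R (ker_mod P E \<pi>) ?K (\<lambda>x. x)"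
    by (intro lin_into lin_subset) (auto simp: a_kernel_def' p0)
  show "lin R ?K (ker_mod E M p) \<pi>"
    by (intro lin_into lin_restrict[OF \<pi>(1)]) (auto simp: a_kernel_def' lin_closed[OF \<pi>(1)])
  show "\<pi> ` carrier ?K = carrier (ker_mod E M p)"
  proof
    show "\<pi> ` carrier ?K \<subseteq> carrier (ker_mod E M p)" by (auto simp: a_kernel_def' lin_closed[OF \<pi>(1)])
    show "carrier (ker_mod E M p) \<subseteq> \<pi> ` carrier ?K"
    proof
      fix x assume x: "x \<in> carrier (ker_mod E M p)"
      then have "x \<in> \<pi> ` carrier P" unfolding \<pi>(2) by (simp add: a_kernel_def')
      then obtain y where "y \<in> carrier P" "x = \<pi> y" by blast
      then show "x \<in> \<pi> ` carrier ?K" using x by (auto simp: a_kernel_def')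
    qed
  qed
qed (auto simp: a_kernel_def' lin_zero[OF p])

text \<open>The quotient of I/M by E/M = N is I/E = Q', for the composite embedding of M into
  I.\<close>

lemma short_exact_coker_comp:
  assumes LM: "M \<in> LM" "E \<in> LM" "N \<in> LM" "I \<in> LM" "Q' \<in> LM"
    and se: "short_exact R M f E q N" and se': "short_exact R E j I r Q'"
  shows "\<exists>Q s a b. Q \<in> LM \<and> short_exact R M (\<lambda>x. j (f x)) I s Q \<and> short_exact R N a Q b Q'"
proof -
  note s0 = short_exactD[OF se] and s1 = short_exactD[OF se']
  interpret E: left_module R E using LM by auto
  interpret N: left_module R N using LM by auto
  interpret I: left_module R I using LM by auto
  interpret Q': left_module R Q' using LM by auto
  have jf: "lin R M I (\<lambda>x. j (f x))" by (rule lin_comp[OF s0(1) s1(1)])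
  have "inj_on (\<lambda>x. j (f x)) (carrier M)"
    using s0(3) s1(3) lin_closed[OF s0(1)] by (auto simp: inj_on_def)
  then obtain Q s where Q: "Q \<in> LM" and sQ: "short_exact R M (\<lambda>x. j (f x)) I s Q"
    using coker_exists[OF LM(1,4) jf] by blast
  note s3 = short_exactD[OF sQ]
  interpret Q: left_module R Q using Q by auto
  have sj: "lin R E Q (\<lambda>x. s (j x))" by (rule lin_comp[OF s1(1) s3(2)])
  have sj0: "s (j x) = \<zero>\<^bsub>Q\<^esub> \<longleftrightarrow> q x = \<zero>\<^bsub>N\<^esub>" if x: "x \<in> carrier E" for x
  proof
    assume "s (j x) = \<zero>\<^bsub>Q\<^esub>"
    then obtain m where m: "m \<in> carrier M" "j x = j (f m)" using s3(6) lin_closed[OF s1(1) x] by blast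
    have "x = f m" by (rule inj_onD[OF s1(3)]) (use m x lin_closed[OF s0(1)] in auto)
    then show "q x = \<zero>\<^bsub>N\<^esub>" using s0(5) m by simp
  next
    assume "q x = \<zero>\<^bsub>N\<^esub>"
    then obtain m where "m \<in> carrier M" "x = f m" using s0(6) x by blast
    then show "s (j x) = \<zero>\<^bsub>Q\<^esub>" using s3(5) by simp
  qed
  have "\<exists>a b. short_exact R N a Q b Q'"
  proof (rule coker_sequence[OF LM(2,3,4) Q LM(5) s0(2,7) s3(2,7) s1(1,2,7)])
    show "\<forall>x\<in>carrier E. s (j x) = \<zero>\<^bsub>Q\<^esub> \<longleftrightarrow> q x = \<zero>\<^bsub>N\<^esub>" using sj0 by blast
    show "\<forall>x\<in>carrier E. r (j x) = \<zero>\<^bsub>Q'\<^esub>" by (rule s1(5))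
    show "\<forall>x\<in>carrier I. s x = \<zero>\<^bsub>Q\<^esub> \<longrightarrow> r x = \<zero>\<^bsub>Q'\<^esub>"
    proof (intro ballI impI)
      fix x assume "x \<in> carrier I" "s x = \<zero>\<^bsub>Q\<^esub>"
      then obtain m where "m \<in> carrier M" "x = j (f m)" using s3(6) by blast
      then show "r x = \<zero>\<^bsub>Q'\<^esub>" using s1(5) lin_closed[OF s0(1)] by simp
    qed
    show "\<forall>z\<in>carrier I. r z = \<zero>\<^bsub>Q'\<^esub> \<longrightarrow> (\<exists>x\<in>carrier E. s z = s (j x))" using s1(6) by blast
  qed
  then show ?thesis using Q sQ by blast
qed

end

section \<open>The cotorsion pair\<close>

locale cotorsion_category = module_category R U
  for R :: "('r, 's) ring_scheme" and U :: "'m set set" +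
  fixes \<A> \<B> :: "('r, 'm) module set"
  assumes cotorsion: "cotorsion_pair R U \<A> \<B>"
    and complete: "complete_pair R U \<A> \<B>"
    and hereditary: "hereditary_pair R U \<A> \<B>"
begin

lemma B_eq: "\<B> = {D \<in> LM. \<forall>A\<in>\<A>. trivial_group (Ext R U 1 A D)}"
  using cotorsion unfolding cotorsion_pair_def by (rule conjunct1)

lemma A_eq: "\<A> = {D \<in> LM. \<forall>B\<in>\<B>. trivial_group (Ext R U 1 D B)}"
  using cotorsion unfolding cotorsion_pair_def by (rule conjunct2)

lemma A_LM: "M \<in> \<A> \<Longrightarrow> M \<in> LM"
  by (subst (asm) A_eq) simp

lemma B_LM: "M \<in> \<B> \<Longrightarrow> M \<in> LM"
  by (subst (asm) B_eq) simp

lemma A_iff: "M \<in> \<A> \<longleftrightarrow> M \<in> LM \<and> (\<forall>H\<in>\<B>. ext_vanish M H)"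
  by (subst A_eq) (auto simp: Ext_1_iff B_LM simp del: One_nat_def)

lemma B_iff: "H \<in> \<B> \<longleftrightarrow> H \<in> LM \<and> (\<forall>M\<in>\<A>. ext_vanish M H)"
  by (subst B_eq) (auto simp: Ext_1_iff A_LM simp del: One_nat_def)

lemma A_extension:
  assumes "M' \<in> \<A>" "M'' \<in> \<A>" "M \<in> LM" "short_exact R M' i M p M''"
  shows "M \<in> \<A>"
  unfolding A_iff
proof (intro conjI ballI assms(3))
  fix H assume "H \<in> \<B>"
  then have "ext_vanish M' H" "ext_vanish M'' H" using assms(1,2) A_iff by auto
  then show "ext_vanish M H"
    by (rule ext_vanish_extension[OF A_LM[OF assms(1)] assms(3) A_LM[OF assms(2)] assms(4)])
qed

text \<open>\<A> is a set of records, so invariance under isomorphism has to be derived from its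
  description by Ext. It is applied to cycles of sums of discs, which are only isomorphic to the
  given modules.\<close>

lemma A_iso:
  assumes "M \<in> \<A>" "M' \<in> LM" "lin R M M' h" "bij_betw h (carrier M) (carrier M')"
  shows "M' \<in> \<A>"
  using assms ext_vanish_iso[OF A_LM[OF assms(1)] assms(2-4)] by (simp add: A_iff)

lemma projective_A: "projective R U P \<Longrightarrow> P \<in> \<A>"
  unfolding A_iff using projective_LM ext_vanish_projective B_LM by blast

lemma zero_A: "M \<in> LM \<Longrightarrow> carrier M = {\<zero>\<^bsub>M\<^esub>} \<Longrightarrow> M \<in> \<A>"
  by (rule projective_A[OF projective_zero])

lemma zero_B: "M \<in> LM \<Longrightarrow> carrier M = {\<zero>\<^bsub>M\<^esub>} \<Longrightarrow> M \<in> \<B>"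
  unfolding B_iff using ext_vanish_zero by blast

lemma zero_mod_A: "M \<in> LM \<Longrightarrow> zero_mod M \<in> \<A>"
  by (rule zero_A[OF zero_LM]) simp_all

lemma zero_mod_B: "M \<in> LM \<Longrightarrow> zero_mod M \<in> \<B>"
  by (rule zero_B[OF zero_LM]) simp_all

lemma dsum_A: "M \<in> \<A> \<Longrightarrow> N \<in> \<A> \<Longrightarrow> dsum M N \<in> \<A>"
  by (rule A_extension[OF _ _ dsum_LM[OF A_LM A_LM] short_exact_dsum[OF A_LM A_LM]])

text \<open>Heredity: Ext^2(M, H) vanishes for H in \<B>, which puts the first syzygy in
  \<A>.\<close>

lemma A_projective_cover:
  assumes "M \<in> \<A>"
  shows "\<exists>P \<pi>. projective R U P \<and> lin R P M \<pi> \<and> \<pi> ` carrier P = carrier M \<and> ker_mod P M \<pi> \<in> \<A>"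
proof -
  have M: "M \<in> LM" by (rule A_LM[OF assms])
  obtain P \<pi> where P: "projective R U P" "lin R P M \<pi>" "\<pi> ` carrier P = carrier M"
    and van: "\<forall>H\<in>LM. trivial_group (Ext R U 2 M H) \<longrightarrow> ext_vanish (ker_mod P M \<pi>) H"
    using Ext_2_syzygy[OF M] by blast
  have "\<forall>H\<in>\<B>. trivial_group (Ext R U 2 M H)"
    using hereditary assms unfolding hereditary_pair_def by simp
  then have "ker_mod P M \<pi> \<in> \<A>"
    unfolding A_iff using van B_LM ker_LM[OF projective_LM[OF P(1)] M P(2)] by blast
  then show ?thesis using P by blast
qed

text \<open>Completeness embeds M into a module of \<B> with cokernel in \<A>. That module is an
  extension of two modules in \<A>, hence lies in \<A> as well.\<close>

lemma A_hull:
  assumes "M \<in> \<A>"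
  shows "\<exists>I f Q q. I \<in> \<A> \<inter> \<B> \<and> Q \<in> \<A> \<and> short_exact R M f I q Q"
proof -
  obtain I Q f q where I: "I \<in> \<B>" "Q \<in> \<A>" "short_exact R M f I q Q"
    using complete A_LM[OF assms] unfolding complete_pair_def by blast
  then have "I \<in> \<A>" using A_extension[OF assms I(2) B_LM[OF I(1)] I(3)] by blast
  then show ?thesis using I by blast
qed

section \<open>Gorenstein modules and their extension closure\<close>

abbreviation "\<G> \<equiv> gorenstein_modules R U \<A> \<B>"

lemma G_LM: "M \<in> \<G> \<Longrightarrow> M \<in> LM"
  by (simp add: gorenstein_modules_def)

lemma hom_into_exact_iff:
  assumes "T \<in> complexes R U" "H \<in> LM"
  shows "hom_into_exact R T H \<longleftrightarrow>
    (\<forall>n h. lin R (obj T n) H h \<and> (\<forall>x\<in>carrier (obj T (n + 1)). h (diff T (n + 1) x) = \<zero>\<^bsub>H\<^esub>) \<longrightarrow>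
      (\<exists>g. lin R (obj T (n - 1)) H g \<and> (\<forall>x\<in>carrier (obj T n). g (diff T n x) = h x)))"
  unfolding hom_into_exact_def hom_exact_at_iff[OF assms(1) LM_left_module[OF assms(2)]] by simp

text \<open>Shifting the resolving sequence by \<open>k\<close> moves any of its images to the
  position that the definition singles out.\<close>

lemma gorenstein_image:
  assumes T: "T \<in> complexes R U" and A: "\<forall>i. obj T i \<in> \<A>" and ex: "exact_cpx T"
    and hom: "\<forall>H\<in>\<A> \<inter> \<B>. hom_into_exact R T H"
  shows "im_module (diff T k) (obj T k) (obj T (k - 1)) \<in> \<G>"
proof -
  note c = complexesD[OF T]
  let ?I = "im_module (diff T k) (obj T k) (obj T (k - 1))"
  define T' :: "('r, 'm) chain_cpx" where "T' = \<lparr>obj = (\<lambda>n. obj T (n + k)), diff = (\<lambda>n. diff T (n + k))\<rparr>"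
  have o: "obj T' n = obj T (n + k)" and d: "diff T' n = diff T (n + k)" for n by (simp_all add: T'_def)
  have e: "n - 1 + k = n + k - 1" "n - 2 + k = n + k - 2" "n + 1 + k = n + k + 1" for n by simp_all
  have T': "T' \<in> complexes R U"
    by (rule complexesI) (unfold o d e, (rule c; assumption?)+)
  have "hom_into_exact R T' H" if H: "H \<in> \<A> \<inter> \<B>" for H
  proof -
    have HL: "H \<in> LM" using H A_LM by blast
    have "hom_into_exact R T H" using hom H by blast
    then show ?thesis
      unfolding hom_into_exact_iff[OF T HL] hom_into_exact_iff[OF T' HL] o d e by blast
  qed
  moreover have "exact_cpx T'" using ex unfolding exact_cpx_def o d e by blast
  moreover have "im_module (diff T' 0) (obj T' 0) (obj T' (-1)) = ?I"
    by (simp add: o d)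
  moreover have "mod_iso R ?I ?I"
    unfolding mod_iso_def by (rule bexI[of _ "\<lambda>x. x"]) (simp_all add: mod_hom_iff lin_id bij_betw_def)
  moreover have "?I \<in> LM"
    unfolding im_module_def
    by (rule LM_subset[OF left_module_image[OF LM_left_module[OF c(1)] LM_left_module[OF c(1)] c(2)] _ c(1)])
      (use lin_closed[OF c(2)] in auto)
  moreover have "\<forall>i. obj T' i \<in> \<A>" using A by (simp add: o)
  ultimately show ?thesis using T' unfolding gorenstein_modules_def by auto
qed

text \<open>All that is kept of a resolving sequence: one step to the left, where Hom-exactness
  extends maps from the kernel into \<A> \<inter> \<B>, and one step to the right. The right step
  records no extension property, since its cokernel is Gorenstein and
  \<open>ext_closure_ext_vanish\<close> will supply one.\<close>

lemma gorenstein_steps: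
  assumes M: "M \<in> \<G>"
  shows "\<exists>E p. E \<in> \<A> \<and> lin R E M p \<and> p ` carrier E = carrier M \<and> ker_mod E M p \<in> \<G> \<and>
      (\<forall>H\<in>\<A> \<inter> \<B>. \<forall>v. lin R (ker_mod E M p) H v \<longrightarrow>
        (\<exists>w. lin R E H w \<and> (\<forall>x\<in>carrier (ker_mod E M p). w x = v x)))"
      (is "?left")
    and "\<exists>E N f q. E \<in> \<A> \<and> N \<in> \<G> \<and> short_exact R M f E q N" (is "?right")
proof -
  from M obtain T where T: "T \<in> complexes R U" "\<forall>i. obj T i \<in> \<A>" "exact_cpx T"
    "\<forall>H\<in>\<A> \<inter> \<B>. hom_into_exact R T H"
    and iso: "mod_iso R M (im_module (diff T 0) (obj T 0) (obj T (-1)))"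
    by (auto simp: gorenstein_modules_def)
  note c = complexesD[OF T(1)]
  note G = gorenstein_image[OF T]
  let ?I = "im_module (diff T 0) (obj T 0) (obj T (-1))"
  from iso obtain h where h: "lin R M ?I h" "bij_betw h (carrier M) (carrier ?I)"
    by (auto simp: mod_iso_def mod_hom_iff)
  have M_LM: "M \<in> LM" by (rule G_LM[OF M])
  have carI: "carrier ?I = diff T 0 ` carrier (obj T 0)" and zI: "\<zero>\<^bsub>?I\<^esub> = \<zero>\<^bsub>obj T (-1)\<^esub>"
    by (simp_all add: im_module_def)
  have d0: "lin R (obj T 0) (obj T (-1)) (diff T 0)" using c(2)[of 0] by simp
  have d1: "lin R (obj T 1) (obj T 0) (diff T 1)" using c(2)[of 1] by simp
  have dm: "lin R (obj T (-1)) (obj T (-2)) (diff T (-1))" using c(2)[of "-1"] by simp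
  have ex: "diff T (n + 1) ` carrier (obj T (n + 1)) = {x \<in> carrier (obj T n). diff T n x = \<zero>\<^bsub>obj T (n - 1)\<^esub>}" for n
    using T(3) by (simp add: exact_cpx_def exact_at_def a_kernel_def')
  have ex0: "diff T 1 ` carrier (obj T 1) = {x \<in> carrier (obj T 0). diff T 0 x = \<zero>\<^bsub>obj T (-1)\<^esub>}"
    using ex[of 0] by simp
  have exm: "diff T 0 ` carrier (obj T 0) = {x \<in> carrier (obj T (-1)). diff T (-1) x = \<zero>\<^bsub>obj T (-2)\<^esub>}"
    using ex[of "-1"] by simp
  have I: "?I \<in> LM" using G_LM[OF G[of 0]] by simp
  have inj: "inj_on h (carrier M)" and surj: "h ` carrier M = carrier ?I"
    using h(2) by (auto simp: bij_betw_def)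
  note mM = LM_left_module[OF M_LM] and mI = LM_left_module[OF I]
  have h0: "h \<zero>\<^bsub>M\<^esub> = \<zero>\<^bsub>obj T (-1)\<^esub>" using lin_zero[OF h(1) mM mI] zI by simp
  have d0I: "lin R (obj T 0) ?I (diff T 0)"
    unfolding im_module_def by (rule lin_into[OF d0]) simp
  have "diff T 0 ` carrier (obj T 0) \<subseteq> h ` carrier M" unfolding surj carI by simp
  then obtain p where p: "lin R (obj T 0) M p" "\<forall>x\<in>carrier (obj T 0). h (p x) = diff T 0 x"
    using lin_lift_mono[OF h(1) inj d0I mM LM_left_module[OF c(1)]] by blast
  have p0: "p x = \<zero>\<^bsub>M\<^esub> \<longleftrightarrow> diff T 0 x = \<zero>\<^bsub>obj T (-1)\<^esub>" if x: "x \<in> carrier (obj T 0)" for x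
    using inj_onD[OF inj, of "p x" "\<zero>\<^bsub>M\<^esub>"] p(2) x h0 lin_closed[OF p(1) x] lin_zero_mem[OF mM] by auto
  have ps: "p ` carrier (obj T 0) = carrier M"
  proof (rule lin_surjI[OF p(1)])
    fix m assume m: "m \<in> carrier M"
    have "h m \<in> diff T 0 ` carrier (obj T 0)" using lin_closed[OF h(1) m] unfolding carI .
    then obtain x where x: "x \<in> carrier (obj T 0)" "h m = diff T 0 x" by blast
    have "m = p x" by (rule inj_onD[OF inj]) (use p(2) x m lin_closed[OF p(1)] in auto)
    then show "m \<in> p ` carrier (obj T 0)" using x(1) by blast
  qed
  have kerp: "a_kernel (obj T 0) M p = diff T 1 ` carrier (obj T 1)"
    unfolding ex0 using p0 by (auto simp: a_kernel_def')
  let ?K = "ker_mod (obj T 0) M p"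
  have d1K: "lin R (obj T 1) ?K (diff T 1)" by (rule lin_into[OF d1]) (simp add: kerp)
  have K: "?K \<in> \<G>" using G[of 1] unfolding kerp by (simp add: im_module_def)
  have "\<exists>w. lin R (obj T 0) H w \<and> (\<forall>x\<in>carrier ?K. w x = v x)"
    if H: "H \<in> \<A> \<inter> \<B>" and v: "lin R ?K H v" for H v
  proof -
    have HL: "H \<in> LM" using H A_LM by blast
    have "\<forall>n h. lin R (obj T n) H h \<and> (\<forall>x\<in>carrier (obj T (n + 1)). h (diff T (n + 1) x) = \<zero>\<^bsub>H\<^esub>) \<longrightarrow>
      (\<exists>g. lin R (obj T (n - 1)) H g \<and> (\<forall>x\<in>carrier (obj T n). g (diff T n x) = h x))"
      using T(4) H hom_into_exact_iff[OF T(1) HL] by blast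
    \<comment> \<open>A map \<open>v\<close> on the image of the degree-one term becomes a cocycle
      after composition with the differential. Writing it as a coboundary extends \<open>v\<close>
      to the degree-zero term.\<close>
    from this[rule_format, of 1 "\<lambda>x. v (diff T 1 x)"]
    have "lin R (obj T 1) H (\<lambda>x. v (diff T 1 x)) \<and> (\<forall>x\<in>carrier (obj T 2). v (diff T 1 (diff T 2 x)) = \<zero>\<^bsub>H\<^esub>) \<Longrightarrow>
      \<exists>g. lin R (obj T 0) H g \<and> (\<forall>x\<in>carrier (obj T 1). g (diff T 1 x) = v (diff T 1 x))"
      by simp
    moreover have "v (diff T 1 (diff T 2 x)) = \<zero>\<^bsub>H\<^esub>" if x: "x \<in> carrier (obj T 2)" for x
      using c(3)[OF x] lin_zero[OF v LM_left_module[OF G_LM[OF K]] LM_left_module[OF HL]] by simp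
    ultimately obtain w where w: "lin R (obj T 0) H w" "\<forall>x\<in>carrier (obj T 1). w (diff T 1 x) = v (diff T 1 x)"
      using lin_comp[OF d1K v] by blast
    show "\<exists>w. lin R (obj T 0) H w \<and> (\<forall>x\<in>carrier ?K. w x = v x)"
      by (rule exI[of _ w]) (use w in \<open>simp add: kerp\<close>)
  qed
  then show ?left using T(2) p(1) ps K by blast
  let ?N = "im_module (diff T (-1)) (obj T (-1)) (obj T (-2))"
  have "short_exact R M h (obj T (-1)) (diff T (-1)) ?N"
  proof (rule short_exactI)
    show "lin R M (obj T (-1)) h"
      by (rule lin_out[OF h(1)[unfolded im_module_def]]) (use lin_closed[OF d0] in auto)
    show "lin R (obj T (-1)) ?N (diff T (-1))" unfolding im_module_def by (rule lin_into[OF dm]) simp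
    have im: "h ` carrier M = {x \<in> carrier (obj T (-1)). diff T (-1) x = \<zero>\<^bsub>obj T (-2)\<^esub>}"
      unfolding surj carI exm ..
    show "\<forall>x\<in>carrier M. diff T (-1) (h x) = \<zero>\<^bsub>?N\<^esub>" using im by (auto simp: im_module_def)
    show "\<forall>y\<in>carrier (obj T (-1)). diff T (-1) y = \<zero>\<^bsub>?N\<^esub> \<longrightarrow> y \<in> h ` carrier M"
      unfolding im by (simp add: im_module_def)
    show "diff T (-1) ` carrier (obj T (-1)) = carrier ?N" by (simp add: im_module_def)
  qed (rule inj)
  moreover have "?N \<in> \<G>" using G[of "-1"] by simp
  ultimately show ?right using T(2) by blast
qed

text \<open>
  The class generated by \<open>\<A>\<close> and the Gorenstein modules under extensions. It replaces a proof that the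
  Gorenstein modules themselves are closed under extensions.
\<close>

inductive_set ext_closure :: "('r, 'm) module set" where
  from_A: "M \<in> \<A> \<Longrightarrow> M \<in> ext_closure"
| from_G: "M \<in> \<G> \<Longrightarrow> M \<in> ext_closure"
| extension: "\<lbrakk>M' \<in> ext_closure; M'' \<in> ext_closure; M \<in> LM; short_exact R M' i M p M''\<rbrakk> \<Longrightarrow> M \<in> ext_closure"

lemma ext_closure_LM: "M \<in> ext_closure \<Longrightarrow> M \<in> LM"
  by (induction rule: ext_closure.induct) (auto dest: A_LM G_LM)

text \<open>For Gorenstein M the left step presents M with kernel K, where E lies in \<A> and maps K
  -> H extend to E; \<open>ext_vanish_syzygy\<close> then applies. Any short exact sequence with
  right end in the closure is therefore Hom-exact against \<A> \<inter> \<B>, so Hom-exactness need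
  not be carried along when resolutions are built.\<close>

lemma ext_closure_ext_vanish:
  assumes "M \<in> ext_closure" and H: "H \<in> \<A> \<inter> \<B>"
  shows "ext_vanish M H"
  using assms(1)
proof (induction rule: ext_closure.induct)
  case (from_A M)
  then show ?case using A_iff H by blast
next
  case (from_G M)
  obtain E p where E: "E \<in> \<A>" "lin R E M p" "p ` carrier E = carrier M" "ker_mod E M p \<in> \<G>"
    "\<forall>v. lin R (ker_mod E M p) H v \<longrightarrow> (\<exists>w. lin R E H w \<and> (\<forall>x\<in>carrier (ker_mod E M p). w x = v x))"
    using gorenstein_steps(1)[OF from_G] H by blast
  have van: "ext_vanish E H" using E(1) A_iff H by blast
  have HL: "H \<in> LM" using H A_LM by blast
  show ?case
  proof (rule ext_vanish_syzygy[OF G_LM[OF E(4)] A_LM[OF E(1)] G_LM[OF from_G] HL short_exact_ker[OF E(2,3)] van])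
    fix v assume "lin R (ker_mod E M p) H v"
    then show "\<exists>w. lin R E H w \<and> (\<forall>x\<in>carrier (ker_mod E M p). w x = v x)" by (rule E(5)[rule_format])
  qed
next
  case (extension M' M'' M i p)
  show ?case
    by (rule ext_vanish_extension[OF ext_closure_LM[OF extension.hyps(1)] extension.hyps(3)
          ext_closure_LM[OF extension.hyps(2)] extension.hyps(4) extension.IH])
qed

text \<open>For Gorenstein M a projective cover of the module E above M is composed with E -> M; the
  new kernel is an extension of the two old ones. For an extension, the cover of the quotient lifts
  to M by projectivity, and the horseshoe applies.\<close>

lemma ext_closure_cover:
  assumes "M \<in> ext_closure"
  shows "\<exists>P \<pi>. projective R U P \<and> lin R P M \<pi> \<and> \<pi> ` carrier P = carrier M \<and> ker_mod P M \<pi> \<in> ext_closure"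
  using assms
proof (induction rule: ext_closure.induct)
  case (from_A M)
  show ?case using A_projective_cover[OF from_A] ext_closure.from_A by blast
next
  case (from_G M)
  obtain E p where E: "E \<in> \<A>" "lin R E M p" "p ` carrier E = carrier M" "ker_mod E M p \<in> \<G>"
    using gorenstein_steps(1)[OF from_G] by blast
  obtain P \<pi> where P: "projective R U P" "lin R P E \<pi>" "\<pi> ` carrier P = carrier E" "ker_mod P E \<pi> \<in> \<A>"
    using A_projective_cover[OF E(1)] by blast
  have LM: "P \<in> LM" "E \<in> LM" "M \<in> LM"
    using projective_LM[OF P(1)] A_LM[OF E(1)] G_LM[OF from_G] by auto
  let ?c = "\<lambda>x. p (\<pi> x)"
  have c: "lin R P M ?c" by (rule lin_comp[OF P(2) E(2)])
  have s: "?c ` carrier P = carrier M" using P(3) E(3) by (simp add: image_image[symmetric])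
  have "ker_mod P M ?c \<in> ext_closure"
    by (rule ext_closure.extension[OF ext_closure.from_A[OF P(4)] ext_closure.from_G[OF E(4)]
          ker_LM[OF LM(1,3) c] short_exact_ker_comp[OF LM P(2,3) E(2)]])
  then show ?case using P(1) c s by blast
next
  case (extension M' M'' M i p)
  note s = short_exactD[OF extension.hyps(4)]
  obtain P' a where P': "projective R U P'" "lin R P' M' a" "a ` carrier P' = carrier M'" "ker_mod P' M' a \<in> ext_closure"
    using extension.IH(1) by blast
  obtain P'' a'' where P'': "projective R U P''" "lin R P'' M'' a''" "a'' ` carrier P'' = carrier M''"
    "ker_mod P'' M'' a'' \<in> ext_closure"
    using extension.IH(2) by blast
  have LM: "M' \<in> LM" "M \<in> LM" "M'' \<in> LM" "P' \<in> LM" "P'' \<in> LM"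
    using extension.hyps ext_closure_LM projective_LM P'(1) P''(1) by auto
  obtain b where b: "lin R P'' M b" "\<forall>x\<in>carrier P''. p (b x) = a'' x"
    using projectiveD[OF P''(1) LM(2,3) s(2) P''(2) s(7)] by blast
  have bs: "(\<lambda>x. p (b x)) ` carrier P'' = carrier M''"
    using b(2) P''(3) by (simp add: image_def)
  \<comment> \<open>\<open>p\<close> after \<open>b\<close> equals \<open>a''\<close> only on the
    carrier, which is enough to make the two kernel records equal.\<close>
  have kb: "ker_mod P'' M'' (\<lambda>x. p (b x)) = ker_mod P'' M'' a''"
    using b(2) by (auto simp: a_kernel_def' intro!: arg_cong[where f="\<lambda>S. P''\<lparr>carrier := S\<rparr>"])
  let ?c = "\<lambda>z. i (a (dfst P' P'' z)) \<oplus>\<^bsub>M\<^esub> b (dsnd P' P'' z)"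
  note hs = horseshoe_kernel[OF LM extension.hyps(4) P'(2,3) b(1) bs]
  have D: "dsum P' P'' \<in> LM" by (rule dsum_LM[OF LM(4,5)])
  \<comment> \<open>A map out of the sum is lifted on each summand separately.\<close>
  have "projective R U (dsum P' P'')"
    unfolding projective_def
  proof (intro conjI D ballI impI)
    fix X Y g f
    assume X: "X \<in> LM" and Y: "Y \<in> LM" and "g \<in> mod_hom R X Y" "f \<in> mod_hom R (dsum P' P'') Y"
      and gs: "g ` carrier X = carrier Y"
    then have g: "lin R X Y g" and f: "lin R (dsum P' P'') Y f" by (simp_all add: mod_hom_iff)
    note XX = LM(4,5)
    interpret P': left_module R P' using LM by auto
    interpret P'': left_module R P'' using LM by auto
    interpret X: left_module R X using X by auto
    have j': "lin R P' (dsum P' P'') (\<lambda>x. dpair P' P'' x \<zero>\<^bsub>P''\<^esub>)"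
      and j'': "lin R P'' (dsum P' P'') (\<lambda>x. dpair P' P'' \<zero>\<^bsub>P'\<^esub> x)"
      by (intro lin_dpair[OF XX] lin_id lin_const_zero P'.left_module_axioms P''.left_module_axioms)+
    obtain k' where k': "lin R P' X k'" "\<forall>x\<in>carrier P'. g (k' x) = f (dpair P' P'' x \<zero>\<^bsub>P''\<^esub>)"
      using projectiveD[OF P'(1) X Y g lin_comp[OF j' f] gs] by blast
    obtain k'' where k'': "lin R P'' X k''" "\<forall>x\<in>carrier P''. g (k'' x) = f (dpair P' P'' \<zero>\<^bsub>P'\<^esub> x)"
      using projectiveD[OF P''(1) X Y g lin_comp[OF j'' f] gs] by blast
    let ?k = "\<lambda>z. k' (dfst P' P'' z) \<oplus>\<^bsub>X\<^esub> k'' (dsnd P' P'' z)"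
    have k: "lin R (dsum P' P'') X ?k"
      by (intro lin_plus lin_comp[OF lin_dfst[OF XX] k'(1)] lin_comp[OF lin_dsnd[OF XX] k''(1)] X.left_module_axioms)
    have "g (?k z) = f z" if z: "z \<in> carrier (dsum P' P'')" for z
    proof (rule dsum_cases[OF XX z])
      fix x y assume xy: "x \<in> carrier P'" "y \<in> carrier P''" "z = dpair P' P'' x y"
      have "f z = f (dpair P' P'' x \<zero>\<^bsub>P''\<^esub> \<oplus>\<^bsub>dsum P' P''\<^esub> dpair P' P'' \<zero>\<^bsub>P'\<^esub> y)"
        using xy by (simp add: dpair_add[OF XX])
      also have "\<dots> = g (k' x) \<oplus>\<^bsub>Y\<^esub> g (k'' y)"
        using xy k'(2) k''(2) by (simp add: lin_add[OF f] dpair_closed[OF XX])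
      also have "\<dots> = g (?k z)"
        using xy lin_closed[OF k'(1)] lin_closed[OF k''(1)]
        by (simp add: lin_add[OF g] dfst_dpair[OF XX] dsnd_dpair[OF XX])
      finally show "g (?k z) = f z" by simp
    qed
    then show "\<exists>h\<in>mod_hom R (dsum P' P'') X. \<forall>p\<in>carrier (dsum P' P''). g (h p) = f p"
      using k by (intro bexI[of _ ?k]) (simp_all add: mod_hom_iff)
  qed
  moreover have "ker_mod (dsum P' P'') M ?c \<in> ext_closure"
    by (rule ext_closure.extension[OF P'(4) _ ker_LM[OF D LM(2) hs(1)] hs(3)]) (simp only: kb P''(4))
  ultimately show ?case using hs(1,2) by blast
qed

lemma B_dsum:
  assumes "M \<in> \<B>" "N \<in> \<B>"
  shows "dsum M N \<in> \<B>"
  unfolding B_iff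
proof (intro conjI ballI ext_vanishI)
  have MN: "M \<in> LM" "N \<in> LM" using assms B_LM by auto
  show "dsum M N \<in> LM" by (rule dsum_LM[OF MN])
  fix A X Y f g u
  assume A: "A \<in> \<A>" and X: "X \<in> LM" and Y: "Y \<in> LM" and se: "short_exact R X f Y g A"
    and u: "lin R X (dsum M N) u"
  have van: "ext_vanish A M" "ext_vanish A N" using A assms B_iff by auto
  obtain v where v: "lin R Y M v" "\<forall>x\<in>carrier X. v (f x) = dfst M N (u x)"
    using ext_vanishD[OF van(1) X Y se lin_comp[OF u lin_dfst[OF MN]]] by blast
  obtain w where w: "lin R Y N w" "\<forall>x\<in>carrier X. w (f x) = dsnd M N (u x)"
    using ext_vanishD[OF van(2) X Y se lin_comp[OF u lin_dsnd[OF MN]]] by blast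
  show "\<exists>w. lin R Y (dsum M N) w \<and> (\<forall>x\<in>carrier X. w (f x) = u x)"
    by (rule exI[of _ "\<lambda>y. dpair M N (v y) (w y)"])
      (simp add: lin_dpair[OF MN v(1) w(1)] v(2) w(2) dpair_collapse[OF MN] lin_closed[OF u])
qed

text \<open>Dual to the cover. For Gorenstein M the module E to its right is embedded by
  \<open>A_hull\<close>, and the cokernel of the composite is an extension of the two
  cokernels.\<close>

lemma ext_closure_hull:
  assumes "M \<in> ext_closure"
  shows "\<exists>I f Q q. I \<in> \<A> \<inter> \<B> \<and> Q \<in> ext_closure \<and> short_exact R M f I q Q"
  using assms
proof (induction rule: ext_closure.induct)
  case (from_A M)
  show ?case using A_hull[OF from_A] ext_closure.from_A by blast
next
  case (from_G M)
  obtain E N f q where E: "E \<in> \<A>" "N \<in> \<G>" "short_exact R M f E q N"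
    using gorenstein_steps(2)[OF from_G] by blast
  obtain I j Q' r where I: "I \<in> \<A> \<inter> \<B>" "Q' \<in> \<A>" "short_exact R E j I r Q'"
    using A_hull[OF E(1)] by blast
  have LM: "M \<in> LM" "E \<in> LM" "N \<in> LM" "I \<in> LM" "Q' \<in> LM"
    using from_G E I G_LM A_LM by auto
  obtain Q s a b where Q: "Q \<in> LM" "short_exact R M (\<lambda>x. j (f x)) I s Q" "short_exact R N a Q b Q'"
    using short_exact_coker_comp[OF LM E(3) I(3)] by blast
  have "Q \<in> ext_closure"
    by (rule ext_closure.extension[OF ext_closure.from_G[OF E(2)] ext_closure.from_A[OF I(2)] Q(1,3)])
  then show ?case using I(1) Q(2) by blast
next
  case (extension M' M'' M i p)
  obtain I' f' Q' q' where I': "I' \<in> \<A> \<inter> \<B>" "Q' \<in> ext_closure" "short_exact R M' f' I' q' Q'"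
    using extension.IH(1) by blast
  obtain I'' f'' Q'' q'' where I'': "I'' \<in> \<A> \<inter> \<B>" "Q'' \<in> ext_closure" "short_exact R M'' f'' I'' q'' Q''"
    using extension.IH(2) by blast
  have LM: "M' \<in> LM" "M \<in> LM" "M'' \<in> LM" "I' \<in> LM" "I'' \<in> LM" "Q' \<in> LM" "Q'' \<in> LM"
    using extension.hyps ext_closure_LM A_LM I' I'' by auto
  note s' = short_exactD[OF I'(3)]
  \<comment> \<open>I' need not be injective, but Ext^1(M'', I') = 0 because M'' is in the closure
    and I' in \<A> \<inter> \<B>. That suffices to extend the embedding of M' to M.\<close>
  obtain t where t: "lin R M I' t" "\<forall>x\<in>carrier M'. t (i x) = f' x"
    using ext_vanishD[OF ext_closure_ext_vanish[OF extension.hyps(2) I'(1)] LM(1,2) extension.hyps(4) s'(1)]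
    by blast
  have ti: "lin R M' I' (\<lambda>x. t (i x))"
    by (rule lin_comp[OF short_exactD(1)[OF extension.hyps(4)] t(1)])
  have "short_exact R M' (\<lambda>x. t (i x)) I' q' Q'"
  proof (rule short_exactI[OF ti s'(2)])
    have "inj_on (\<lambda>x. t (i x)) (carrier M') = inj_on f' (carrier M')"
      by (rule inj_on_cong) (simp add: t(2))
    then show "inj_on (\<lambda>x. t (i x)) (carrier M')" using s'(3) by simp
    show "\<forall>x\<in>carrier M'. q' (t (i x)) = \<zero>\<^bsub>Q'\<^esub>" using t(2) s'(5) by simp
    have "(\<lambda>x. t (i x)) ` carrier M' = f' ` carrier M'" by (rule image_cong) (simp_all add: t(2))
    then show "\<forall>y\<in>carrier I'. q' y = \<zero>\<^bsub>Q'\<^esub> \<longrightarrow> y \<in> (\<lambda>x. t (i x)) ` carrier M'" using s'(4) by simp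
    show "q' ` carrier I' = carrier Q'" by (rule s'(7))
  qed
  from horseshoe_cokernel[OF LM extension.hyps(4) t(1) this I''(3)]
  obtain Q s a b where Q: "Q \<in> LM" "short_exact R M (\<lambda>m. dpair I' I'' (t m) (f'' (p m))) (dsum I' I'') s Q"
    "short_exact R Q' a Q b Q''" by blast
  have "Q \<in> ext_closure" by (rule ext_closure.extension[OF I'(2) I''(2) Q(1,3)])
  moreover have "dsum I' I'' \<in> \<A> \<inter> \<B>" using dsum_A B_dsum I'(1) I''(1) by blast
  ultimately show ?case using Q(2) by blast
qed

end

section \<open>Complexes\<close>

lemma chain_mapsD:
  assumes "f \<in> chain_maps R C D"
  shows "lin R (obj C n) (obj D n) (f n)"
    "x \<in> carrier (obj C n) \<Longrightarrow> f (n - 1) (diff C n x) = diff D n (f n x)"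
  using assms by (auto simp: chain_maps_def mod_hom_iff)

lemma chain_mapsI:
  assumes "\<And>n. lin R (obj C n) (obj D n) (f n)"
    "\<And>n x. x \<in> carrier (obj C n) \<Longrightarrow> f (n - 1) (diff C n x) = diff D n (f n x)"
  shows "f \<in> chain_maps R C D"
  using assms by (simp add: chain_maps_def mod_hom_iff)

section \<open>Contractible complexes\<close>

definition contraction ::
    "('r, 's) ring_scheme \<Rightarrow> ('r, 'm) chain_cpx \<Rightarrow> (int \<Rightarrow> 'm \<Rightarrow> 'm) \<Rightarrow> bool" where
  "contraction R C s \<longleftrightarrow> (\<forall>n. lin R (obj C n) (obj C (n + 1)) (s n) \<and>
     (\<forall>x\<in>carrier (obj C n). diff C (n + 1) (s n x) \<oplus>\<^bsub>obj C n\<^esub> s (n - 1) (diff C n x) = x))"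

context module_category
begin

text \<open>The identity is a cycle of degree 0 in the Hom-complex. A preimage in degree 1 is a
  contraction: the differential carries a plus sign in odd degrees.\<close>

lemma contraction_exists:
  assumes H: "H \<in> complexes R U" and ex: "hom_cpx_exact R H H"
  shows "\<exists>s. contraction R H s"
proof -
  note c = complexesD[OF H]
  \<comment> \<open>The identity, restricted so that it belongs to the extensional Hom
    groups.\<close>
  define j where "j = (\<lambda>i. \<lambda>x\<in>carrier (obj H i). x)"
  have jl: "lin R (obj H i) (obj H i) (j i)" for i
    by (rule lin_cong[OF lin_id LM_left_module[OF c(1)]]) (simp add: j_def)
  have "j \<in> carrier (hom_cpx_obj R H H 0)"
    using jl by (simp add: hom_cpx_obj_def hom_group_def mod_hom_iff) (simp add: j_def)
  moreover have "hom_cpx_diff H H 0 j = \<zero>\<^bsub>hom_cpx_obj R H H (-1)\<^esub>"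
  proof (intro ext)
    fix i x
    interpret L: left_module R "obj H (i - 1)" using c(1) by auto
    show "hom_cpx_diff H H 0 j i x = \<zero>\<^bsub>hom_cpx_obj R H H (-1)\<^esub> i x"
      using lin_closed[OF c(2)[of i], of x]
      by (simp add: hom_cpx_diff_def hom_cpx_obj_def hom_group_def j_def restrict_def)
  qed
  ultimately have "j \<in> a_kernel (hom_cpx_obj R H H 0) (hom_cpx_obj R H H (-1)) (hom_cpx_diff H H 0)"
    by (simp add: a_kernel_def')
  moreover have "hom_cpx_diff H H 1 ` carrier (hom_cpx_obj R H H 1) =
      a_kernel (hom_cpx_obj R H H 0) (hom_cpx_obj R H H (-1)) (hom_cpx_diff H H 0)"
    using ex[unfolded hom_cpx_exact_def exact_at_def, rule_format, of 0] by simp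
  ultimately obtain s where s: "s \<in> carrier (hom_cpx_obj R H H 1)" "j = hom_cpx_diff H H 1 s"
    by blast
  have "contraction R H s"
    unfolding contraction_def
  proof (intro allI conjI ballI)
    fix n
    show "lin R (obj H n) (obj H (n + 1)) (s n)"
      using s(1) by (simp add: hom_cpx_obj_def hom_group_def mod_hom_iff add.commute[of 1])
    fix x assume x: "x \<in> carrier (obj H n)"
    have "j n x = hom_cpx_diff H H 1 s n x" using s(2) by simp
    then show "diff H (n + 1) (s n x) \<oplus>\<^bsub>obj H n\<^esub> s (n - 1) (diff H n x) = x"
      using x by (simp add: j_def hom_cpx_diff_def add.commute)
  qed
  then show ?thesis by blast
qed

text \<open>A cycle f is the boundary of s after f: since f commutes with the differentials up to
  sign, that boundary is (ds + sd)f = f. As A is arbitrary, contractible complexes with terms in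
  \<B> satisfy the dg condition.\<close>

lemma contractible_hom_exact:
  assumes A: "A \<in> complexes R U" and D: "D \<in> complexes R U" and s: "contraction R D s"
  shows "hom_cpx_exact R A D"
  unfolding hom_cpx_exact_def exact_at_def
proof
  fix n :: int
  note cA = complexesD[OF A] and cD = complexesD[OF D]
  note mA = LM_left_module[OF cA(1)] and mD = LM_left_module[OF cD(1)]
  \<comment> \<open>Degrees occur inside dependent modules, so different forms of the same integer
    have to be matched by explicit rewriting.\<close>
  have e: "n + 1 + i - 1 = n + i" "n + 1 + (i - 1) = n + i" "n + (i - 1) = n + i - 1" "n - 1 + i = n + i - 1"
    "n + 1 + (i - 2) = n + i - 1" "n + i + 1 = n + 1 + i" "n + 1 + i - 2 = n + i - 1" for i :: int by simp_all
  have sl: "lin R (obj D k) (obj D (k + 1)) (s k)"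
    and sc: "x \<in> carrier (obj D k) \<Longrightarrow> diff D (k + 1) (s k x) \<oplus>\<^bsub>obj D k\<^esub> s (k - 1) (diff D k x) = x" for k x
    using s by (auto simp: contraction_def)
  let ?O = "hom_cpx_obj R A D" let ?d = "hom_cpx_diff A D"
  have mem: "f \<in> carrier (?O k) \<longleftrightarrow> (\<forall>i. lin R (obj A i) (obj D (k + i)) (f i) \<and> f i \<in> extensional (carrier (obj A i)))"
    for f k by (simp add: hom_cpx_obj_def hom_group_def mod_hom_iff)
  have zer: "\<zero>\<^bsub>?O (n - 1)\<^esub> = (\<lambda>i. \<lambda>x\<in>carrier (obj A i). \<zero>\<^bsub>obj D (n + i - 1)\<^esub>)"
    by (simp add: hom_cpx_obj_def hom_group_def e)
  have dA: "diff A i x \<in> carrier (obj A (i - 1))" if "x \<in> carrier (obj A i)" for i x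
    using lin_closed[OF cA(2) that] .
  show "?d (n + 1) ` carrier (?O (n + 1)) = a_kernel (?O n) (?O (n - 1)) (?d n)"
  proof
    show "?d (n + 1) ` carrier (?O (n + 1)) \<subseteq> a_kernel (?O n) (?O (n - 1)) (?d n)"
    proof (rule image_subsetI)
      fix f assume "f \<in> carrier (?O (n + 1))"
      then have fl: "lin R (obj A i) (obj D (n + 1 + i)) (f i)" for i unfolding mem by blast
      have fl': "lin R (obj A (i - 1)) (obj D (n + i)) (f (i - 1))" for i using fl[of "i - 1"] unfolding e .
      have fl'': "lin R (obj A (i - 2)) (obj D (n + i - 1)) (f (i - 2))" for i using fl[of "i - 2"] unfolding e .
      have dD: "lin R (obj D (n + 1 + i)) (obj D (n + i)) (diff D (n + 1 + i))" for i
        using cD(2)[of "n + 1 + i"] unfolding e .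
      define g where "g = ?d (n + 1) f"
      have g: "g i x = (if even n then diff D (n + 1 + i) (f i x) \<oplus>\<^bsub>obj D (n + i)\<^esub> f (i - 1) (diff A i x)
          else diff D (n + 1 + i) (f i x) \<ominus>\<^bsub>obj D (n + i)\<^esub> f (i - 1) (diff A i x))"
        if "x \<in> carrier (obj A i)" for i x
        using that by (simp add: g_def hom_cpx_diff_def e)
      have gl: "lin R (obj A i) (obj D (n + i)) (g i)" for i
      proof (cases "even n")
        case True
        show ?thesis
          by (rule lin_cong[OF lin_plus[OF lin_comp[OF fl dD] lin_comp[OF cA(2) fl'] mD] mA])
            (simp add: g True)
      next
        case False
        show ?thesis
          by (rule lin_cong[OF lin_diff[OF lin_comp[OF fl dD] lin_comp[OF cA(2) fl'] mD] mA])
            (simp add: g False)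
      qed
      have gO: "g \<in> carrier (?O n)"
        unfolding mem using gl by (simp add: g_def hom_cpx_diff_def)
      have "?d n g i x = \<zero>\<^bsub>?O (n - 1)\<^esub> i x" for i x
      proof (cases "x \<in> carrier (obj A i)")
        case False
        then show ?thesis by (simp add: hom_cpx_diff_def zer)
      next
        case x: True
        let ?L = "obj D (n + i - 1)"
        interpret L: left_module R ?L by (rule mD)
        interpret L': left_module R "obj D (n + i)" by (rule mD)
        define a where "a = diff D (n + 1 + i) (f i x)"
        define b where "b = f (i - 1) (diff A i x)"
        have a: "a \<in> carrier (obj D (n + i))" unfolding a_def by (rule lin_closed[OF dD lin_closed[OF fl x]])
        have b: "b \<in> carrier (obj D (n + i))" unfolding b_def by (rule lin_closed[OF fl' dA[OF x]])
        have dl: "lin R (obj D (n + i)) ?L (diff D (n + i))" by (rule cD(2))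
        have da: "diff D (n + i) a = \<zero>\<^bsub>?L\<^esub>"
          using cD(3)[OF lin_closed[OF fl x]] unfolding e a_def .
        have db: "diff D (n + i) b \<in> carrier ?L" by (rule lin_closed[OF dl b])
        have dd: "f (i - 2) (diff A (i - 1) (diff A i x)) = \<zero>\<^bsub>?L\<^esub>"
          using cA(3)[OF x] lin_zero[OF fl'' mA mD] by simp
        have g': "g (i - 1) (diff A i x) = (if even n then diff D (n + i) b \<oplus>\<^bsub>?L\<^esub> \<zero>\<^bsub>?L\<^esub> else diff D (n + i) b \<ominus>\<^bsub>?L\<^esub> \<zero>\<^bsub>?L\<^esub>)"
          using g[OF dA[OF x]] dd by (simp add: e b_def)
        have gi: "g i x = (if even n then a \<oplus>\<^bsub>obj D (n + i)\<^esub> b else a \<ominus>\<^bsub>obj D (n + i)\<^esub> b)"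
          using g[OF x] by (simp add: a_def b_def)
        have "?d n g i x = (if even n then diff D (n + i) (g i x) \<ominus>\<^bsub>?L\<^esub> g (i - 1) (diff A i x)
            else diff D (n + i) (g i x) \<oplus>\<^bsub>?L\<^esub> g (i - 1) (diff A i x))"
          using x by (simp add: hom_cpx_diff_def)
        also have "\<dots> = \<zero>\<^bsub>?L\<^esub>"
          unfolding g' gi using db da
          by (simp add: lin_add[OF dl a b] lin_minus[OF dl mD mD a b])
        finally show ?thesis using x by (simp add: zer)
      qed
      then have "?d n g = \<zero>\<^bsub>?O (n - 1)\<^esub>" by (intro ext)
      then show "?d (n + 1) f \<in> a_kernel (?O n) (?O (n - 1)) (?d n)"
        using gO unfolding g_def by (simp add: a_kernel_def')
    qed
  next
    show "a_kernel (?O n) (?O (n - 1)) (?d n) \<subseteq> ?d (n + 1) ` carrier (?O (n + 1))"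
    proof
      fix f assume "f \<in> a_kernel (?O n) (?O (n - 1)) (?d n)"
      then have fO: "f \<in> carrier (?O n)" and df: "?d n f = \<zero>\<^bsub>?O (n - 1)\<^esub>" by (auto simp: a_kernel_def')
      have fl: "lin R (obj A i) (obj D (n + i)) (f i)" and fe: "f i \<in> extensional (carrier (obj A i))" for i
        using fO unfolding mem by auto
      have fl': "lin R (obj A (i - 1)) (obj D (n + i - 1)) (f (i - 1))" for i using fl[of "i - 1"] unfolding e .
      have sl': "lin R (obj D (n + i)) (obj D (n + 1 + i)) (s (n + i))" for i using sl[of "n + i"] unfolding e .
      define g where "g = (\<lambda>i. \<lambda>x\<in>carrier (obj A i). s (n + i) (f i x))"
      have gl: "lin R (obj A i) (obj D (n + 1 + i)) (g i)" for i
        by (rule lin_cong[OF lin_comp[OF fl sl'] mA]) (simp add: g_def)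
      have gO: "g \<in> carrier (?O (n + 1))" unfolding mem using gl by (simp add: g_def)
      have "?d (n + 1) g i x = f i x" for i x
      proof (cases "x \<in> carrier (obj A i)")
        case False
        then show ?thesis using fe by (simp add: hom_cpx_diff_def extensional_def)
      next
        case x: True
        let ?L = "obj D (n + i - 1)" let ?M = "obj D (n + i)"
        interpret L: left_module R ?L by (rule mD)
        interpret M: left_module R ?M by (rule mD)
        define y where "y = diff D (n + i) (f i x)"
        define z where "z = f (i - 1) (diff A i x)"
        have fx: "f i x \<in> carrier ?M" by (rule lin_closed[OF fl x])
        have y: "y \<in> carrier ?L" unfolding y_def by (rule lin_closed[OF cD(2) fx])
        have z: "z \<in> carrier ?L" unfolding z_def by (rule lin_closed[OF fl' dA[OF x]])
        have "?d n f i x = \<zero>\<^bsub>?L\<^esub>" using df x by (simp add: zer)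
        then have yz: "(if even n then y \<ominus>\<^bsub>?L\<^esub> z else y \<oplus>\<^bsub>?L\<^esub> z) = \<zero>\<^bsub>?L\<^esub>"
          using x by (simp add: hom_cpx_diff_def y_def z_def split: if_splits)
        \<comment> \<open>The cycle condition expresses fd through df with sign (-1)^n, which
          cancels the sign of the Hom differential in degree n + 1.\<close>
        have z_eq: "z = (if even n then y else \<ominus>\<^bsub>?L\<^esub> y)"
          using yz y z by (auto split: if_splits intro: L.minus_equality[symmetric] simp: L.a_comm)
        have sL: "lin R ?L ?M (s (n + i - 1))" using sl[of "n + i - 1"] by simp
        have sy: "s (n + i - 1) y \<in> carrier ?M" by (rule lin_closed[OF sL y])
        have dsf: "diff D (n + 1 + i) (s (n + i) (f i x)) \<in> carrier ?M"
          using lin_closed[OF cD(2) lin_closed[OF sl' fx]] unfolding e .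
        have con: "diff D (n + 1 + i) (s (n + i) (f i x)) \<oplus>\<^bsub>?M\<^esub> s (n + i - 1) y = f i x"
          using sc[OF fx] unfolding e y_def .
        have "?d (n + 1) g i x = (if even n
            then diff D (n + 1 + i) (s (n + i) (f i x)) \<oplus>\<^bsub>?M\<^esub> s (n + i - 1) z
            else diff D (n + 1 + i) (s (n + i) (f i x)) \<ominus>\<^bsub>?M\<^esub> s (n + i - 1) z)"
          using x dA[OF x] by (simp add: hom_cpx_diff_def g_def e z_def)
        also have "\<dots> = f i x"
        proof (cases "even n")
          case True
          then show ?thesis using con z_eq by simp
        next
          case False
          have "s (n + i - 1) z = \<ominus>\<^bsub>?M\<^esub> s (n + i - 1) y"
            using z_eq False lin_neg[OF sL mD mD y] by simp
          then show ?thesis using False con sy dsf by (simp add: M.minus_eq)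
        qed
        finally show ?thesis .
      qed
      then have "f = ?d (n + 1) g" by (intro ext) simp
      then show "f \<in> ?d (n + 1) ` carrier (?O (n + 1))" using gO by blast
    qed
  qed
qed

section \<open>Discs\<close>

text \<open>The disc on H: identity from degree m + 1 to degree m. The other terms are the zero
  submodule of H, so that all carriers stay small subsets of \<open>'m\<close>. Chain maps into it
  correspond to linear maps from the degree-m term into H.\<close>

definition disc_cpx :: "('r, 'm) module \<Rightarrow> int \<Rightarrow> ('r, 'm) chain_cpx" where
  "disc_cpx H m = \<lparr>obj = (\<lambda>k. if k = m \<or> k = m + 1 then H else zero_mod H),
     diff = (\<lambda>k. if k = m + 1 then (\<lambda>x. x) else (\<lambda>x. \<zero>\<^bsub>H\<^esub>))\<rparr>"

lemma disc_cpx: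
  assumes H: "H \<in> LM"
  shows "disc_cpx H m \<in> complexes R U" and "exact_cpx (disc_cpx H m)"
    and "contraction R (disc_cpx H m) (\<lambda>k. if k = m then (\<lambda>x. x) else (\<lambda>x. \<zero>\<^bsub>H\<^esub>))"
    and "cycle_module (disc_cpx H m) k = (if k = m then H else zero_mod H)"
proof -
  interpret H: left_module R H using H by auto
  interpret Z: left_module R "zero_mod H" using zero_LM[OF H] by auto
  have zl: "lin R N H (\<lambda>x. \<zero>\<^bsub>H\<^esub>)" for N :: "('r, 'm) module"
    by (rule lin_const_zero[OF H.left_module_axioms])
  have zz: "lin R N (zero_mod H) (\<lambda>x. \<zero>\<^bsub>H\<^esub>)" for N :: "('r, 'm) module"
    using lin_const_zero[OF Z.left_module_axioms] by simp
  show "disc_cpx H m \<in> complexes R U"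
  proof (rule complexesI)
    fix n
    show "obj (disc_cpx H m) n \<in> LM" using H zero_LM[OF H] by (simp add: disc_cpx_def)
    show "lin R (obj (disc_cpx H m) n) (obj (disc_cpx H m) (n - 1)) (diff (disc_cpx H m) n)"
      using zl zz lin_id by (auto simp: disc_cpx_def)
    fix x
    show "diff (disc_cpx H m) (n - 1) (diff (disc_cpx H m) n x) = \<zero>\<^bsub>obj (disc_cpx H m) (n - 2)\<^esub>"
      by (simp add: disc_cpx_def)
  qed
  show "exact_cpx (disc_cpx H m)"
    unfolding exact_cpx_def exact_at_def a_kernel_def'
    by (auto simp: disc_cpx_def)
  show "contraction R (disc_cpx H m) (\<lambda>k. if k = m then (\<lambda>x. x) else (\<lambda>x. \<zero>\<^bsub>H\<^esub>))"
    unfolding contraction_def using zl zz lin_id by (auto simp: disc_cpx_def)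
  show "cycle_module (disc_cpx H m) k = (if k = m then H else zero_mod H)"
    by (auto simp: cycle_module_def disc_cpx_def a_kernel_def' intro: arg_cong[where f="\<lambda>S. H\<lparr>carrier := S\<rparr>"])
qed

lemma chain_maps_restrict:
  assumes X: "X \<in> complexes R U" and f: "f \<in> chain_maps R X H"
  shows "(\<lambda>n. restrict (f n) (carrier (obj X n))) \<in> chain_maps R X H"
proof (rule chain_mapsI)
  note c = complexesD[OF X] and f' = chain_mapsD[OF f]
  fix n
  show "lin R (obj X n) (obj H n) (restrict (f n) (carrier (obj X n)))"
    by (rule lin_cong[OF f'(1) LM_left_module[OF c(1)]]) simp
  fix x assume x: "x \<in> carrier (obj X n)"
  then show "restrict (f (n - 1)) (carrier (obj X (n - 1))) (diff X n x) = diff H n (restrict (f n) (carrier (obj X n)) x)"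
    using f'(2)[OF x] lin_closed[OF c(2) x] by simp
qed

lemma chain_maps_comp:
  assumes f: "f \<in> chain_maps R X Y" and g: "g \<in> chain_maps R Y Z"
  shows "(\<lambda>n x. g n (f n x)) \<in> chain_maps R X Z"
proof (rule chain_mapsI)
  fix n
  show "lin R (obj X n) (obj Z n) (\<lambda>x. g n (f n x))"
    by (rule lin_comp[OF chain_mapsD(1)[OF f] chain_mapsD(1)[OF g]])
  fix x assume x: "x \<in> carrier (obj X n)"
  show "g (n - 1) (f (n - 1) (diff X n x)) = diff Z n (g n (f n x))"
    using chain_mapsD(2)[OF f x] chain_mapsD(2)[OF g lin_closed[OF chain_mapsD(1)[OF f] x]] by simp
qed

section \<open>Hom-exactness of sequences of complexes\<close>

text \<open>Counterpart for complexes of \<open>hom_exact_at_iff\<close>: exactness at the Hom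
  groups becomes an extension property of plain chain maps. The condition that consecutive maps
  compose to zero gives the inclusion of the image in the kernel.\<close>

lemma seq_hom_into_exact_iff:
  assumes S: "\<forall>i. S i \<in> complexes R U" and d: "\<forall>i. d i \<in> chain_maps R (S i) (S (i - 1))"
    and dd: "\<forall>i n. \<forall>x\<in>carrier (obj (S (i + 1)) n). d i n (d (i + 1) n x) = \<zero>\<^bsub>obj (S (i - 1)) n\<^esub>"
    and H: "H \<in> complexes R U"
  shows "seq_hom_into_exact R S d H \<longleftrightarrow> (\<forall>i. \<forall>\<phi>\<in>chain_maps R (S i) H.
    (\<forall>n. \<forall>x\<in>carrier (obj (S (i + 1)) n). \<phi> n (d (i + 1) n x) = \<zero>\<^bsub>obj H n\<^esub>) \<longrightarrow>
    (\<exists>\<psi>\<in>chain_maps R (S (i - 1)) H. \<forall>n. \<forall>x\<in>carrier (obj (S i) n). \<psi> n (d i n x) = \<phi> n x))"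
  unfolding seq_hom_into_exact_def exact_at_def
proof (rule iff_allI)
  fix i
  let ?X = "S i" let ?Y = "S (i + 1)" let ?W = "S (i - 1)"
  let ?Im = "precomp_map ?X (d i) ` carrier (chain_map_group R ?W H)"
  let ?Ker = "a_kernel (chain_map_group R ?X H) (chain_map_group R ?Y H) (precomp_map ?Y (d (i + 1)))"
  have c: "?X \<in> complexes R U" "?Y \<in> complexes R U" "?W \<in> complexes R U" using S by auto
  have di: "d i \<in> chain_maps R ?X ?W" and di1: "d (i + 1) \<in> chain_maps R ?Y ?X"
    using d[rule_format, of i] d[rule_format, of "i + 1"] by simp_all
  have dX: "d i n x \<in> carrier (obj ?W n)" if "x \<in> carrier (obj ?X n)" for n x
    using lin_closed[OF chain_mapsD(1)[OF di] that] .
  have dY: "d (i + 1) n x \<in> carrier (obj ?X n)" if "x \<in> carrier (obj ?Y n)" for n x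
    using lin_closed[OF chain_mapsD(1)[OF di1] that] .
  have Ker: "\<phi> \<in> ?Ker \<longleftrightarrow> \<phi> \<in> chain_maps R ?X H \<and> (\<forall>n. \<phi> n \<in> extensional (carrier (obj ?X n))) \<and>
      (\<forall>n. \<forall>x\<in>carrier (obj ?Y n). \<phi> n (d (i + 1) n x) = \<zero>\<^bsub>obj H n\<^esub>)" for \<phi>
  proof -
    have "precomp_map ?Y (d (i + 1)) \<phi> = (\<lambda>n. \<lambda>x\<in>carrier (obj ?Y n). \<zero>\<^bsub>obj H n\<^esub>) \<longleftrightarrow>
      (\<forall>n. \<forall>x\<in>carrier (obj ?Y n). \<phi> n (d (i + 1) n x) = \<zero>\<^bsub>obj H n\<^esub>)"
      by (auto simp: precomp_map_def compose_def fun_eq_iff restrict_def)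
    then show ?thesis by (auto simp: a_kernel_def' chain_map_group_def)
  qed
  have Im: "\<phi> \<in> ?Im \<longleftrightarrow> (\<forall>n. \<phi> n \<in> extensional (carrier (obj ?X n))) \<and>
      (\<exists>\<psi>\<in>chain_maps R ?W H. \<forall>n. \<forall>x\<in>carrier (obj ?X n). \<psi> n (d i n x) = \<phi> n x)" for \<phi>
  proof
    assume "\<phi> \<in> ?Im"
    then obtain \<psi> where "\<psi> \<in> chain_maps R ?W H" "\<phi> = precomp_map ?X (d i) \<psi>"
      by (auto simp: chain_map_group_def)
    then show "(\<forall>n. \<phi> n \<in> extensional (carrier (obj ?X n))) \<and>
      (\<exists>\<psi>\<in>chain_maps R ?W H. \<forall>n. \<forall>x\<in>carrier (obj ?X n). \<psi> n (d i n x) = \<phi> n x)"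
      by (intro conjI bexI[of _ \<psi>]) (simp_all add: precomp_map_def compose_def)
  next
    assume a: "(\<forall>n. \<phi> n \<in> extensional (carrier (obj ?X n))) \<and>
      (\<exists>\<psi>\<in>chain_maps R ?W H. \<forall>n. \<forall>x\<in>carrier (obj ?X n). \<psi> n (d i n x) = \<phi> n x)"
    then obtain \<psi> where \<psi>: "\<psi> \<in> chain_maps R ?W H"
      "\<forall>n. \<forall>x\<in>carrier (obj ?X n). \<psi> n (d i n x) = \<phi> n x" by blast
    let ?\<psi> = "\<lambda>n. restrict (\<psi> n) (carrier (obj ?W n))"
    have "?\<psi> \<in> carrier (chain_map_group R ?W H)"
      using chain_maps_restrict[OF c(3) \<psi>(1)] by (simp add: chain_map_group_def)
    moreover have "\<phi> = precomp_map ?X (d i) ?\<psi>"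
    proof (intro ext)
      fix n x
      show "\<phi> n x = precomp_map ?X (d i) ?\<psi> n x"
        using a \<psi>(2) dX[of x n] by (cases "x \<in> carrier (obj ?X n)") (auto simp: precomp_map_def compose_def extensional_def)
    qed
    ultimately show "\<phi> \<in> ?Im" by blast
  qed
  have sub: "?Im \<subseteq> ?Ker"
  proof
    fix \<phi> assume "\<phi> \<in> ?Im"
    then have e: "\<forall>n. \<phi> n \<in> extensional (carrier (obj ?X n))" unfolding Im by blast
    from \<open>\<phi> \<in> ?Im\<close> obtain \<psi> where \<psi>: "\<psi> \<in> chain_maps R ?W H"
      "\<forall>n. \<forall>x\<in>carrier (obj ?X n). \<psi> n (d i n x) = \<phi> n x" unfolding Im by blast
    have "\<phi> \<in> chain_maps R ?X H"
    proof (rule chain_mapsI)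
      note \<psi>d = chain_mapsD[OF chain_maps_comp[OF di \<psi>(1)]]
      fix n
      show "lin R (obj ?X n) (obj H n) (\<phi> n)"
        by (rule lin_cong[OF \<psi>d(1) LM_left_module[OF complexesD(1)[OF c(1)]]]) (simp add: \<psi>(2))
      fix x assume x: "x \<in> carrier (obj ?X n)"
      show "\<phi> (n - 1) (diff ?X n x) = diff H n (\<phi> n x)"
        using \<psi>d(2)[OF x] \<psi>(2) x lin_closed[OF complexesD(2)[OF c(1)] x] by simp
    qed
    moreover have "\<phi> n (d (i + 1) n x) = \<zero>\<^bsub>obj H n\<^esub>" if x: "x \<in> carrier (obj ?Y n)" for n x
    proof -
      have "\<phi> n (d (i + 1) n x) = \<psi> n (d i n (d (i + 1) n x))" using \<psi>(2) dY[OF x] by simp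
      also have "\<dots> = \<psi> n \<zero>\<^bsub>obj ?W n\<^esub>" using dd x by simp
      also have "\<dots> = \<zero>\<^bsub>obj H n\<^esub>"
        by (rule lin_zero[OF chain_mapsD(1)[OF \<psi>(1)] LM_left_module[OF complexesD(1)[OF c(3)]]
              LM_left_module[OF complexesD(1)[OF H]]])
      finally show ?thesis .
    qed
    ultimately show "\<phi> \<in> ?Ker" unfolding Ker using e by blast
  qed
  then have "?Im = ?Ker \<longleftrightarrow> ?Ker \<subseteq> ?Im" by blast
  also have "\<dots> \<longleftrightarrow> (\<forall>\<phi>\<in>chain_maps R ?X H.
    (\<forall>n. \<forall>x\<in>carrier (obj ?Y n). \<phi> n (d (i + 1) n x) = \<zero>\<^bsub>obj H n\<^esub>) \<longrightarrow>
    (\<exists>\<psi>\<in>chain_maps R ?W H. \<forall>n. \<forall>x\<in>carrier (obj ?X n). \<psi> n (d i n x) = \<phi> n x))" (is "_ \<longleftrightarrow> ?ext")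
  proof
    assume KI: "?Ker \<subseteq> ?Im"
    show ?ext
    proof (intro ballI impI)
      fix \<phi> assume \<phi>: "\<phi> \<in> chain_maps R ?X H"
        "\<forall>n. \<forall>x\<in>carrier (obj ?Y n). \<phi> n (d (i + 1) n x) = \<zero>\<^bsub>obj H n\<^esub>"
      let ?\<phi> = "\<lambda>n. restrict (\<phi> n) (carrier (obj ?X n))"
      have "?\<phi> \<in> ?Ker" unfolding Ker using chain_maps_restrict[OF c(1) \<phi>(1)] \<phi>(2) dY by simp
      then have "?\<phi> \<in> ?Im" using KI by blast
      then show "\<exists>\<psi>\<in>chain_maps R ?W H. \<forall>n. \<forall>x\<in>carrier (obj ?X n). \<psi> n (d i n x) = \<phi> n x"
        unfolding Im by simp
    qed
  next
    assume x: ?ext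
    show "?Ker \<subseteq> ?Im"
    proof
      fix \<phi> assume "\<phi> \<in> ?Ker"
      then show "\<phi> \<in> ?Im" unfolding Im Ker using x by blast
    qed
  qed
  finally show "?Im = ?Ker \<longleftrightarrow> ?ext" .
qed

end

section \<open>Terms of Gorenstein complexes\<close>

context cotorsion_category
begin

text \<open>For the last claim: exactness makes each term an extension of the cycles one degree
  below by the cycles in its own degree.\<close>

lemma tildeD:
  assumes "X \<in> tilde_class R U \<A>"
  shows "X \<in> complexes R U" "exact_cpx X" "cycle_module X n \<in> \<A>" "obj X n \<in> \<A>"
proof -
  show c: "X \<in> complexes R U" and e: "exact_cpx X" and z: "\<And>n. cycle_module X n \<in> \<A>"
    using assms by (auto simp: tilde_class_def)
  note d = complexesD[OF c]
  have im: "diff X n ` carrier (obj X n) = carrier (cycle_module X (n - 1))"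
    using e[unfolded exact_cpx_def exact_at_def, rule_format, of "n - 1"] by (simp add: cycle_module_def)
  have "short_exact R (cycle_module X n) (\<lambda>x. x) (obj X n) (diff X n) (cycle_module X (n - 1))"
  proof (rule short_exactI)
    show "lin R (cycle_module X n) (obj X n) (\<lambda>x. x)"
      unfolding cycle_module_def by (rule lin_subset) (auto simp: a_kernel_def')
    show "lin R (obj X n) (cycle_module X (n - 1)) (diff X n)"
      using im unfolding cycle_module_def by (intro lin_into[OF d(2)]) simp
  qed (auto simp: im, auto simp: cycle_module_def a_kernel_def')
  then show "obj X n \<in> \<A>" by (rule A_extension[OF z z d(1)])
qed

text \<open>The cycles of a disc are H in one degree and zero elsewhere, and the disc is
  contractible, so every Hom-complex into it is exact.\<close>

lemma disc_cpx_classes: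
  assumes H: "H \<in> \<A> \<inter> \<B>"
  shows "disc_cpx H m \<in> tilde_class R U \<A> \<inter> dg_tilde_class R U \<A> \<B>"
proof
  have HL: "H \<in> LM" using H A_LM by blast
  note D = disc_cpx[OF HL, of m]
  show "disc_cpx H m \<in> tilde_class R U \<A>"
    unfolding tilde_class_def using D(1,2,4) H zero_mod_A[OF HL] by auto
  have "obj (disc_cpx H m) n \<in> \<B>" for n using H zero_mod_B[OF HL] by (simp add: disc_cpx_def)
  then show "disc_cpx H m \<in> dg_tilde_class R U \<A> \<B>"
    unfolding dg_tilde_class_def using D(1) contractible_hom_exact[OF tildeD(1) D(1,3)] by auto
qed

lemma tilde_dg_contractible:
  assumes "H \<in> tilde_class R U \<A> \<inter> dg_tilde_class R U \<A> \<B>"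
  shows "\<exists>s. contraction R H s" "obj H n \<in> \<A> \<inter> \<B>"
  using assms contraction_exists[OF tildeD(1)] tildeD(4) by (auto simp: dg_tilde_class_def)

text \<open>The degree-n row of a resolving sequence of complexes resolves C_n. Hom-exactness
  against H comes from the disc on H in degrees n + 1 and n, since a linear map on the degree-n term
  is the same as a chain map into that disc.\<close>

lemma gorenstein_complex_obj:
  assumes "C \<in> gorenstein_complexes R U \<A> \<B>"
  shows "obj C n \<in> \<G>"
proof -
  from assms have C: "C \<in> complexes R U" by (simp add: gorenstein_complexes_def)
  from assms obtain S d where S: "\<forall>i. S i \<in> tilde_class R U \<A>"
    and d: "\<forall>i. d i \<in> chain_maps R (S i) (S (i - 1))" and ex: "exact_seq S d"
    and hom: "\<forall>H\<in>tilde_class R U \<A> \<inter> dg_tilde_class R U \<A> \<B>. seq_hom_into_exact R S d H"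
    and iso: "cpx_iso R C (im_cpx (d 0) (S 0) (S (-1)))"
    unfolding gorenstein_complexes_def by blast
  have Sc: "\<forall>i. S i \<in> complexes R U" using S tildeD(1) by blast
  have SL: "obj (S i) k \<in> LM" for i k by (rule complexesD(1)[OF Sc[rule_format]])
  have SA: "obj (S i) k \<in> \<A>" for i k by (rule tildeD(4)[OF S[rule_format]])
  note dm = chain_mapsD[OF d[rule_format]]
  have ker: "d (i + 1) k ` carrier (obj (S (i + 1)) k) =
      {x \<in> carrier (obj (S i) k). d i k x = \<zero>\<^bsub>obj (S (i - 1)) k\<^esub>}" for i k
    using ex by (simp add: exact_seq_def exact_at_def a_kernel_def')
  have dd: "\<forall>i k. \<forall>x\<in>carrier (obj (S (i + 1)) k). d i k (d (i + 1) k x) = \<zero>\<^bsub>obj (S (i - 1)) k\<^esub>"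
    using ker by blast
  define T :: "('r, 'm) chain_cpx" where "T = \<lparr>obj = (\<lambda>i. obj (S i) n), diff = (\<lambda>i. d i n)\<rparr>"
  have o: "obj T i = obj (S i) n" and df: "diff T i = d i n" for i by (simp_all add: T_def)
  have T: "T \<in> complexes R U"
  proof (rule complexesI, unfold o df)
    fix i
    show "obj (S i) n \<in> LM" by (rule SL)
    show "lin R (obj (S i) n) (obj (S (i - 1)) n) (d i n)" by (rule dm)
    fix x assume "x \<in> carrier (obj (S i) n)"
    then show "d (i - 1) n (d i n x) = \<zero>\<^bsub>obj (S (i - 2)) n\<^esub>"
      using dd[rule_format, of x "i - 1" n] by simp
  qed
  have "hom_into_exact R T H" if H: "H \<in> \<A> \<inter> \<B>" for H
  proof -
    have HL: "H \<in> LM" using H A_LM by blast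
    interpret H: left_module R H using HL by auto
    let ?D = "disc_cpx H n"
    have D: "?D \<in> complexes R U" by (rule disc_cpx(1)[OF HL])
    have "seq_hom_into_exact R S d ?D" using hom disc_cpx_classes[OF H] by blast
    note ext = this[unfolded seq_hom_into_exact_iff[OF Sc d dd D], rule_format]
    show ?thesis
      unfolding hom_into_exact_iff[OF T HL] o df
    proof (intro allI impI, elim conjE)
      fix i h
      assume h: "lin R (obj (S i) n) H h"
        and hd: "\<forall>x\<in>carrier (obj (S (i + 1)) n). h (d (i + 1) n x) = \<zero>\<^bsub>H\<^esub>"
      note cS = complexesD[OF Sc[rule_format, of i]]
      \<comment> \<open>The chain map into the disc determined by h: the identity differential of
        the disc forces h after the differential in degree n + 1.\<close>
      define \<phi> where "\<phi> k = (if k = n then h else if k = n + 1 then (\<lambda>x. h (diff (S i) (n + 1) x)) else (\<lambda>x. \<zero>\<^bsub>H\<^esub>))" for k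
      have z: "lin R (obj (S i) k) (zero_mod H) (\<lambda>x. \<zero>\<^bsub>H\<^esub>)" for k
        using lin_const_zero[OF LM_left_module[OF zero_LM[OF HL]]] by simp
      have dn1: "lin R (obj (S i) (n + 1)) (obj (S i) n) (diff (S i) (n + 1))"
        using cS(2)[of "n + 1"] by simp
      have h0: "h \<zero>\<^bsub>obj (S i) n\<^esub> = \<zero>\<^bsub>H\<^esub>" by (rule lin_zero[OF h LM_left_module[OF SL] H.left_module_axioms])
      have "\<phi> \<in> chain_maps R (S i) ?D"
      proof (rule chain_mapsI)
        fix k
        show "lin R (obj (S i) k) (obj ?D k) (\<phi> k)"
          using h lin_comp[OF dn1 h] z by (auto simp: \<phi>_def disc_cpx_def)
        fix x assume x: "x \<in> carrier (obj (S i) k)"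
        consider "k = n + 1" | "k = n + 2" | "k \<noteq> n + 1" "k \<noteq> n + 2" by blast
        then show "\<phi> (k - 1) (diff (S i) k x) = diff ?D k (\<phi> k x)"
        proof cases
          case 1
          then show ?thesis by (simp add: \<phi>_def disc_cpx_def)
        next
          case 2
          have "diff (S i) (n + 1) (diff (S i) (n + 2) x) = \<zero>\<^bsub>obj (S i) n\<^esub>"
            using cS(3)[of x "n + 2"] x 2 by (simp add: add.commute[of 1])
          then show ?thesis using 2 h0 by (simp add: \<phi>_def disc_cpx_def)
        next
          case 3
          then show ?thesis by (auto simp: \<phi>_def disc_cpx_def)
        qed
      qed
      moreover have "\<phi> k (d (i + 1) k x) = \<zero>\<^bsub>obj ?D k\<^esub>" if x: "x \<in> carrier (obj (S (i + 1)) k)" for k x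
      proof -
        \<comment> \<open>Commuting \<open>d\<close> past the differential reduces the vanishing in
          degree n + 1 to that in degree n.\<close>
        have "h (diff (S i) (n + 1) (d (i + 1) (n + 1) x)) = \<zero>\<^bsub>H\<^esub>" if k: "k = n + 1"
        proof -
          have x': "x \<in> carrier (obj (S (i + 1)) (n + 1))" using x k by simp
          have "diff (S (i + 1)) (n + 1) x \<in> carrier (obj (S (i + 1)) n)"
            using lin_closed[OF complexesD(2)[OF Sc[rule_format, of "i + 1"]] x'] by simp
          moreover have "d (i + 1) n (diff (S (i + 1)) (n + 1) x) = diff (S i) (n + 1) (d (i + 1) (n + 1) x)"
            using dm(2)[OF x'] by simp
          ultimately show ?thesis using hd by metis
        qed
        then show ?thesis using hd x by (auto simp: \<phi>_def disc_cpx_def)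
      qed
      ultimately obtain \<psi> where \<psi>: "\<psi> \<in> chain_maps R (S (i - 1)) ?D"
        "\<forall>k. \<forall>x\<in>carrier (obj (S i) k). \<psi> k (d i k x) = \<phi> k x"
        using ext[of \<phi> i] by blast
      have "lin R (obj (S (i - 1)) n) H (\<psi> n)" using chain_mapsD(1)[OF \<psi>(1), of n] by (simp add: disc_cpx_def)
      moreover have "\<forall>x\<in>carrier (obj (S i) n). \<psi> n (d i n x) = h x" using \<psi>(2) by (simp add: \<phi>_def)
      ultimately show "\<exists>g. lin R (obj (S (i - 1)) n) H g \<and> (\<forall>x\<in>carrier (obj (S i) n). g (d i n x) = h x)"
        by blast
    qed
  qed
  moreover have "exact_cpx T" using ex unfolding exact_cpx_def exact_seq_def o df by blast
  moreover have "mod_iso R (obj C n) (im_module (diff T 0) (obj T 0) (obj T (-1)))"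
  proof -
    from iso obtain h where h: "h \<in> chain_maps R C (im_cpx (d 0) (S 0) (S (-1)))"
      "\<forall>k. bij_betw (h k) (carrier (obj C k)) (carrier (obj (im_cpx (d 0) (S 0) (S (-1))) k))"
      by (auto simp: cpx_iso_def)
    then show ?thesis
      unfolding mod_iso_def using chain_mapsD(1)[OF h(1), of n] h(2)[rule_format, of n]
      by (intro bexI[of _ "h n"]) (simp_all add: mod_hom_iff im_cpx_def o df)
  qed
  moreover have "\<forall>i. obj T i \<in> \<A>" using SA by (simp add: o)
  ultimately show ?thesis
    unfolding gorenstein_modules_def mem_Collect_eq using T complexesD(1)[OF C] by blast
qed

end

section \<open>Resolving complexes with terms in the extension closure\<close>

context cotorsion_category
begin

text \<open>The sum over all n of the discs with \<open>F n\<close> in degrees n and n - 1. Only two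
  of them meet a given degree, so binary sums suffice; \<open>F n\<close> is the first summand in
  degree n and the second in degree n - 1.\<close>

definition disc_sum :: "(int \<Rightarrow> ('r, 'm) module) \<Rightarrow> ('r, 'm) chain_cpx" where
  "disc_sum F = \<lparr>obj = (\<lambda>n. dsum (F n) (F (n + 1))),
     diff = (\<lambda>n z. dpair (F (n - 1)) (F n) \<zero>\<^bsub>F (n - 1)\<^esub> (dfst (F n) (F (n + 1)) z))\<rparr>"

text \<open>Cycles and boundaries in degree n are both the second summand, a copy of
  \<open>F (n + 1)\<close>.\<close>

lemma disc_sum_tilde:
  assumes F: "\<forall>n. F n \<in> \<A>"
  shows "disc_sum F \<in> tilde_class R U \<A>"
proof -
  have FL: "F n \<in> LM" for n using F A_LM by blast
  have mF: "left_module R (F n)" for n using FL by auto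
  have z: "\<zero>\<^bsub>F n\<^esub> \<in> carrier (F n)" for n by (rule lin_zero_mem[OF mF])
  note simps = dfst_dpair[OF FL FL] dsnd_dpair[OF FL FL] dpair_closed[OF FL FL] dpair_zero[OF FL FL]
  have o: "obj (disc_sum F) n = dsum (F n) (F (n + 1))" for n by (simp add: disc_sum_def)
  have d: "diff (disc_sum F) n z = dpair (F (n - 1)) (F n) \<zero>\<^bsub>F (n - 1)\<^esub> (dfst (F n) (F (n + 1)) z)" for n z
    by (simp add: disc_sum_def)
  have fst: "dfst (F n) (F (n + 1)) y \<in> carrier (F n)" if "y \<in> carrier (dsum (F n) (F (n + 1)))" for n y
    by (rule lin_closed[OF lin_dfst[OF FL FL] that])
  have C: "disc_sum F \<in> complexes R U"
  proof (rule complexesI)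
    fix n
    show "obj (disc_sum F) n \<in> LM" unfolding o by (rule dsum_LM[OF FL FL])
    have "lin R (dsum (F n) (F (n + 1))) (dsum (F (n - 1)) (F n))
      (\<lambda>z. dpair (F (n - 1)) (F n) \<zero>\<^bsub>F (n - 1)\<^esub> (dfst (F n) (F (n + 1)) z))"
      by (intro lin_dpair[OF FL FL] lin_const_zero mF lin_dfst[OF FL FL])
    then show "lin R (obj (disc_sum F) n) (obj (disc_sum F) (n - 1)) (diff (disc_sum F) n)"
      by (simp add: disc_sum_def)
    fix y assume "y \<in> carrier (obj (disc_sum F) n)"
    then have "dfst (F n) (F (n + 1)) y \<in> carrier (F n)" unfolding o by (rule fst)
    then show "diff (disc_sum F) (n - 1) (diff (disc_sum F) n y) = \<zero>\<^bsub>obj (disc_sum F) (n - 2)\<^esub>"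
      using simps(1)[of "\<zero>\<^bsub>F (n - 1)\<^esub>" "n - 1" "dfst (F n) (F (n + 1)) y" n] simps(4)[of "n - 2" "n - 1"] z
      by (simp add: o d)
  qed
  note c = complexesD[OF C]
  have ker: "{y \<in> carrier (obj (disc_sum F) n). diff (disc_sum F) n y = \<zero>\<^bsub>obj (disc_sum F) (n - 1)\<^esub>}
      = (\<lambda>x. dpair (F n) (F (n + 1)) \<zero>\<^bsub>F n\<^esub> x) ` carrier (F (n + 1))" for n
  proof safe
    fix y assume y: "y \<in> carrier (obj (disc_sum F) n)" "diff (disc_sum F) n y = \<zero>\<^bsub>obj (disc_sum F) (n - 1)\<^esub>"
    have yD: "y \<in> carrier (dsum (F n) (F (n + 1)))" using y(1) by (simp add: o)
    have "dpair (F (n - 1)) (F n) \<zero>\<^bsub>F (n - 1)\<^esub> (dfst (F n) (F (n + 1)) y) = dpair (F (n - 1)) (F n) \<zero>\<^bsub>F (n - 1)\<^esub> \<zero>\<^bsub>F n\<^esub>"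
      using y(2) simps(4)[of "n - 1" n] by (simp add: o d)
    then have "dsnd (F (n - 1)) (F n) (dpair (F (n - 1)) (F n) \<zero>\<^bsub>F (n - 1)\<^esub> (dfst (F n) (F (n + 1)) y))
      = dsnd (F (n - 1)) (F n) (dpair (F (n - 1)) (F n) \<zero>\<^bsub>F (n - 1)\<^esub> \<zero>\<^bsub>F n\<^esub>)" by simp
    then have "dfst (F n) (F (n + 1)) y = \<zero>\<^bsub>F n\<^esub>"
      unfolding simps(2)[OF z fst[OF yD]] simps(2)[OF z z] .
    then have "y = dpair (F n) (F (n + 1)) \<zero>\<^bsub>F n\<^esub> (dsnd (F n) (F (n + 1)) y)"
      using dpair_collapse[OF FL FL yD] by simp
    then show "y \<in> (\<lambda>x. dpair (F n) (F (n + 1)) \<zero>\<^bsub>F n\<^esub> x) ` carrier (F (n + 1))"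
      using lin_closed[OF lin_dsnd[OF FL FL] yD] by blast
  next
    fix x assume x: "x \<in> carrier (F (n + 1))"
    show "dpair (F n) (F (n + 1)) \<zero>\<^bsub>F n\<^esub> x \<in> carrier (obj (disc_sum F) n)"
      unfolding o by (rule simps(3)[OF z x])
    show "diff (disc_sum F) n (dpair (F n) (F (n + 1)) \<zero>\<^bsub>F n\<^esub> x) = \<zero>\<^bsub>obj (disc_sum F) (n - 1)\<^esub>"
      unfolding d simps(1)[OF z x] using simps(4)[of "n - 1" n] by (simp add: o)
  qed
  have im: "diff (disc_sum F) (n + 1) ` carrier (obj (disc_sum F) (n + 1))
      = (\<lambda>x. dpair (F n) (F (n + 1)) \<zero>\<^bsub>F n\<^esub> x) ` carrier (F (n + 1))" for n
  proof -
    have "dfst (F (n + 1)) (F (n + 1 + 1)) ` carrier (dsum (F (n + 1)) (F (n + 1 + 1))) = carrier (F (n + 1))"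
    proof
      show "dfst (F (n + 1)) (F (n + 1 + 1)) ` carrier (dsum (F (n + 1)) (F (n + 1 + 1))) \<subseteq> carrier (F (n + 1))"
        using fst by blast
      show "carrier (F (n + 1)) \<subseteq> dfst (F (n + 1)) (F (n + 1 + 1)) ` carrier (dsum (F (n + 1)) (F (n + 1 + 1)))"
      proof
        fix x assume x: "x \<in> carrier (F (n + 1))"
        show "x \<in> dfst (F (n + 1)) (F (n + 1 + 1)) ` carrier (dsum (F (n + 1)) (F (n + 1 + 1)))"
          using simps(1)[OF x z[of "n + 1 + 1"]] simps(3)[OF x z[of "n + 1 + 1"]] by (metis imageI)
      qed
    qed
    note eq = this
    have "diff (disc_sum F) (n + 1) = (\<lambda>y. dpair (F n) (F (n + 1)) \<zero>\<^bsub>F n\<^esub> (dfst (F (n + 1)) (F (n + 1 + 1)) y))"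
      by (simp add: disc_sum_def)
    then show ?thesis unfolding eq[symmetric] image_image o by simp
  qed
  have ex: "exact_cpx (disc_sum F)"
    unfolding exact_cpx_def exact_at_def a_kernel_def' ker im by simp
  have "cycle_module (disc_sum F) n \<in> \<A>" for n
  proof (rule A_iso[of "F (n + 1)" _ "\<lambda>x. dpair (F n) (F (n + 1)) \<zero>\<^bsub>F n\<^esub> x"])
    show "F (n + 1) \<in> \<A>" using F by blast
    show "cycle_module (disc_sum F) n \<in> LM" unfolding cycle_module_def by (rule ker_LM[OF c(1) c(1) c(2)])
    have car: "carrier (cycle_module (disc_sum F) n) = (\<lambda>x. dpair (F n) (F (n + 1)) \<zero>\<^bsub>F n\<^esub> x) ` carrier (F (n + 1))"
      using ker[of n] by (simp add: cycle_module_def a_kernel_def')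
    have "lin R (F (n + 1)) (dsum (F n) (F (n + 1))) (\<lambda>x. dpair (F n) (F (n + 1)) \<zero>\<^bsub>F n\<^esub> x)"
      by (intro lin_dpair[OF FL FL] lin_const_zero mF lin_id)
    then show "lin R (F (n + 1)) (cycle_module (disc_sum F) n) (\<lambda>x. dpair (F n) (F (n + 1)) \<zero>\<^bsub>F n\<^esub> x)"
      using car unfolding cycle_module_def o by (intro lin_into) simp_all
    show "bij_betw (\<lambda>x. dpair (F n) (F (n + 1)) \<zero>\<^bsub>F n\<^esub> x) (carrier (F (n + 1))) (carrier (cycle_module (disc_sum F) n))"
      unfolding car
      by (rule inj_on_imp_bij_betw, rule inj_on_inverseI[of _ "dsnd (F n) (F (n + 1))"]) (simp add: simps(2) z)
  qed
  then show ?thesis using C ex by (simp add: tilde_class_def)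
qed

definition short_exact_cpx ::
    "('r, 'm) chain_cpx \<Rightarrow> (int \<Rightarrow> 'm \<Rightarrow> 'm) \<Rightarrow> ('r, 'm) chain_cpx \<Rightarrow> (int \<Rightarrow> 'm \<Rightarrow> 'm) \<Rightarrow> ('r, 'm) chain_cpx \<Rightarrow> bool" where
  "short_exact_cpx V f S g W \<longleftrightarrow> f \<in> chain_maps R V S \<and> g \<in> chain_maps R S W \<and>
     (\<forall>n. short_exact R (obj V n) (f n) (obj S n) (g n) (obj W n))"

definition ext_closure_cpx :: "('r, 'm) chain_cpx set" where
  "ext_closure_cpx = {C \<in> complexes R U. \<forall>n. obj C n \<in> ext_closure}"

text \<open>A map P_n -> C_n extends to a chain map from the disc on P_n in degrees n and n - 1,
  given by the differential of C in the lower degree. Their sum \<open>g\<close> is onto because its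
  first component already is. Its kernel in degree n is an extension of P_{n+1} by the kernel of the
  n-th cover, hence stays in the closure.\<close>

lemma cover_cpx:
  assumes C: "C \<in> ext_closure_cpx"
  shows "\<exists>K\<in>ext_closure_cpx. \<exists>S\<in>tilde_class R U \<A>. \<exists>f g. short_exact_cpx K f S g C"
proof -
  have Cc: "C \<in> complexes R U" and Ce: "obj C n \<in> ext_closure" for n
    using C by (auto simp: ext_closure_cpx_def)
  note c = complexesD[OF Cc]
  have "\<forall>n. \<exists>P \<pi>. projective R U P \<and> lin R P (obj C n) \<pi> \<and> \<pi> ` carrier P = carrier (obj C n) \<and>
    ker_mod P (obj C n) \<pi> \<in> ext_closure"
    using ext_closure_cover[OF Ce] by blast
  then obtain P \<pi> where P: "\<forall>n. projective R U (P n) \<and> lin R (P n) (obj C n) (\<pi> n) \<and>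
    \<pi> n ` carrier (P n) = carrier (obj C n) \<and> ker_mod (P n) (obj C n) (\<pi> n) \<in> ext_closure"
    by metis
  have PA: "\<forall>n. P n \<in> \<A>" using P projective_A by blast
  have PL: "P n \<in> LM" for n using PA A_LM by blast
  note mC = LM_left_module[OF c(1)] and mP = LM_left_module[OF PL]
  have \<pi>: "lin R (P n) (obj C n) (\<pi> n)" "\<pi> n ` carrier (P n) = carrier (obj C n)" for n using P by auto
  define S where "S = disc_sum P"
  have S: "S \<in> tilde_class R U \<A>" unfolding S_def by (rule disc_sum_tilde[OF PA])
  note s = complexesD[OF tildeD(1)[OF S]]
  have oS: "obj S n = dsum (P n) (P (n + 1))"
    and dS: "diff S n z = dpair (P (n - 1)) (P n) \<zero>\<^bsub>P (n - 1)\<^esub> (dfst (P n) (P (n + 1)) z)" for n z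
    by (simp_all add: S_def disc_sum_def)
  define g where "g n z = \<pi> n (dfst (P n) (P (n + 1)) z) \<oplus>\<^bsub>obj C n\<^esub> diff C (n + 1) (\<pi> (n + 1) (dsnd (P n) (P (n + 1)) z))" for n z
  have dC: "lin R (obj C (n + 1)) (obj C n) (diff C (n + 1))" for n using c(2)[of "n + 1"] by simp
  have b: "lin R (P (n + 1)) (obj C n) (\<lambda>x. diff C (n + 1) (\<pi> (n + 1) x))" for n
    by (rule lin_comp[OF \<pi>(1) dC])
  \<comment> \<open>The horseshoe is applied to C_n as an extension of the zero module by itself;
    every map from P_{n+1} to C_n is then an admissible lift.\<close>
  have se: "short_exact R (obj C n) (\<lambda>x. x) (obj C n) (\<lambda>x. \<zero>\<^bsub>obj C n\<^esub>) (zero_mod (obj C n))" for n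
  proof (rule short_exactI)
    show "lin R (obj C n) (zero_mod (obj C n)) (\<lambda>x. \<zero>\<^bsub>obj C n\<^esub>)"
      using lin_const_zero[OF LM_left_module[OF zero_LM[OF c(1)]]] by simp
    show "(\<lambda>x. \<zero>\<^bsub>obj C n\<^esub>) ` carrier (obj C n) = carrier (zero_mod (obj C n))"
      using lin_zero_mem[OF mC] by auto
  qed (simp_all add: lin_id)
  have hit0: "(\<lambda>x. \<zero>\<^bsub>obj C n\<^esub>) ` carrier (P (n + 1)) = carrier (zero_mod (obj C n))" for n
    using lin_zero_mem[OF mP] by auto
  have gl: "lin R (obj S n) (obj C n) (g n)" and gs: "g n ` carrier (obj S n) = carrier (obj C n)"
    and gk: "short_exact R (ker_mod (P n) (obj C n) (\<pi> n)) (\<lambda>x. dpair (P n) (P (n + 1)) x \<zero>\<^bsub>P (n + 1)\<^esub>)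
      (ker_mod (obj S n) (obj C n) (g n)) (dsnd (P n) (P (n + 1))) (P (n + 1))" for n
    using horseshoe_kernel[OF c(1)[of n] c(1)[of n] zero_LM[OF c(1)[of n]] PL[of n] PL[of "n + 1"] se[of n]
        \<pi>[of n] b[of n] hit0[of n]]
    unfolding oS g_def by (simp_all add: a_kernel_def')
  have gchain: "g \<in> chain_maps R S C"
  proof (rule chain_mapsI[OF gl])
    fix n z assume "z \<in> carrier (obj S n)"
    then obtain x y where xy: "x \<in> carrier (P n)" "y \<in> carrier (P (n + 1))" "z = dpair (P n) (P (n + 1)) x y"
      using dsum_cases[OF PL PL] unfolding oS by metis
    interpret L: left_module R "obj C n" by (rule mC)
    interpret L': left_module R "obj C (n - 1)" by (rule mC)
    have z: "\<zero>\<^bsub>P (n - 1)\<^esub> \<in> carrier (P (n - 1))" by (rule lin_zero_mem[OF mP])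
    have p: "\<pi> n x \<in> carrier (obj C n)" by (rule lin_closed[OF \<pi>(1) xy(1)])
    have q: "\<pi> (n + 1) y \<in> carrier (obj C (n + 1))" by (rule lin_closed[OF \<pi>(1) xy(2)])
    have dq: "diff C (n + 1) (\<pi> (n + 1) y) \<in> carrier (obj C n)" by (rule lin_closed[OF dC q])
    have ddq: "diff C n (diff C (n + 1) (\<pi> (n + 1) y)) = \<zero>\<^bsub>obj C (n - 1)\<^esub>" using c(3)[OF q] by simp
    have dp: "diff C n (\<pi> n x) \<in> carrier (obj C (n - 1))" by (rule lin_closed[OF c(2) p])
    have "diff S n z = dpair (P (n - 1)) (P n) \<zero>\<^bsub>P (n - 1)\<^esub> x"
      unfolding dS xy(3) dfst_dpair[OF PL PL xy(1,2)] ..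
    then have "g (n - 1) (diff S n z) = \<pi> (n - 1) \<zero>\<^bsub>P (n - 1)\<^esub> \<oplus>\<^bsub>obj C (n - 1)\<^esub> diff C n (\<pi> n x)"
      using dfst_dpair[OF PL PL z xy(1)] dsnd_dpair[OF PL PL z xy(1)] by (simp add: g_def)
    also have "\<dots> = diff C n (\<pi> n x)" using dp lin_zero[OF \<pi>(1) mP mC] by simp
    also have "\<dots> = diff C n (g n z)"
      unfolding g_def xy(3) dfst_dpair[OF PL PL xy(1,2)] dsnd_dpair[OF PL PL xy(1,2)]
      using lin_add[OF c(2) p dq] ddq dp by simp
    finally show "g (n - 1) (diff S n z) = diff C n (g n z)" .
  qed
  define K :: "('r, 'm) chain_cpx" where "K = \<lparr>obj = (\<lambda>n. ker_mod (obj S n) (obj C n) (g n)), diff = diff S\<rparr>"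
  have oK: "obj K n = ker_mod (obj S n) (obj C n) (g n)" and dK: "diff K n = diff S n" for n by (simp_all add: K_def)
  have cK: "carrier (obj K n) = {z \<in> carrier (obj S n). g n z = \<zero>\<^bsub>obj C n\<^esub>}" for n by (simp add: oK a_kernel_def')
  have KL: "obj K n \<in> LM" for n unfolding oK by (rule ker_LM[OF s(1) c(1) gl])
  have "K \<in> complexes R U"
  proof (rule complexesI[OF KL])
    fix n
    have "diff S n ` carrier (obj K n) \<subseteq> carrier (obj K (n - 1))"
    proof (rule image_subsetI)
      fix z assume z: "z \<in> carrier (obj K n)"
      then have zS: "z \<in> carrier (obj S n)" by (simp add: cK)
      have "g (n - 1) (diff S n z) = diff C n \<zero>\<^bsub>obj C n\<^esub>"
        using chain_mapsD(2)[OF gchain zS] z by (simp add: cK)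
      then show "diff S n z \<in> carrier (obj K (n - 1))"
        using lin_closed[OF s(2) zS] lin_zero[OF c(2) mC mC] by (simp add: cK)
    qed
    then show "lin R (obj K n) (obj K (n - 1)) (diff K n)"
      unfolding dK oK by (intro lin_into lin_restrict[OF s(2)]) (auto simp: a_kernel_def')
    fix z assume "z \<in> carrier (obj K n)"
    then have "z \<in> carrier (obj S n)" by (simp add: cK)
    then show "diff K (n - 1) (diff K n z) = \<zero>\<^bsub>obj K (n - 2)\<^esub>" using s(3) by (simp add: dK oK)
  qed
  moreover have "obj K n \<in> ext_closure" for n
  proof (rule ext_closure.extension[OF _ _ KL gk[folded oK]])
    show "ker_mod (P n) (obj C n) (\<pi> n) \<in> ext_closure" using P by blast
    show "P (n + 1) \<in> ext_closure" using PA ext_closure.from_A by blast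
  qed
  ultimately have K: "K \<in> ext_closure_cpx" by (simp add: ext_closure_cpx_def)
  have "(\<lambda>n x. x) \<in> chain_maps R K S"
    by (rule chain_mapsI) (auto simp: oK dK a_kernel_def' intro!: lin_subset)
  then have "short_exact_cpx K (\<lambda>n x. x) S g C"
    unfolding short_exact_cpx_def oK using gchain short_exact_ker[OF gl gs] by blast
  then show ?thesis using K S by blast
qed

text \<open>Dual to the cover. The index shift places I_n in degrees n + 1 and n, since chain maps
  into a disc are determined in its lower degree. The cokernel in degree n is an extension of Q_n by
  I_{n-1}.\<close>

lemma hull_cpx:
  assumes C: "C \<in> ext_closure_cpx"
  shows "\<exists>L\<in>ext_closure_cpx. \<exists>S\<in>tilde_class R U \<A>. \<exists>f g. short_exact_cpx C f S g L"
proof -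
  have Cc: "C \<in> complexes R U" and Ce: "obj C n \<in> ext_closure" for n
    using C by (auto simp: ext_closure_cpx_def)
  note c = complexesD[OF Cc]
  have "\<forall>n. \<exists>I e Q q. I \<in> \<A> \<inter> \<B> \<and> Q \<in> ext_closure \<and> short_exact R (obj C n) e I q Q"
    using ext_closure_hull[OF Ce] by blast
  then obtain I e Q q where I: "\<forall>n. I n \<in> \<A> \<inter> \<B> \<and> Q n \<in> ext_closure \<and> short_exact R (obj C n) (e n) (I n) (q n) (Q n)"
    by metis
  have IA: "I n \<in> \<A>" and IL: "I n \<in> LM" and QE: "Q n \<in> ext_closure" and QL: "Q n \<in> LM"
    and se: "short_exact R (obj C n) (e n) (I n) (q n) (Q n)" for n
    using I A_LM ext_closure_LM by blast+
  note mC = LM_left_module[OF c(1)] and mI = LM_left_module[OF IL]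
  note sI = short_exactD[OF se]
  define S where "S = disc_sum (\<lambda>n. I (n - 1))"
  have S: "S \<in> tilde_class R U \<A>" unfolding S_def by (rule disc_sum_tilde) (simp add: IA)
  note s = complexesD[OF tildeD(1)[OF S]]
  have oS: "obj S n = dsum (I (n - 1)) (I n)"
    and dS: "diff S n z = dpair (I (n - 2)) (I (n - 1)) \<zero>\<^bsub>I (n - 2)\<^esub> (dfst (I (n - 1)) (I n) z)" for n z
    by (simp_all add: S_def disc_sum_def)
  define f where "f n x = dpair (I (n - 1)) (I n) (e (n - 1) (diff C n x)) (e n x)" for n x
  have t: "lin R (obj C n) (I (n - 1)) (\<lambda>x. e (n - 1) (diff C n x))" for n
    by (rule lin_comp[OF c(2) sI(1)])
  have step: "\<exists>L s a b. L \<in> LM \<and> short_exact R (obj C n) (f n) (obj S n) s L \<and> short_exact R (I (n - 1)) a L b (Q n)" for n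
  proof -
    \<comment> \<open>Here the horseshoe starts from the zero submodule, so the component
      \<open>e (n - 1)\<close> after the differential may be any map; injectivity of
      \<open>f\<close> comes from \<open>e n\<close>.\<close>
    have Z: "zero_mod (obj C n) \<in> LM" by (rule zero_LM[OF c(1)])
    have cz: "\<zero>\<^bsub>obj C n\<^esub> \<in> carrier (obj C n)" by (rule lin_zero_mem[OF mC])
    have t0: "e (n - 1) (diff C n \<zero>\<^bsub>obj C n\<^esub>) = \<zero>\<^bsub>I (n - 1)\<^esub>" by (rule lin_zero[OF t mC mI])
    have "short_exact R (zero_mod (obj C n)) (\<lambda>x. x) (obj C n) (\<lambda>x. x) (obj C n)"
      by (rule short_exactI) (auto simp: lin_id cz intro: lin_subset)
    moreover have "short_exact R (zero_mod (obj C n)) (\<lambda>x. e (n - 1) (diff C n x)) (I (n - 1)) (\<lambda>x. x) (I (n - 1))"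
      by (rule short_exactI) (auto simp: lin_id t0 cz intro!: lin_restrict[OF t])
    ultimately show ?thesis
      using horseshoe_cokernel[OF Z c(1) c(1) IL IL IL QL _ t _ se] unfolding oS f_def by blast
  qed
  then have "\<forall>n. \<exists>L s. L \<in> ext_closure \<and> short_exact R (obj C n) (f n) (obj S n) s L"
    using ext_closure.extension[OF ext_closure.from_A[OF IA] QE] by meson
  then obtain L g where Lg: "\<forall>n. L n \<in> ext_closure \<and> short_exact R (obj C n) (f n) (obj S n) (g n) (L n)"
    by metis
  have LE: "L n \<in> ext_closure" and LL: "L n \<in> LM" and sL: "short_exact R (obj C n) (f n) (obj S n) (g n) (L n)" for n
    using Lg ext_closure_LM by blast+
  note g = short_exactD[OF sL] and mL = LM_left_module[OF LL] and mS = LM_left_module[OF s(1)]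
  have fchain: "f \<in> chain_maps R C S"
  proof (rule chain_mapsI[OF g(1)])
    fix n x assume x: "x \<in> carrier (obj C n)"
    have dx: "diff C n x \<in> carrier (obj C (n - 1))" by (rule lin_closed[OF c(2) x])
    have "f (n - 1) (diff C n x) = dpair (I (n - 2)) (I (n - 1)) (e (n - 2) (diff C (n - 1) (diff C n x))) (e (n - 1) (diff C n x))"
      by (simp add: f_def)
    also have "\<dots> = dpair (I (n - 2)) (I (n - 1)) \<zero>\<^bsub>I (n - 2)\<^esub> (e (n - 1) (diff C n x))"
      using c(3)[OF x] lin_zero[OF sI(1) mC mI] by simp
    also have "\<dots> = diff S n (f n x)"
      unfolding dS f_def dfst_dpair[OF IL IL lin_closed[OF t x] lin_closed[OF sI(1) x]] ..
    finally show "f (n - 1) (diff C n x) = diff S n (f n x)" .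
  qed
  \<comment> \<open>The cokernels were obtained degree by degree, so their differentials must be
    induced afterwards; this works because \<open>f\<close> is a chain map.\<close>
  have "\<exists>k. lin R (L n) (L (n - 1)) k \<and> (\<forall>z\<in>carrier (obj S n). k (g n z) = g (n - 1) (diff S n z))" for n
  proof (rule lin_factor[OF g(2,7) lin_comp[OF s(2) g(2)] mS mL mL], intro ballI impI)
    fix z assume "z \<in> carrier (obj S n)" "g n z = \<zero>\<^bsub>L n\<^esub>"
    then obtain x where x: "x \<in> carrier (obj C n)" "z = f n x" using g(6) by blast
    then have "diff S n z = f (n - 1) (diff C n x)" using chain_mapsD(2)[OF fchain] by simp
    then show "g (n - 1) (diff S n z) = \<zero>\<^bsub>L (n - 1)\<^esub>" using g(5) lin_closed[OF c(2) x(1)] by simp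
  qed
  then have "\<forall>n. \<exists>k. lin R (L n) (L (n - 1)) k \<and> (\<forall>z\<in>carrier (obj S n). k (g n z) = g (n - 1) (diff S n z))"
    by blast
  from choice[OF this] obtain k where k: "\<forall>n. lin R (L n) (L (n - 1)) (k n) \<and>
      (\<forall>z\<in>carrier (obj S n). k n (g n z) = g (n - 1) (diff S n z))" by blast
  have kl: "lin R (L n) (L (n - 1)) (k n)" and kg: "\<forall>z\<in>carrier (obj S n). k n (g n z) = g (n - 1) (diff S n z)" for n
    using k by auto
  define D :: "('r, 'm) chain_cpx" where "D = \<lparr>obj = L, diff = k\<rparr>"
  have D: "obj D n = L n" "diff D n = k n" for n by (simp_all add: D_def)
  have "D \<in> complexes R U"
  proof (rule complexesI, unfold D)
    fix n
    show "L n \<in> LM" by (rule LL)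
    show "lin R (L n) (L (n - 1)) (k n)" by (rule kl)
    fix x assume "x \<in> carrier (L n)"
    then obtain z where z: "z \<in> carrier (obj S n)" "x = g n z" using g(7) by (metis imageE)
    have dz: "diff S n z \<in> carrier (obj S (n - 1))" by (rule lin_closed[OF s(2) z(1)])
    have "k (n - 1) (k n x) = g (n - 1 - 1) (diff S (n - 1) (diff S n z))"
      using kg[of n] kg[of "n - 1"] z dz by simp
    also have "\<dots> = \<zero>\<^bsub>L (n - 2)\<^esub>" using s(3)[OF z(1)] lin_zero[OF g(2) mS mL] by simp
    finally show "k (n - 1) (k n x) = \<zero>\<^bsub>L (n - 2)\<^esub>" .
  qed
  then have DE: "D \<in> ext_closure_cpx" using LE by (simp add: ext_closure_cpx_def D)
  have "g \<in> chain_maps R S D"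
    by (rule chain_mapsI, unfold D) (use g(2) kg in auto)
  then have "short_exact_cpx C f S g D"
    unfolding short_exact_cpx_def D using fchain sL by blast
  then show ?thesis using DE S by blast
qed

text \<open>Covers and hulls both stay in the class, so each can be iterated from \<open>C\<close>,
  giving syzygies on one side and cosyzygies on the other.\<close>

lemma exact_splicing:
  assumes C: "C \<in> ext_closure_cpx"
  shows "\<exists>W S f g. W 0 = C \<and> (\<forall>i::int. W i \<in> ext_closure_cpx \<and> S i \<in> tilde_class R U \<A> \<and>
    short_exact_cpx (W (i + 1)) (f i) (S i) (g i) (W i))"
proof -
  have "\<forall>C\<in>ext_closure_cpx. \<exists>K. K \<in> ext_closure_cpx \<and> (\<exists>S\<in>tilde_class R U \<A>. \<exists>f g. short_exact_cpx K f S g C)"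
    using cover_cpx by blast
  from bchoice[OF this] obtain l where l: "\<forall>C\<in>ext_closure_cpx. l C \<in> ext_closure_cpx \<and>
    (\<exists>S\<in>tilde_class R U \<A>. \<exists>f g. short_exact_cpx (l C) f S g C)" by blast
  have "\<forall>C\<in>ext_closure_cpx. \<exists>L. L \<in> ext_closure_cpx \<and> (\<exists>S\<in>tilde_class R U \<A>. \<exists>f g. short_exact_cpx C f S g L)"
    using hull_cpx by blast
  from bchoice[OF this] obtain r where r: "\<forall>C\<in>ext_closure_cpx. r C \<in> ext_closure_cpx \<and>
    (\<exists>S\<in>tilde_class R U \<A>. \<exists>f g. short_exact_cpx C f S g (r C))" by blast
  define W where "W i = (if i \<ge> 0 then (l ^^ nat i) C else (r ^^ nat (- i)) C)" for i :: int
  have lE: "(l ^^ n) C \<in> ext_closure_cpx" and rE: "(r ^^ n) C \<in> ext_closure_cpx" for n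
    by (induction n) (use C l r in auto)
  have WE: "W i \<in> ext_closure_cpx" for i using lE rE by (simp add: W_def)
  have "\<exists>S. \<exists>f g. S \<in> tilde_class R U \<A> \<and> short_exact_cpx (W (i + 1)) f S g (W i)" for i
  proof (cases "i \<ge> 0")
    case True
    then have "W (i + 1) = l (W i)" by (simp add: W_def nat_add_distrib)
    moreover obtain S f g where "S \<in> tilde_class R U \<A>" "short_exact_cpx (l (W i)) f S g (W i)"
      using bspec[OF l WE[of i]] by blast
    ultimately show ?thesis by metis
  next
    case False
    then have "nat (- i) = Suc (nat (- (i + 1)))" by simp
    then have "W i = r (W (i + 1))" using False by (auto simp: W_def)
    moreover obtain S f g where "S \<in> tilde_class R U \<A>" "short_exact_cpx (W (i + 1)) f S g (r (W (i + 1)))"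
      using bspec[OF r WE[of "i + 1"]] by blast
    ultimately show ?thesis by metis
  qed
  then have "\<forall>i. \<exists>S f g. S \<in> tilde_class R U \<A> \<and> short_exact_cpx (W (i + 1)) f S g (W i)" by blast
  then obtain S f g where "\<forall>i. S i \<in> tilde_class R U \<A> \<and> short_exact_cpx (W (i + 1)) (f i) (S i) (g i) (W i)"
    by metis
  moreover have "W 0 = C" by (simp add: W_def)
  ultimately show ?thesis using WE by blast
qed

text \<open>
  A chain map \<open>\<phi>\<close> into a complex with contraction \<open>s\<close> and differential \<open>\<delta>\<close> satisfies
  \<open>\<phi>\<^sub>n = \<delta>s\<phi>\<^sub>n + s(\<delta>s\<phi>\<^sub>n\<^sub>-\<^sub>1)\<delta>\<close>, and the right-hand side is a chain map for any family of linear maps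
  in place of \<open>\<phi>\<close>. So degreewise extensions suffice.
\<close>

lemma contractible_extension:
  assumes X: "X \<in> complexes R U" and Y: "Y \<in> complexes R U" and H: "H \<in> complexes R U"
    and s: "contraction R H s" and d: "d \<in> chain_maps R X Y" and \<phi>: "\<phi> \<in> chain_maps R X H"
    and w: "\<forall>n. lin R (obj Y n) (obj H n) (w n)" "\<forall>n. \<forall>x\<in>carrier (obj X n). w n (d n x) = \<phi> n x"
  shows "\<exists>\<psi>\<in>chain_maps R Y H. \<forall>n. \<forall>x\<in>carrier (obj X n). \<psi> n (d n x) = \<phi> n x"
proof -
  note cX = complexesD[OF X] and cY = complexesD[OF Y] and cH = complexesD[OF H]
  note mH = LM_left_module[OF cH(1)] and mY = LM_left_module[OF cY(1)]
  note dm = chain_mapsD[OF d] and \<phi>m = chain_mapsD[OF \<phi>]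
  have sl: "lin R (obj H k) (obj H (k + 1)) (s k)"
    and sc: "x \<in> carrier (obj H k) \<Longrightarrow> diff H (k + 1) (s k x) \<oplus>\<^bsub>obj H k\<^esub> s (k - 1) (diff H k x) = x" for k x
    using s by (auto simp: contraction_def)
  have sl': "lin R (obj H (k - 1)) (obj H k) (s (k - 1))" for k using sl[of "k - 1"] by simp
  have dl: "lin R (obj H (k + 1)) (obj H k) (diff H (k + 1))" for k using cH(2)[of "k + 1"] by simp
  \<comment> \<open>On cycles the second term of the homotopy identity drops out.\<close>
  have cyc: "diff H (k + 1) (s k x) = x" if x: "x \<in> carrier (obj H k)" "diff H k x = \<zero>\<^bsub>obj H (k - 1)\<^esub>" for k x
  proof -
    interpret L: left_module R "obj H k" by (rule mH)
    have "diff H (k + 1) (s k x) \<oplus>\<^bsub>obj H k\<^esub> \<zero>\<^bsub>obj H k\<^esub> = x"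
      using sc[OF x(1)] x(2) lin_zero[OF sl' mH mH] by simp
    then show ?thesis using lin_closed[OF dl lin_closed[OF sl x(1)]] by simp
  qed
  \<comment> \<open>The family \<open>w\<close> need not commute with differentials, but
    \<open>\<chi>\<close> takes values in cycles, and this is what makes \<open>\<psi>\<close> below
    a chain map.\<close>
  define \<chi> where "\<chi> n y = diff H (n + 1) (s n (w n y))" for n y
  have \<chi>l: "lin R (obj Y n) (obj H n) (\<chi> n)" for n
    unfolding \<chi>_def by (rule lin_comp[OF lin_comp[OF w(1)[rule_format] sl] dl])
  have \<chi>0: "diff H n (\<chi> n y) = \<zero>\<^bsub>obj H (n - 1)\<^esub>" if y: "y \<in> carrier (obj Y n)" for n y
    using cH(3)[OF lin_closed[OF sl lin_closed[OF w(1)[rule_format] y]]] by (simp add: \<chi>_def)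
  define \<psi> where "\<psi> n y = \<chi> n y \<oplus>\<^bsub>obj H n\<^esub> s (n - 1) (\<chi> (n - 1) (diff Y n y))" for n y
  have "\<psi> \<in> chain_maps R Y H"
  proof (rule chain_mapsI)
    fix n
    show "lin R (obj Y n) (obj H n) (\<psi> n)"
      unfolding \<psi>_def by (rule lin_plus[OF \<chi>l lin_comp[OF lin_comp[OF cY(2) \<chi>l] sl'] mH])
    fix y assume y: "y \<in> carrier (obj Y n)"
    interpret L: left_module R "obj H (n - 1)" by (rule mH)
    have dy: "diff Y n y \<in> carrier (obj Y (n - 1))" by (rule lin_closed[OF cY(2) y])
    have \<chi>d: "\<chi> (n - 1) (diff Y n y) \<in> carrier (obj H (n - 1))" by (rule lin_closed[OF \<chi>l dy])
    have "\<chi> (n - 1 - 1) (diff Y (n - 1) (diff Y n y)) = \<zero>\<^bsub>obj H (n - 1 - 1)\<^esub>"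
      using cY(3)[OF y] lin_zero[OF \<chi>l mY mH, of "n - 2"] by simp
    then have "\<psi> (n - 1) (diff Y n y) = \<chi> (n - 1) (diff Y n y)"
      using \<chi>d lin_zero[OF sl' mH mH, of "n - 1"] by (simp add: \<psi>_def)
    also have "\<dots> = diff H (n - 1 + 1) (s (n - 1) (\<chi> (n - 1) (diff Y n y)))"
      by (rule cyc[symmetric, OF \<chi>d \<chi>0[OF dy]])
    also have "\<dots> = diff H n (\<psi> n y)"
      using \<chi>0[OF y] \<chi>d lin_closed[OF cH(2) lin_closed[OF sl' \<chi>d]]
        lin_add[OF cH(2) lin_closed[OF \<chi>l y] lin_closed[OF sl' \<chi>d]] by (simp add: \<psi>_def)
    finally show "\<psi> (n - 1) (diff Y n y) = diff H n (\<psi> n y)" .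
  qed
  moreover have "\<psi> n (d n x) = \<phi> n x" if x: "x \<in> carrier (obj X n)" for n x
  proof -
    have dx: "diff X n x \<in> carrier (obj X (n - 1))" by (rule lin_closed[OF cX(2) x])
    have \<phi>x: "\<phi> n x \<in> carrier (obj H n)" by (rule lin_closed[OF \<phi>m(1) x])
    have "\<chi> n (d n x) = diff H (n + 1) (s n (\<phi> n x))" using w(2) x by (simp add: \<chi>_def)
    moreover have "\<chi> (n - 1) (diff Y n (d n x)) = diff H n (\<phi> n x)"
    proof -
      have "\<chi> (n - 1) (diff Y n (d n x)) = \<chi> (n - 1) (d (n - 1) (diff X n x))" using dm(2)[OF x] by simp
      also have "\<dots> = diff H (n - 1 + 1) (s (n - 1) (diff H n (\<phi> n x)))"
        using w(2) dx \<phi>m(2)[OF x] by (simp add: \<chi>_def)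
      also have "\<dots> = diff H n (\<phi> n x)"
        by (rule cyc[OF lin_closed[OF cH(2) \<phi>x]]) (use cH(3)[OF \<phi>x] in simp)
      finally show ?thesis .
    qed
    ultimately show ?thesis using sc[OF \<phi>x] by (simp add: \<psi>_def)
  qed
  ultimately show ?thesis by blast
qed

text \<open>Hom-exactness holds because a chain map \<phi> on S_i that kills the image of S_{i+1}
  factors in each degree through W_i, and then extends from W_i to S_{i-1} since Ext^1 from the
  terms of W_{i-1} to \<A> \<inter> \<B> vanishes. \<open>contractible_extension\<close> turns these
  unrelated extensions into a chain map.\<close>

lemma gorenstein_complexI:
  assumes C: "C \<in> ext_closure_cpx"
  shows "C \<in> gorenstein_complexes R U \<A> \<B>"
proof -
  from exact_splicing[OF C] obtain W S f g where W0: "W 0 = C"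
    and WS: "\<forall>i::int. W i \<in> ext_closure_cpx \<and> S i \<in> tilde_class R U \<A> \<and>
    short_exact_cpx (W (i + 1)) (f i) (S i) (g i) (W i)" by blast
  have Wc: "W i \<in> complexes R U" and WE: "obj (W i) n \<in> ext_closure" and S: "S i \<in> tilde_class R U \<A>"
    and f: "f i \<in> chain_maps R (W (i + 1)) (S i)" and g: "g i \<in> chain_maps R (S i) (W i)"
    and se: "short_exact R (obj (W (i + 1)) n) (f i n) (obj (S i) n) (g i n) (obj (W i) n)" for i n
    using WS by (auto simp: ext_closure_cpx_def short_exact_cpx_def)
  have Sc: "S i \<in> complexes R U" for i by (rule tildeD(1)[OF S])
  note cS = complexesD[OF Sc] and cW = complexesD[OF Wc]
  have f': "f (i - 1) \<in> chain_maps R (W i) (S (i - 1))"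
    and se': "short_exact R (obj (W i) n) (f (i - 1) n) (obj (S (i - 1)) n) (g (i - 1) n) (obj (W (i - 1)) n)" for i n
    using f[of "i - 1"] se[of "i - 1" n] by simp_all
  note e = short_exactD[OF se] and e' = short_exactD[OF se']
  define d where "d i n x = f (i - 1) n (g i n x)" for i n x
  have d: "d i \<in> chain_maps R (S i) (S (i - 1))" for i
    using chain_maps_comp[OF g f'] unfolding d_def .
  have gs: "g i n ` carrier (obj (S i) n) = carrier (obj (W i) n)" for i n by (rule e(7))
  have dim: "d i n ` carrier (obj (S i) n) = f (i - 1) n ` carrier (obj (W i) n)" for i n
    unfolding d_def gs[symmetric] by (simp add: image_image)
  have d0: "d i n x = \<zero>\<^bsub>obj (S (i - 1)) n\<^esub> \<longleftrightarrow> g i n x = \<zero>\<^bsub>obj (W i) n\<^esub>" if x: "x \<in> carrier (obj (S i) n)" for i n x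
  proof -
    have f0: "f (i - 1) n \<zero>\<^bsub>obj (W i) n\<^esub> = \<zero>\<^bsub>obj (S (i - 1)) n\<^esub>"
      by (rule lin_zero[OF e'(1) LM_left_module[OF cW(1)] LM_left_module[OF cS(1)]])
    have gx: "g i n x \<in> carrier (obj (W i) n)" by (rule lin_closed[OF e(2) x])
    show ?thesis
      using inj_onD[OF e'(3) _ gx lin_zero_mem[OF LM_left_module[OF cW(1)]]] f0 by (auto simp: d_def)
  qed
  have dker: "d (i + 1) n ` carrier (obj (S (i + 1)) n) =
      {x \<in> carrier (obj (S i) n). d i n x = \<zero>\<^bsub>obj (S (i - 1)) n\<^esub>}" for i n
  proof -
    have "d (i + 1) n ` carrier (obj (S (i + 1)) n) = f i n ` carrier (obj (W (i + 1)) n)"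
      using dim[of "i + 1" n] by simp
    also have "\<dots> = {x \<in> carrier (obj (S i) n). d i n x = \<zero>\<^bsub>obj (S (i - 1)) n\<^esub>}"
      unfolding e(4) using d0 by auto
    finally show ?thesis .
  qed
  have ex: "exact_seq S d" unfolding exact_seq_def exact_at_def a_kernel_def' using dker by blast
  have dd: "\<forall>i n. \<forall>x\<in>carrier (obj (S (i + 1)) n). d i n (d (i + 1) n x) = \<zero>\<^bsub>obj (S (i - 1)) n\<^esub>"
    using dker by blast
  have "seq_hom_into_exact R S d H" if H: "H \<in> tilde_class R U \<A> \<inter> dg_tilde_class R U \<A> \<B>" for H
  proof -
    have Hc: "H \<in> complexes R U" using tildeD(1) H by blast
    obtain s where s: "contraction R H s" using tilde_dg_contractible(1)[OF H] by blast
    note cH = complexesD[OF Hc]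
    have "\<exists>\<psi>\<in>chain_maps R (S (i - 1)) H. \<forall>n. \<forall>x\<in>carrier (obj (S i) n). \<psi> n (d i n x) = \<phi> n x"
      if \<phi>: "\<phi> \<in> chain_maps R (S i) H"
        and kill: "\<forall>n. \<forall>x\<in>carrier (obj (S (i + 1)) n). \<phi> n (d (i + 1) n x) = \<zero>\<^bsub>obj H n\<^esub>" for i \<phi>
    proof -
      have "\<exists>w. lin R (obj (S (i - 1)) n) (obj H n) w \<and> (\<forall>x\<in>carrier (obj (S i) n). w (d i n x) = \<phi> n x)" for n
      proof -
        have "\<forall>x\<in>carrier (obj (S i) n). g i n x = \<zero>\<^bsub>obj (W i) n\<^esub> \<longrightarrow> \<phi> n x = \<zero>\<^bsub>obj H n\<^esub>"
        proof (intro ballI impI)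
          fix x assume x: "x \<in> carrier (obj (S i) n)" "g i n x = \<zero>\<^bsub>obj (W i) n\<^esub>"
          then have "x \<in> d (i + 1) n ` carrier (obj (S (i + 1)) n)" unfolding dker using d0 by simp
          then show "\<phi> n x = \<zero>\<^bsub>obj H n\<^esub>" using kill by blast
        qed
        from lin_factor[OF e(2,7) chain_mapsD(1)[OF \<phi>] LM_left_module[OF cS(1)] LM_left_module[OF cW(1)]
            LM_left_module[OF cH(1)] this]
        obtain u where u: "lin R (obj (W i) n) (obj H n) u" "\<forall>x\<in>carrier (obj (S i) n). u (g i n x) = \<phi> n x"
          by blast
        from ext_vanishD[OF ext_closure_ext_vanish[OF WE tilde_dg_contractible(2)[OF H]] cW(1) cS(1) se' u(1)]
        obtain w where w: "lin R (obj (S (i - 1)) n) (obj H n) w"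
          "\<forall>x\<in>carrier (obj (W i) n). w (f (i - 1) n x) = u x" by blast
        have "\<forall>x\<in>carrier (obj (S i) n). w (d i n x) = \<phi> n x"
          using w(2) u(2) lin_closed[OF e(2)] by (simp add: d_def)
        then show ?thesis using w(1) by blast
      qed
      then have "\<forall>n. \<exists>w. lin R (obj (S (i - 1)) n) (obj H n) w \<and> (\<forall>x\<in>carrier (obj (S i) n). w (d i n x) = \<phi> n x)"
        by blast
      from choice[OF this] obtain w where "\<forall>n. lin R (obj (S (i - 1)) n) (obj H n) (w n) \<and>
        (\<forall>x\<in>carrier (obj (S i) n). w n (d i n x) = \<phi> n x)" by blast
      then have w: "\<forall>n. lin R (obj (S (i - 1)) n) (obj H n) (w n)"
        "\<forall>n. \<forall>x\<in>carrier (obj (S i) n). w n (d i n x) = \<phi> n x" by auto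
      show ?thesis by (rule contractible_extension[OF Sc Sc Hc s d \<phi> w])
    qed
    then show ?thesis
      unfolding seq_hom_into_exact_iff[OF allI[OF Sc] allI[OF d] dd Hc] by blast
  qed
  \<comment> \<open>\<open>d 0\<close> is an epimorphism onto \<open>W 0 = C\<close> followed by the
    monomorphism into \<open>S (-1)\<close>, so its image is a copy of \<open>C\<close>.\<close>
  moreover have "cpx_iso R C (im_cpx (d 0) (S 0) (S (-1)))"
  proof -
    let ?I = "im_cpx (d 0) (S 0) (S (-1))"
    have fm: "f (-1) \<in> chain_maps R C (S (-1))" using f'[of 0] W0 by simp
    have cI: "carrier (obj ?I n) = f (-1) n ` carrier (obj C n)" for n
      using dim[of 0 n] W0 by (simp add: im_cpx_def im_module_def)
    have "f (-1) \<in> chain_maps R C ?I"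
    proof (rule chain_mapsI)
      fix n
      have "lin R (obj C n) ((obj (S (-1)) n)\<lparr>carrier := f (-1) n ` carrier (obj C n)\<rparr>) (f (-1) n)"
        by (rule lin_into[OF chain_mapsD(1)[OF fm]]) simp
      then show "lin R (obj C n) (obj ?I n) (f (-1) n)"
        using dim[of 0 n] W0 by (simp add: im_cpx_def im_module_def)
      fix x assume "x \<in> carrier (obj C n)"
      then show "f (-1) (n - 1) (diff C n x) = diff ?I n (f (-1) n x)"
        using chain_mapsD(2)[OF fm] by (simp add: im_cpx_def)
    qed
    moreover have "bij_betw (f (-1) n) (carrier (obj C n)) (carrier (obj ?I n))" for n
      using e'(3)[of 0 n] W0 unfolding cI by (simp add: bij_betw_def)
    ultimately show ?thesis unfolding cpx_iso_def by blast
  qed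
  moreover have "C \<in> complexes R U" using Wc[of 0] W0 by simp
  ultimately show ?thesis
    unfolding gorenstein_complexes_def mem_Collect_eq using S d ex by blast
qed

end

theorem theorem1p1:
  fixes R :: "('r, 's) ring_scheme"
    and U :: "'m set set"
    and \<A> \<B> :: "('r, 'm) module set"
    and C :: "('r, 'm) chain_cpx"
  assumes "ring R"
    and "module_universe R U"
    and "cotorsion_pair R U \<A> \<B>"
    and "complete_pair R U \<A> \<B>"
    and "hereditary_pair R U \<A> \<B>"
    and "C \<in> complexes R U"
  shows "C \<in> gorenstein_complexes R U \<A> \<B> \<longleftrightarrow>
    (\<forall>i. obj C i \<in> gorenstein_modules R U \<A> \<B>)"
proof -
  interpret cotorsion_category R U \<A> \<B>
    by (intro cotorsion_category.intro module_category.intro cotorsion_category_axioms.intro assms)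
  show ?thesis
  proof
    assume "C \<in> gorenstein_complexes R U \<A> \<B>"
    then show "\<forall>i. obj C i \<in> gorenstein_modules R U \<A> \<B>"
      using gorenstein_complex_obj by blast
  next
    assume "\<forall>i. obj C i \<in> gorenstein_modules R U \<A> \<B>"
    then have "C \<in> ext_closure_cpx"
      using assms(6) by (simp add: ext_closure_cpx_def ext_closure.from_G)
    then show "C \<in> gorenstein_complexes R U \<A> \<B>"
      by (rule gorenstein_complexI)
  qed
qed

end
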